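(* (Wick rule for a product of normal products of free noises.) In the setting and notation of the context, for any $l\in\mathbb N$ and $k_1,\dots,k_l\in\mathbb N$, with $n:=k_1+\dots+k_l$, $${:}\omega(t_1)\cdots\omega(t_{k_1}){:}\,{:}\omega(t_{k_1+1})\cdots\omega(t_{k_1+k_2}){:}\cdots{:}\omega(t_{k_1+\dots+k_{l-1}+1})\cdots\omega(t_n){:}=\sum{:}W(\varkappa)\omega(t_1)\omega(t_2)\cdots\omega(t_n){:}\,,$$ where the summation is over all $\varkappa\in G_n$ such that each block of the induced partition $\pi(\varkappa)$ of $\{1,\dots,n\}$ contains at most one element of each of the sets $\{1,\dots,k_1\}$, $\{k_1+1,\dots,k_1+k_2\}$, …, $\{k_1+\dots+k_{l-1}+1,\dots,n\}$. The formula is understood as equality of operators on $\mathcal F(\mathcal H)$ after smearing both sides with an arbitrary $f^{(n)}\in\mathcal D^{(n)}$.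
   Context: $T$ is a locally compact, second countable Hausdorff space without isolated points, $\sigma$ a Radon non-atomic measure on $T$ with $\sigma(O)>0$ for every non-empty open $O$. $\mathcal D^{(n)}=C_0(T^n)$ (real continuous functions with compact support), $\mathcal D^{(0)}=\mathbb R$. $\mathcal H=L^2(T,\sigma)$ (real), $\mathcal F(\mathcal H)=\mathbb R\oplus\bigoplus_{n\ge1}\mathcal H^{\otimes n}$ is the full Fock space, $\Omega=(1,0,0,\dots)$. A function $\lambda\in C(T)$ (real continuous) is fixed. Formally $\omega(t)=\partial_t^\dagger+\partial_t+\lambda(t)\partial_t^\dagger\partial_t$, where $\partial_t^\dagger,\partial_t$ are the creation and annihilation operators at the point $t$ with $\partial_s\partial_t^\dagger=\delta(s,t)$. Rigorously, smeared products are defined as follows. For a function $h(t_1,\dots,t_k;y_1,\dots,y_m)$ ($k\ge1$, all variables in $T$) put $(Ch)(t_1,\dots,t_{k-1};y_1,\dots,y_{m+1})=h(t_1,\dots,t_{k-1},y_1;y_2,\dots,y_{m+1})$ (corresponding to $\partial_{t_k}^\dagger$), $(Ah)(t_1,\dots,t_{k-1};y_1,\dots,y_{m-1})=\int_T\sigma(dt)\,h(t_1,\dots,t_{k-1},t;t,y_1,\dots,y_{m-1})$ (corresponding to $\partial_{t_k}$), $(Nh)(t_1,\dots,t_{k-1};y_1,\dots,y_m)=\lambda(y_1)h(t_1,\dots,t_{k-1},y_1;y_1,\dots,y_m)$ (corresponding to $\lambda(t_k)\partial_{t_k}^\dagger\partial_{t_k}$), with $Ah=Nh=0$ if $m=0$.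 For a word $w=(w_1,\dots,w_n)\in\{C,A,N\}^n$ and $f^{(n)}\in\mathcal D^{(n)}$, let $w(f^{(n)})$ be the bounded operator on $\mathcal F(\mathcal H)$ with $w(f^{(n)})g^{(m)}=w_1w_2\cdots w_n(f^{(n)}\otimes g^{(m)})$ ($w_n$ applied first), where $(f^{(n)}\otimes g^{(m)})(t;y)=f^{(n)}(t)g^{(m)}(y)$. Free Wick product: ${:}\omega(t_1)\cdots\omega(t_n){:}$ is obtained by formally expanding $\omega(t_1)\cdots\omega(t_n)$ and removing all terms containing $\partial_{t_i}\partial_{t_{i+1}}^\dagger$ for some $i$. Call a word of length $n$ normally ordered if it is one of the $2n+1$ words $C^n$, $C^{i-1}A^{n-i+1}$, $C^{i-1}NA^{n-i}$, $i=1,\dots,n$. The smearing of ${:}\omega(t_1)\cdots\omega(t_n){:}$ with $f^{(n)}$, denoted $\langle f^{(n)},{:}\omega^{\otimes n}{:}\rangle$, is the sum of $w(f^{(n)})$ over normally ordered $w$; for $n=0$, $\langle c,{:}\omega^{\otimes0}{:}\rangle=c\mathbf 1$. The smearing with $f^{(n)}$ of a product of Wick products of lengths $k_1,\dots,k_l$ is the sum of $w(f^{(n)})$ over all words $w$ of length $n$ that are concatenations of normally ordered words of lengths $k_1,\dots,k_l$ (in this order). Marked partitions: $NC(n,\pm1)$ is the set of all $\varkappa=\{(A_1,m_1),\dots,(A_k,m_k)\}$ where $\pi(\varkappa)=\{A_1,\dots,A_k\}$ is a non-crossing partition of $\{1,\dots,n\}$, $m_j\in\{-1,+1\}$, and $m_j=+1$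 whenever $A_j$ is a singleton. $G_n\subset NC(n,\pm1)$ consists of those $\varkappa$ for which there are no $i\ne j$ with $\min A_i<\min A_j\le\max A_j<\max A_i$ and $m_j=+1$. For $\varkappa\in G_n$, $W(\varkappa)\omega(t_1)\cdots\omega(t_n)$ is obtained from $\omega(t_1)\cdots\omega(t_n)$ thus: for each block $A_i=\{j_1<\dots<j_r\}$, if $m_i=-1$ replace $\omega(t_{j_1}),\dots,\omega(t_{j_r})$ by $\lambda^{r-2}(t_{j_1})\delta(t_{j_1},\dots,t_{j_r})$; if $m_i=+1$ keep $\omega(t_{j_1})$ and, if $r\ge2$, replace $\omega(t_{j_2}),\dots,\omega(t_{j_r})$ by $\lambda^{r-1}(t_{j_1})\delta(t_{j_1},\dots,t_{j_r})$; here $\int_{T^k}\sigma(dt_1)\cdots\sigma(dt_k)f^{(k)}(t_1,\dots,t_k)\delta(t_1,\dots,t_k)=\int_T\sigma(dt)f^{(k)}(t,\dots,t)$. Explicitly: let $B_1,\dots,B_p$ be the $+1$ blocks ordered by their minima and $D_1,\dots,D_q$ the $-1$ blocks; put $$f_\varkappa(u_1,\dots,u_p)=\int_{T^q}\sigma(dv_1)\cdots\sigma(dv_q)\,f^{(n)}(t_1,\dots,t_n)\prod_{j=1}^p\lambda(u_j)^{|B_j|-1}\prod_{j=1}^q\lambda(v_j)^{|D_j|-2},$$ where $t_i=u_j$ if $i\in B_j$, $t_i=v_j$ if $i\in D_j$ (and $\lambda^0=1$). Then the smearing of ${:}W(\varkappa)\omega(t_1)\cdots\omega(t_n){:}$ with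 $f^{(n)}$ is $\langle f_\varkappa,{:}\omega^{\otimes p}{:}\rangle$. *)

theory Defs
  imports "HOL-Analysis.Analysis"
begin

section \<open>The underlying measure space\<close>

text \<open>Borel, finite on compact sets, inner regular with respect to compact sets.\<close>
definition radon_measure :: "'a::topological_space measure \<Rightarrow> bool" where
  "radon_measure M \<longleftrightarrow>
     sets M = sets borel \<and>
     (\<forall>K. compact K \<longrightarrow> emeasure M K < \<infinity>) \<and>
     (\<forall>B\<in>sets borel. emeasure M B = (SUP K\<in>{K. compact K \<and> K \<subseteq> B}. emeasure M K))"

definition measure_atom :: "'a measure \<Rightarrow> 'a set \<Rightarrow> bool" where
  "measure_atom M A \<longleftrightarrow>
     A \<in> sets M \<and> emeasure M A > 0 \<and>
     (\<forall>B\<in>sets M. B \<subseteq> A \<longrightarrow> emeasure M B = 0 \<or> emeasure M (A - B) = 0)"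

definition nonatomic :: "'a measure \<Rightarrow> bool" where
  "nonatomic M \<longleftrightarrow> (\<nexists>A. measure_atom M A)"

section \<open>Test functions and Fock space\<close>

text \<open>
  A point of the n-fold power of T is, for the library's product topology and product measure, an
  extensional function x on {..<n}. Functions of a varying number of variables are written as
  functions on lists; a function of n variables is the restriction of such a function to the lists
  of length n, and its values on other lists are irrelevant.
\<close>
definition tup :: "nat \<Rightarrow> (nat \<Rightarrow> 'a) \<Rightarrow> 'a list" where
  "tup n x = map x [0..<n]"

abbreviation power_top :: "nat \<Rightarrow> (nat \<Rightarrow> 'a::topological_space) topology" where
  "power_top n \<equiv> product_topology (\<lambda>_. euclidean) {..<n}"

abbreviation power_meas :: "'a measure \<Rightarrow> nat \<Rightarrow> (nat \<Rightarrow> 'a) measure" where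
  "power_meas \<sigma> n \<equiv> Pi\<^sub>M {..<n} (\<lambda>_. \<sigma>)"

text \<open>Real continuous functions of n variables with compact support. For n = 0 the underlying
  space is a single point and these are the real numbers.\<close>
definition test_fun :: "nat \<Rightarrow> ('a::topological_space list \<Rightarrow> real) \<Rightarrow> bool" where
  "test_fun n f \<longleftrightarrow>
     continuous_map (power_top n) euclideanreal (\<lambda>x. f (tup n x)) \<and>
     compactin (power_top n)
       (power_top n closure_of {x \<in> topspace (power_top n). f (tup n x) \<noteq> 0})"

text \<open>
  Fock space over real L2 of \<sigma>, the m-th tensor power of which is real L2 of the m-fold product
  measure. A vector is represented by one function G on lists; its component of degree m is the
  restriction of G to lists of length m. Two representatives give the same vector of the Hilbert
  space iff \<^term>\<open>fock_eq\<close> holds.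
\<close>
definition fock :: "'a measure \<Rightarrow> ('a list \<Rightarrow> real) set" where
  "fock \<sigma> = {G.
     (\<forall>m. (\<lambda>x. G (tup m x)) \<in> borel_measurable (power_meas \<sigma> m)) \<and>
     (\<forall>m. integrable (power_meas \<sigma> m) (\<lambda>x. (G (tup m x))\<^sup>2)) \<and>
     summable (\<lambda>m. \<integral>x. (G (tup m x))\<^sup>2 \<partial>power_meas \<sigma> m)}"

definition fock_eq :: "'a measure \<Rightarrow> ('a list \<Rightarrow> real) \<Rightarrow> ('a list \<Rightarrow> real) \<Rightarrow> bool" where
  "fock_eq \<sigma> F G \<longleftrightarrow> (\<forall>m. AE x in power_meas \<sigma> m. F (tup m x) = G (tup m x))"

definition fock_op_eq :: "'a measure \<Rightarrow> (('a list \<Rightarrow> real) \<Rightarrow> 'a list \<Rightarrow> real)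
    \<Rightarrow> (('a list \<Rightarrow> real) \<Rightarrow> 'a list \<Rightarrow> real) \<Rightarrow> bool" where
  "fock_op_eq \<sigma> \<Phi> \<Psi> \<longleftrightarrow> (\<forall>G\<in>fock \<sigma>. fock_eq \<sigma> (\<Phi> G) (\<Psi> G))"

section \<open>Smeared words in creation, annihilation and neutral operators\<close>

datatype letter = Cre | Ann | Neu

text \<open>
  A function h(t_1, ..., t_k; y_1, ..., y_m), for all m at once, is a function of the two lists of
  variables. The convention that annihilation and neutral operators kill the component m = 0 needs
  no separate clause for \<^term>\<open>Ann\<close>: the values of the result on lists ys of length m come from the
  component m + 1 of h, and the component 0 of h is never used. The clauses for the empty list say
  that the result of \<^term>\<open>Cre\<close> has no component of degree 0, and that \<^term>\<open>Neu\<close>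
  kills the component of degree 0.
\<close>
fun letter_op :: "'a measure \<Rightarrow> ('a \<Rightarrow> real) \<Rightarrow> letter
    \<Rightarrow> ('a list \<Rightarrow> 'a list \<Rightarrow> real) \<Rightarrow> 'a list \<Rightarrow> 'a list \<Rightarrow> real" where
  "letter_op \<sigma> lam Cre h ts [] = 0"
| "letter_op \<sigma> lam Cre h ts (y # ys) = h (ts @ [y]) ys"
| "letter_op \<sigma> lam Ann h ts ys = (\<integral>t. h (ts @ [t]) (t # ys) \<partial>\<sigma>)"
| "letter_op \<sigma> lam Neu h ts [] = 0"
| "letter_op \<sigma> lam Neu h ts (y # ys) = lam y * h (ts @ [y]) (y # ys)"

text \<open>The operator w(f) with f a function of length w variables; the last letter acts first.
  For fixed w each component of the result depends on a single component of G, so applying it to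
  G is the same as applying it to the components and adding up. For a test function f the variables
  ts are always inserted into the continuous function f, only the variables ys into G, so the result
  depends on the choice of the representative G only up to a null set in every degree.\<close>
definition word_op :: "'a measure \<Rightarrow> ('a \<Rightarrow> real) \<Rightarrow> letter list \<Rightarrow> ('a list \<Rightarrow> real)
    \<Rightarrow> ('a list \<Rightarrow> real) \<Rightarrow> 'a list \<Rightarrow> real" where
  "word_op \<sigma> lam w f G = foldr (letter_op \<sigma> lam) w (\<lambda>ts ys. f ts * G ys) []"

definition words_op :: "'a measure \<Rightarrow> ('a \<Rightarrow> real) \<Rightarrow> letter list set \<Rightarrow> ('a list \<Rightarrow> real)
    \<Rightarrow> ('a list \<Rightarrow> real) \<Rightarrow> 'a list \<Rightarrow> real" where
  "words_op \<sigma> lam W f G ys = (\<Sum>w\<in>W. word_op \<sigma> lam w f G ys)"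

section \<open>Free Wick products\<close>

text \<open>For n = 0 only the empty word remains, so the smeared Wick product is multiplication by a
  constant.\<close>
definition normal_words :: "nat \<Rightarrow> letter list set" where
  "normal_words n =
     {replicate n Cre} \<union>
     (\<Union>i\<in>{1..n}. {replicate (i - 1) Cre @ replicate (n - i + 1) Ann,
                   replicate (i - 1) Cre @ [Neu] @ replicate (n - i) Ann})"

definition wick :: "'a measure \<Rightarrow> ('a \<Rightarrow> real) \<Rightarrow> nat \<Rightarrow> ('a list \<Rightarrow> real)
    \<Rightarrow> ('a list \<Rightarrow> real) \<Rightarrow> 'a list \<Rightarrow> real" where
  "wick \<sigma> lam n = words_op \<sigma> lam (normal_words n)"

definition product_words :: "nat list \<Rightarrow> letter list set" where
  "product_words ks = {concat ws |ws. list_all2 (\<lambda>w k. w \<in> normal_words k) ws ks}"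

definition wick_product :: "'a measure \<Rightarrow> ('a \<Rightarrow> real) \<Rightarrow> nat list \<Rightarrow> ('a list \<Rightarrow> real)
    \<Rightarrow> ('a list \<Rightarrow> real) \<Rightarrow> 'a list \<Rightarrow> real" where
  "wick_product \<sigma> lam ks = words_op \<sigma> lam (product_words ks)"

section \<open>Marked non-crossing partitions\<close>

type_synonym marked_partition = "(nat set \<times> int) set"

abbreviation underlying :: "marked_partition \<Rightarrow> nat set set" where
  "underlying \<kappa> \<equiv> fst ` \<kappa>"

definition noncrossing :: "nat set set \<Rightarrow> bool" where
  "noncrossing P \<longleftrightarrow>
     \<not> (\<exists>A\<in>P. \<exists>B\<in>P. A \<noteq> B \<and>
          (\<exists>a b c d. a < b \<and> b < c \<and> c < d \<and> a \<in> A \<and> c \<in> A \<and> b \<in> B \<and> d \<in> B))"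

text \<open>Injectivity of \<^term>\<open>fst\<close> says that every block carries exactly one mark.\<close>
definition NC_marked :: "nat \<Rightarrow> marked_partition set" where
  "NC_marked n = {\<kappa>.
     inj_on fst \<kappa> \<and> partition_on {1..n} (underlying \<kappa>) \<and> noncrossing (underlying \<kappa>) \<and>
     (\<forall>(A, m)\<in>\<kappa>. m \<in> {-1, 1} \<and> (card A = 1 \<longrightarrow> m = 1))}"

definition G_set :: "nat \<Rightarrow> marked_partition set" where
  "G_set n = {\<kappa>\<in>NC_marked n.
     \<not> (\<exists>(A, m)\<in>\<kappa>. \<exists>(B, m')\<in>\<kappa>. A \<noteq> B \<and>
          Min A < Min B \<and> Min B \<le> Max B \<and> Max B < Max A \<and> m' = 1)}"

definition plus_blocks :: "marked_partition \<Rightarrow> nat set list" where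
  "plus_blocks \<kappa> =
     (THE Bs. set Bs = {B. (B, 1) \<in> \<kappa>} \<and> sorted_wrt (\<lambda>A B. Min A < Min B) Bs)"

definition minus_blocks :: "marked_partition \<Rightarrow> nat set set" where
  "minus_blocks \<kappa> = {D. (D, -1) \<in> \<kappa>}"

text \<open>The value of the variable t_i, where us lists the variables attached to the blocks marked +1
  and v assigns a variable to every block marked -1.\<close>
definition block_var :: "marked_partition \<Rightarrow> 'a list \<Rightarrow> (nat set \<Rightarrow> 'a) \<Rightarrow> nat \<Rightarrow> 'a" where
  "block_var \<kappa> us v i =
     (THE t. (\<exists>j < length (plus_blocks \<kappa>). i \<in> plus_blocks \<kappa> ! j \<and> t = us ! j) \<or>
             (\<exists>D\<in>minus_blocks \<kappa>. i \<in> D \<and> t = v D))"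

text \<open>The kernel obtained from f by inserting the delta functions prescribed by \<kappa>; the
  integration variables are indexed by the blocks marked -1 themselves. Such blocks have at least
  two elements, so the subtractions in the exponents are not truncated.\<close>
definition contracted :: "'a measure \<Rightarrow> ('a \<Rightarrow> real) \<Rightarrow> nat \<Rightarrow> marked_partition
    \<Rightarrow> ('a list \<Rightarrow> real) \<Rightarrow> 'a list \<Rightarrow> real" where
  "contracted \<sigma> lam n \<kappa> f us =
     (\<integral>v. f (map (block_var \<kappa> us v) [1..<n + 1])
         * (\<Prod>j<length (plus_blocks \<kappa>). lam (us ! j) ^ (card (plus_blocks \<kappa> ! j) - 1))
         * (\<Prod>D\<in>minus_blocks \<kappa>. lam (v D) ^ (card D - 2))
      \<partial>Pi\<^sub>M (minus_blocks \<kappa>) (\<lambda>_. \<sigma>))"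

definition wick_contracted :: "'a measure \<Rightarrow> ('a \<Rightarrow> real) \<Rightarrow> nat \<Rightarrow> marked_partition
    \<Rightarrow> ('a list \<Rightarrow> real) \<Rightarrow> ('a list \<Rightarrow> real) \<Rightarrow> 'a list \<Rightarrow> real" where
  "wick_contracted \<sigma> lam n \<kappa> f =
     wick \<sigma> lam (length (plus_blocks \<kappa>)) (contracted \<sigma> lam n \<kappa> f)"

text \<open>The j-th group of consecutive indices, j counted from 0.\<close>
definition segment :: "nat list \<Rightarrow> nat \<Rightarrow> nat set" where
  "segment ks j = {sum_list (take j ks) + 1 .. sum_list (take (Suc j) ks)}"

definition admissible :: "nat list \<Rightarrow> marked_partition set" where
  "admissible ks = {\<kappa>\<in>G_set (sum_list ks).
     \<forall>A\<in>underlying \<kappa>. \<forall>j<length ks. card (A \<inter> segment ks j) \<le> 1}"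

subsection \<open>All index sets of sums above are finite\<close>

lemma finite_normal_words: "finite (normal_words n)"
  by (simp add: normal_words_def)

lemma finite_product_words: "finite (product_words ks)"
proof -
  have "product_words ks = concat ` {ws. list_all2 (\<lambda>w k. w \<in> normal_words k) ws ks}"
    by (auto simp: product_words_def)
  moreover have "finite {ws. list_all2 (\<lambda>w k. w \<in> normal_words k) ws ks}"
  proof (induction ks)
    case Nil
    have "{ws. list_all2 (\<lambda>w k. w \<in> normal_words k) ws []} = {[]}"
      by auto
    then show ?case by simp
  next
    case (Cons k ks)
    have "{ws. list_all2 (\<lambda>w k. w \<in> normal_words k) ws (k # ks)} =
        (\<lambda>(w, ws). w # ws) `
          (normal_words k \<times> {ws. list_all2 (\<lambda>w k. w \<in> normal_words k) ws ks})"
      by (auto simp: list_all2_Cons2 image_iff)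
    then show ?case using Cons finite_normal_words by simp
  qed
  ultimately show ?thesis by simp
qed

lemma finite_NC_marked: "finite (NC_marked n)"
proof (rule finite_subset)
  show "NC_marked n \<subseteq> Pow (Pow {1..n} \<times> {-1, 1})"
  proof
    fix \<kappa> assume \<kappa>: "\<kappa> \<in> NC_marked n"
    have "A \<subseteq> {1..n} \<and> m \<in> {-1, 1}" if "(A, m) \<in> \<kappa>" for A m
    proof
      have "A \<in> underlying \<kappa>"
        using that by (rule image_eqI[rotated]) simp
      moreover have "{1..n} = \<Union>(underlying \<kappa>)"
        using \<kappa> by (intro partition_onD1) (simp add: NC_marked_def)
      ultimately show "A \<subseteq> {1..n}" by (metis Union_upper)
      show "m \<in> {-1, 1}" using \<kappa> that by (auto simp: NC_marked_def)
    qed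
    then show "\<kappa> \<in> Pow (Pow {1..n} \<times> {-1, 1})" by auto
  qed
qed simp

lemma finite_admissible: "finite (admissible ks)"
  by (rule finite_subset[OF _ finite_NC_marked[of "sum_list ks"]])
    (auto simp: admissible_def G_set_def)

end

theory Submission
  imports Defs
begin

text \<open>
  Reading a word from the left to right turns it into a program for a stack machine. The stack
  initially holds the variables ys of the vector; \<^term>\<open>Ann\<close> pushes a new variable, which is
  integrated over, \<^term>\<open>Cre\<close> pops the top variable, and \<^term>\<open>Neu\<close> reads the top variable t
  and contributes a factor lam t. Every letter therefore touches exactly one variable, and grouping
  the positions of the word by the variable that they touch gives a partition. It is non-crossing
  because a stack is last in, first out.

  A variable that is pushed and later popped by letters of the word gives a block Ann Neu ... Neu Cre:
  its r letters contribute the (r-2)-nd power of lam, it is integrated out, and the block is marked -1.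
  Every other variable is still seen from outside and gives a block marked +1: it is either an
  original variable that is popped (Neu ... Neu Cre), or an original variable that is read but left
  on the stack (Neu ... Neu), or a pushed variable that is never popped (Ann Neu ... Neu). In each
  case r-1 of the powers of lam belong to the delta function of the block, and one letter, namely
  Cre, Neu and Ann respectively, remains. The remaining letters, in the order of the minima of the
  blocks, form a normally ordered word: nothing below an unpopped variable can be reached, so
  Cre comes first, at most one Neu follows, and the rest is Ann. For the same reason no block marked
  +1 lies inside another block, which is the condition defining \<^const>\<open>G_set\<close>.

  Hence words of length n correspond to pairs of a partition in \<^const>\<open>G_set\<close> and a normally
  ordered word whose length is the number of blocks marked +1. The correspondence is built one letter
  at a time (\<open>absorb_inj\<close>, \<open>absorb_surj\<close>, \<open>marked_bij\<close>). Two neighbouring letters fail to be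
  normally ordered exactly if they touch the same variable; this translates products of normally
  ordered words into partitions whose blocks meet each segment at most once
  (\<open>product_words_bij\<close>).

  The operator of a word agrees with that of the normally ordered word applied to the contracted
  kernel (\<open>word_kernel_eq_contraction\<close>). Again one letter is added at a time. All cases are
  pointwise identities except two, in which the integration over a pushed variable has to be exchanged
  with the integrations over the blocks marked -1. The exchange needs integrability, which holds for
  almost all values of the remaining variables: the kernels are compactly supported and bounded in the
  variables of the test function and locally integrable in those of the Fock vector.
\<close>

section \<open>Non-crossing diagrams\<close>

text \<open>Both relations compare extrema of blocks. Stated elementwise they change in an obvious way when a
  single point is added or removed; \<open>starts_before_Min\<close> and \<open>enclosed_Min_Max\<close> give the
  formulation by minima and maxima.\<close>
definition starts_before :: "nat set \<Rightarrow> nat set \<Rightarrow> bool" where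
  "starts_before A B \<longleftrightarrow> (\<exists>a\<in>A. \<forall>b\<in>B. a < b)"

definition enclosed :: "nat set \<Rightarrow> nat set \<Rightarrow> bool" where
  "enclosed B A \<longleftrightarrow> (\<exists>a\<in>A. \<exists>c\<in>A. \<forall>b\<in>B. a < b \<and> b < c)"

text \<open>The blocks marked +1 form the list Ps, the latest one first: it belongs to the top of the stack and
  is the only one that can still grow. Ms is the set of blocks marked -1.\<close>
definition diagram :: "nat \<Rightarrow> nat set list \<Rightarrow> nat set set \<Rightarrow> bool" where
  "diagram n Ps Ms \<longleftrightarrow>
     \<Union>(set Ps \<union> Ms) = {1..n} \<and> {} \<notin> set Ps \<union> Ms \<and> set Ps \<inter> Ms = {} \<and>
     (\<forall>A\<in>set Ps \<union> Ms. \<forall>B\<in>set Ps \<union> Ms. A \<noteq> B \<longrightarrow> A \<inter> B = {}) \<and>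
     noncrossing (set Ps \<union> Ms) \<and>
     (\<forall>D\<in>Ms. card D \<noteq> 1) \<and>
     (\<forall>B\<in>set Ps. \<forall>A\<in>set Ps \<union> Ms. A \<noteq> B \<longrightarrow> \<not> enclosed B A) \<and>
     sorted_wrt (\<lambda>B A. starts_before A B) Ps"

lemma diagramI:
  assumes "\<Union>(set Ps \<union> Ms) = {1..n}" "{} \<notin> set Ps \<union> Ms" "set Ps \<inter> Ms = {}"
    "\<And>A B i. A \<in> set Ps \<union> Ms \<Longrightarrow> B \<in> set Ps \<union> Ms \<Longrightarrow> i \<in> A \<Longrightarrow> i \<in> B \<Longrightarrow> A = B"
    "\<And>A B a b c d. A \<in> set Ps \<union> Ms \<Longrightarrow> B \<in> set Ps \<union> Ms \<Longrightarrow> A \<noteq> B \<Longrightarrow>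
       a < b \<Longrightarrow> b < c \<Longrightarrow> c < d \<Longrightarrow> a \<in> A \<Longrightarrow> c \<in> A \<Longrightarrow> b \<in> B \<Longrightarrow> d \<in> B \<Longrightarrow> False"
    "\<And>D. D \<in> Ms \<Longrightarrow> card D \<noteq> 1"
    "\<And>A B. B \<in> set Ps \<Longrightarrow> A \<in> set Ps \<union> Ms \<Longrightarrow> A \<noteq> B \<Longrightarrow> enclosed B A \<Longrightarrow> False"
    "sorted_wrt (\<lambda>B A. starts_before A B) Ps"
  shows "diagram n Ps Ms"
proof -
  have "noncrossing (set Ps \<union> Ms)"
    unfolding noncrossing_def using assms(5) by metis
  moreover have "\<forall>A\<in>set Ps \<union> Ms. \<forall>B\<in>set Ps \<union> Ms. A \<noteq> B \<longrightarrow> A \<inter> B = {}"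
    using assms(4) by (metis disjoint_iff)
  ultimately show ?thesis
    unfolding diagram_def using assms(1,2,3,6,7,8) by metis
qed

lemma
  assumes "diagram n Ps Ms"
  shows diagram_Union: "\<Union>(set Ps \<union> Ms) = {1..n}"
    and diagram_nonempty: "A \<in> set Ps \<union> Ms \<Longrightarrow> A \<noteq> {}"
    and diagram_marks: "A \<in> set Ps \<Longrightarrow> A \<in> Ms \<Longrightarrow> False"
    and diagram_disjoint: "A \<in> set Ps \<union> Ms \<Longrightarrow> B \<in> set Ps \<union> Ms \<Longrightarrow> i \<in> A \<Longrightarrow> i \<in> B \<Longrightarrow> A = B"
    and diagram_noncrossing: "A \<in> set Ps \<union> Ms \<Longrightarrow> B \<in> set Ps \<union> Ms \<Longrightarrow> A \<noteq> B \<Longrightarrow>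
       a < b \<Longrightarrow> b < c \<Longrightarrow> c < d \<Longrightarrow> a \<in> A \<Longrightarrow> c \<in> A \<Longrightarrow> b \<in> B \<Longrightarrow> d \<in> B \<Longrightarrow> False"
    and diagram_card: "D \<in> Ms \<Longrightarrow> card D \<noteq> 1"
    and diagram_enclosed: "B \<in> set Ps \<Longrightarrow> A \<in> set Ps \<union> Ms \<Longrightarrow> A \<noteq> B \<Longrightarrow> enclosed B A \<Longrightarrow> False"
    and diagram_sorted: "sorted_wrt (\<lambda>B A. starts_before A B) Ps"
    and diagram_bounds: "A \<in> set Ps \<union> Ms \<Longrightarrow> i \<in> A \<Longrightarrow> 1 \<le> i \<and> i \<le> n"
    and diagram_finite: "A \<in> set Ps \<union> Ms \<Longrightarrow> finite A"
    and diagram_finite_minus: "finite Ms"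
proof -
  have U: "\<Union>(set Ps \<union> Ms) = {1..n}"
    and ne: "{} \<notin> set Ps \<union> Ms" and marks: "set Ps \<inter> Ms = {}"
    and disj: "\<forall>A\<in>set Ps \<union> Ms. \<forall>B\<in>set Ps \<union> Ms. A \<noteq> B \<longrightarrow> A \<inter> B = {}"
    and nc: "noncrossing (set Ps \<union> Ms)"
    and card: "\<forall>D\<in>Ms. card D \<noteq> 1"
    and encl: "\<forall>B\<in>set Ps. \<forall>A\<in>set Ps \<union> Ms. A \<noteq> B \<longrightarrow> \<not> enclosed B A"
    and srt: "sorted_wrt (\<lambda>B A. starts_before A B) Ps"
    using assms unfolding diagram_def atomize_conj by (elim conjE, intro conjI)
  show "\<Union>(set Ps \<union> Ms) = {1..n}" by fact
  then show "A \<in> set Ps \<union> Ms \<Longrightarrow> i \<in> A \<Longrightarrow> 1 \<le> i \<and> i \<le> n"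
    using atLeastAtMost_iff by blast
  show "A \<in> set Ps \<union> Ms \<Longrightarrow> finite A"
    using U by (metis Union_upper finite_atLeastAtMost finite_subset)
  have "Ms \<subseteq> Pow {1..n}" using U by auto
  then show "finite Ms" using finite_subset by blast
  show "A \<in> set Ps \<union> Ms \<Longrightarrow> A \<noteq> {}" using ne by blast
  show "A \<in> set Ps \<Longrightarrow> A \<in> Ms \<Longrightarrow> False" using marks by blast
  show "A \<in> set Ps \<union> Ms \<Longrightarrow> B \<in> set Ps \<union> Ms \<Longrightarrow> i \<in> A \<Longrightarrow> i \<in> B \<Longrightarrow> A = B"
    using disj by blast
  show "A \<in> set Ps \<union> Ms \<Longrightarrow> B \<in> set Ps \<union> Ms \<Longrightarrow> A \<noteq> B \<Longrightarrow>
       a < b \<Longrightarrow> b < c \<Longrightarrow> c < d \<Longrightarrow> a \<in> A \<Longrightarrow> c \<in> A \<Longrightarrow> b \<in> B \<Longrightarrow> d \<in> B \<Longrightarrow> False"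
    using nc unfolding noncrossing_def by metis
  show "D \<in> Ms \<Longrightarrow> card D \<noteq> 1" using card by blast
  show "B \<in> set Ps \<Longrightarrow> A \<in> set Ps \<union> Ms \<Longrightarrow> A \<noteq> B \<Longrightarrow> enclosed B A \<Longrightarrow> False"
    using encl by blast
  show "sorted_wrt (\<lambda>B A. starts_before A B) Ps" by fact
qed

lemma diagram_fresh:
  assumes "diagram n Ps Ms" "A \<in> set Ps \<union> Ms"
  shows "Suc n \<notin> A"
  using diagram_bounds[OF assms] by fastforce

lemma not_starts_before_self: "\<not> starts_before A A"
  by (auto simp: starts_before_def)

lemma diagram_new:
  assumes "diagram n Ps Ms"
  shows "diagram (Suc n) ({Suc n} # Ps) Ms"
proof -
  note d = assms
  let ?P = "set Ps \<union> Ms"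
  have le: "i \<le> n" if "A \<in> ?P" "i \<in> A" for A i
    using diagram_bounds[OF d] that by blast
  have eq: "set ({Suc n} # Ps) \<union> Ms = insert {Suc n} ?P" by auto
  have new: "{Suc n} \<notin> ?P" using le by fastforce
  show ?thesis
  proof (rule diagramI, unfold eq)
    have "\<Union> (insert {Suc n} ?P) = insert (Suc n) {1..n}"
      using diagram_Union[OF d] by auto
    then show "\<Union> (insert {Suc n} ?P) = {1..Suc n}" by auto
    show "{} \<notin> insert {Suc n} ?P" using diagram_nonempty[OF d] by blast
    show "set ({Suc n} # Ps) \<inter> Ms = {}"
      using new diagram_marks[OF d] by auto
    show "A = B" if "A \<in> insert {Suc n} ?P" "B \<in> insert {Suc n} ?P" "i \<in> A" "i \<in> B" for A B i
      using that le diagram_disjoint[OF d] by (metis insertE not_less_eq_eq order_refl singletonD)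
    show False if "A \<in> insert {Suc n} ?P" "B \<in> insert {Suc n} ?P" "A \<noteq> B"
       "a < b" "b < c" "c < d" "a \<in> A" "c \<in> A" "b \<in> B" "d \<in> B" for A B a b c d
    proof -
      have "A \<noteq> {Suc n}" "B \<noteq> {Suc n}" using that by auto
      then show False using that diagram_noncrossing[OF d, of A B a b c d] by blast
    qed
    show "card D \<noteq> 1" if "D \<in> Ms" for D using diagram_card[OF d that] .
    show False if "B \<in> set ({Suc n} # Ps)" "A \<in> insert {Suc n} ?P" "A \<noteq> B" "enclosed B A" for A B
    proof -
      have ne: "B \<noteq> {}" using that(1) diagram_nonempty[OF d] by auto
      from that(4) obtain a c where ac: "a \<in> A" "c \<in> A" "\<forall>b\<in>B. a < b \<and> b < c"
        unfolding enclosed_def by blast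
      have "A \<noteq> {Suc n}" using ac ne by fastforce
      then have A: "A \<in> ?P" using that by blast
      then have "c \<le> n" using le ac by blast
      then have "B \<noteq> {Suc n}" using ac by auto
      then show False using diagram_enclosed[OF d] A that by auto
    qed
    show "sorted_wrt (\<lambda>B A. starts_before A B) ({Suc n} # Ps)"
    proof (simp add: diagram_sorted[OF d], intro ballI)
      fix A assume A: "A \<in> set Ps"
      then obtain a where "a \<in> A" using diagram_nonempty[OF d] by blast
      moreover have "a \<le> n" using le A calculation by blast
      ultimately show "starts_before A {Suc n}"
        unfolding starts_before_def by (metis less_Suc_eq_le singletonD)
    qed
  qed
qed

text \<open>Adding the new last point to the latest block B marked +1, whatever its mark is afterwards. A
  crossing with the enlarged block would need a block X with points on both sides of some point of B.
  As X does not cross B, it then encloses B, which is forbidden for a block marked +1.\<close>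
lemma diagram_grow:
  assumes d: "diagram n (B # Ps) Ms"
    and P': "set Ps' \<union> Ms' = insert (insert (Suc n) B) (set Ps \<union> Ms)"
    and sub: "set Ps' \<subseteq> insert (insert (Suc n) B) (set Ps)"
    and int: "set Ps' \<inter> Ms' = {}"
    and sorted: "sorted_wrt (\<lambda>B A. starts_before A B) Ps'"
    and card: "\<And>D. D \<in> Ms' \<Longrightarrow> card D \<noteq> 1"
  shows "diagram (Suc n) Ps' Ms'"
proof -
  let ?B = "insert (Suc n) B"
  let ?P = "insert B (set Ps \<union> Ms)"
  let ?R = "set Ps \<union> Ms"
  have eq: "set (B # Ps) \<union> Ms = ?P" by auto
  have le: "i \<le> n" if "A \<in> ?P" "i \<in> A" for A i
    using diagram_bounds[OF d] that eq by blast
  have later: "starts_before X B" if "X \<in> set Ps" for X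
    using diagram_sorted[OF d] that by simp
  have BR: "B \<notin> ?R"
    using later not_starts_before_self diagram_marks[OF d, of B] by auto
  have disj: "i \<notin> X" if "X \<in> ?R" "i \<in> B" for i X
    using diagram_disjoint[OF d, unfolded eq, of B X i] that BR by blast
  have ne: "B \<noteq> {}" using diagram_nonempty[OF d] by auto
  have nest: False if X: "X \<in> ?R" "a \<in> X" "c \<in> X" "b \<in> B" "a < b" "b < c" for X a b c
  proof -
    have XB: "X \<noteq> B" using X BR by blast
    have "a < b' \<and> b' < c" if b': "b' \<in> B" for b'
    proof -
      have "b' \<noteq> a" "b' \<noteq> c" using disj X b' by blast+
      moreover have "\<not> b' < a"
        using diagram_noncrossing[OF d, unfolded eq, of B X b' a b c] X XB b' by blast
      moreover have "\<not> c < b'"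
        using diagram_noncrossing[OF d, unfolded eq, of X B a b c b'] X XB b' by blast
      ultimately show ?thesis by linarith
    qed
    then have "enclosed B X" using X unfolding enclosed_def by blast
    then show False using diagram_enclosed[OF d, of B X] X XB by auto
  qed
  show ?thesis
  proof (rule diagramI, unfold P')
    have "\<Union> (insert ?B ?R) = insert (Suc n) (\<Union>?P)" by auto
    also have "\<Union>?P = {1..n}" using diagram_Union[OF d] eq by simp
    finally show "\<Union> (insert ?B ?R) = {1..Suc n}" by auto
    show "{} \<notin> insert ?B ?R" using diagram_nonempty[OF d] by auto
    show "set Ps' \<inter> Ms' = {}" by fact
    show "sorted_wrt (\<lambda>B A. starts_before A B) Ps'" by fact
    show "card D \<noteq> 1" if "D \<in> Ms'" for D using card that .
    have sep: False if "X \<in> ?R" "i \<in> ?B" "i \<in> X" for X i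
      using that disj[of X i] le[of X i] by auto
    show "X = Y" if "X \<in> insert ?B ?R" "Y \<in> insert ?B ?R" "i \<in> X" "i \<in> Y" for X Y i
      using that sep diagram_disjoint[OF d, unfolded eq, of X Y i] by blast
    show False if "X \<in> insert ?B ?R" "Y \<in> insert ?B ?R" "X \<noteq> Y"
       "a < b" "b < c" "c < e" "a \<in> X" "c \<in> X" "b \<in> Y" "e \<in> Y" for X Y a b c e
    proof -
      from that consider "X = ?B" "Y \<in> ?R" | "Y = ?B" "X \<in> ?R" | "X \<in> ?R" "Y \<in> ?R" by blast
      then show False
      proof cases
        case 1
        then have "e \<le> n" using le that by blast
        then have "a \<in> B" "c \<in> B" using 1 that by auto
        then show False using 1 that BR diagram_noncrossing[OF d, unfolded eq, of B Y a b c e] by blast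
      next
        case 2
        then have "c \<le> n" using le that by blast
        then have "b \<in> B" using 2 that by auto
        then show False using 2 that nest by blast
      next
        case 3
        then show False using that diagram_noncrossing[OF d, unfolded eq, of X Y a b c e] by blast
      qed
    qed
    show False if "Y \<in> set Ps'" "X \<in> insert ?B ?R" "X \<noteq> Y" "enclosed Y X" for X Y
    proof -
      from that(4) obtain a c where ac: "a \<in> X" "c \<in> X" "\<forall>b\<in>Y. a < b \<and> b < c"
        unfolding enclosed_def by blast
      have "c \<le> Suc n" using ac that le by (auto intro: le_SucI)
      then have "Y \<noteq> ?B" using ac by auto
      then have Y: "Y \<in> set Ps" using that sub by blast
      show False
      proof (cases "X = ?B")
        case True
        obtain b where "b \<in> Y" "\<forall>x\<in>B. b < x" using later[OF Y] unfolding starts_before_def by blast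
        moreover from this have "b \<le> n" using le[of Y b] Y by simp
        moreover have "a < b" using ac calculation by blast
        ultimately show False using ac True by fastforce
      next
        case False
        then have "X \<in> ?R" using that by blast
        moreover have "\<not> enclosed Y X"
          using diagram_enclosed[OF d, of Y X] calculation Y that by auto
        ultimately show False using that by blast
      qed
    qed
  qed
qed

lemma diagram_extend:
  assumes d: "diagram n (B # Ps) Ms"
  shows "diagram (Suc n) (insert (Suc n) B # Ps) Ms"
proof (rule diagram_grow[OF d])
  have "insert (Suc n) B \<notin> Ms"
    using diagram_fresh[OF d, of "insert (Suc n) B"] by auto
  then show "set (insert (Suc n) B # Ps) \<inter> Ms = {}"
    using diagram_marks[OF d] by auto
  show "sorted_wrt (\<lambda>B A. starts_before A B) (insert (Suc n) B # Ps)"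
  proof -
    have "starts_before X (insert (Suc n) B)" if X: "X \<in> set Ps" for X
    proof -
      obtain x where "x \<in> X" "\<forall>b\<in>B. x < b"
        using diagram_sorted[OF d] X unfolding starts_before_def by auto
      moreover have "x \<le> n" using diagram_bounds[OF d, of X x] X calculation by auto
      ultimately show ?thesis unfolding starts_before_def by (metis insertE less_Suc_eq_le)
    qed
    then show ?thesis using diagram_sorted[OF d] by simp
  qed
qed (use diagram_card[OF d] in auto)

lemma diagram_close:
  assumes d: "diagram n (B # Ps) Ms"
  shows "diagram (Suc n) Ps (insert (insert (Suc n) B) Ms)"
proof (rule diagram_grow[OF d])
  have "insert (Suc n) B \<notin> set Ps"
    using diagram_fresh[OF d, of "insert (Suc n) B"] by auto
  then show "set Ps \<inter> insert (insert (Suc n) B) Ms = {}"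
    using diagram_marks[OF d] by auto
  show "sorted_wrt (\<lambda>B A. starts_before A B) Ps"
    using diagram_sorted[OF d] by simp
  show "card D \<noteq> 1" if "D \<in> insert (insert (Suc n) B) Ms" for D
  proof (cases "D \<in> Ms")
    case False
    then have "D = insert (Suc n) B" using that by simp
    moreover have "finite B" "B \<noteq> {}" "Suc n \<notin> B"
      using diagram_finite[OF d] diagram_nonempty[OF d] diagram_fresh[OF d] by auto
    ultimately show ?thesis by simp
  qed (use diagram_card[OF d] in auto)
qed auto

text \<open>Without its last point a block can be marked +1, also if it was marked -1 before: a block enclosing
  the shortened block would cross the original one, which reaches up to the last point.\<close>
lemma diagram_shrink:
  assumes d: "diagram (Suc n) Ps' Ms'"
    and P': "set Ps' \<union> Ms' = insert (insert (Suc n) B) (set Ps \<union> Ms)"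
    and B: "Suc n \<notin> B" "B \<noteq> {}" "insert (Suc n) B \<notin> set Ps \<union> Ms"
    and sub: "set Ps \<subseteq> set Ps'" "Ms \<subseteq> Ms'"
    and sorted: "sorted_wrt (\<lambda>B A. starts_before A B) Ps"
    and later: "\<And>X. X \<in> set Ps \<Longrightarrow> starts_before X B"
  shows "diagram n (B # Ps) Ms"
proof -
  let ?B = "insert (Suc n) B"
  let ?R = "set Ps \<union> Ms"
  have eq: "set (B # Ps) \<union> Ms = insert B ?R" by auto
  have sep: False if "X \<in> ?R" "i \<in> ?B" "i \<in> X" for X i
    using diagram_disjoint[OF d, unfolded P', of X ?B i] that B by blast
  have le: "i \<le> n" if "X \<in> insert B ?R" "i \<in> X" for X i
  proof -
    have "i \<le> Suc n" using that diagram_bounds[OF d, unfolded P', of X i]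
      diagram_bounds[OF d, unfolded P', of ?B i] by blast
    moreover have "i \<noteq> Suc n" using that sep[of X i] B by blast
    ultimately show ?thesis by simp
  qed
  have BR: "B \<notin> ?R" using B sep[of B] by blast
  show ?thesis
  proof (rule diagramI, unfold eq)
    have U: "\<Union> (insert ?B ?R) = {1..Suc n}" using diagram_Union[OF d] unfolding P' .
    have "\<Union> (insert B ?R) = \<Union> (insert ?B ?R) - {Suc n}" using le by fastforce
    also have "\<dots> = {1..n}" unfolding U by auto
    finally show "\<Union> (insert B ?R) = {1..n}" .
    show "{} \<notin> insert B ?R" using B diagram_nonempty[OF d, unfolded P'] by blast
    show "set (B # Ps) \<inter> Ms = {}" using BR sub diagram_marks[OF d] by auto
    show "X = Y" if "X \<in> insert B ?R" "Y \<in> insert B ?R" "i \<in> X" "i \<in> Y" for X Y i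
      using that sep[of X i] sep[of Y i] diagram_disjoint[OF d, unfolded P', of X Y i] by blast
    show False if "X \<in> insert B ?R" "Y \<in> insert B ?R" "X \<noteq> Y"
       "a < b" "b < c" "c < e" "a \<in> X" "c \<in> X" "b \<in> Y" "e \<in> Y" for X Y a b c e
    proof -
      from that consider "X = B" "Y \<in> ?R" | "Y = B" "X \<in> ?R" | "X \<in> ?R" "Y \<in> ?R" by blast
      then show False
      proof cases
        case 1
        then show False using that B diagram_noncrossing[OF d, unfolded P', of ?B Y a b c e] by blast
      next
        case 2
        then show False using that B diagram_noncrossing[OF d, unfolded P', of X ?B a b c e] by blast
      next
        case 3
        then show False using that diagram_noncrossing[OF d, unfolded P', of X Y a b c e] by blast
      qed
    qed
    show "card D \<noteq> 1" if "D \<in> Ms" for D using diagram_card[OF d] sub that by blast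
    show False if "Y \<in> set (B # Ps)" "X \<in> insert B ?R" "X \<noteq> Y" "enclosed Y X" for X Y
    proof -
      from that(4) obtain a c where ac: "a \<in> X" "c \<in> X" "\<forall>b\<in>Y. a < b \<and> b < c"
        unfolding enclosed_def by blast
      show False
      proof (cases "Y = B")
        case True
        then have X: "X \<in> ?R" using that by blast
        obtain b where "b \<in> B" using B by blast
        moreover have "c < Suc n" using le[of X c] X ac by simp
        ultimately show False
          using diagram_noncrossing[OF d, unfolded P', of X ?B a b c "Suc n"] ac X B True by blast
      next
        case False
        then have Y: "Y \<in> set Ps" "Y \<in> set Ps'" using that sub by auto
        define X' where "X' = (if X = B then ?B else X)"
        have X': "X' \<in> insert ?B ?R" "X' \<noteq> Y" "X \<subseteq> X'"
          using that Y B by (auto simp: X'_def)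
        then have "enclosed Y X'" using ac unfolding enclosed_def by blast
        then show False using diagram_enclosed[OF d, unfolded P', of Y X'] X' Y by blast
      qed
    qed
    show "sorted_wrt (\<lambda>B A. starts_before A B) (B # Ps)"
      using sorted later by simp
  qed
qed

text \<open>Nothing ends after the last point, so a block marked +1 that started later than D would be enclosed
  by D.\<close>
lemma diagram_latest:
  assumes d: "diagram (Suc n) Ps Ms" and X: "X \<in> set Ps"
    and D: "D \<in> set Ps \<union> Ms" "Suc n \<in> D" "X \<noteq> D"
  shows "starts_before X D"
proof -
  have fin: "finite X" "finite D" "X \<noteq> {}" "D \<noteq> {}"
    using diagram_finite[OF d] diagram_nonempty[OF d] X D by auto
  have "Suc n \<notin> X" using diagram_disjoint[OF d] X D by blast
  then have lt: "x < Suc n" if "x \<in> X" for x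
    using that diagram_bounds[OF d, of X x] X by (cases "x = Suc n") auto
  show ?thesis
  proof (rule ccontr)
    assume n: "\<not> starts_before X D"
    have "Min D < x" if x: "x \<in> X" for x
    proof -
      have "\<exists>b\<in>D. b \<le> Min X"
        using n fin unfolding starts_before_def by (meson Min_in not_le)
      then obtain b where b: "b \<in> D" "b \<le> Min X" by blast
      then have "b \<noteq> x" using diagram_disjoint[OF d, of X D x] x X D by auto
      moreover have "b \<le> x" using b fin x by (meson Min_le order_trans)
      ultimately show ?thesis using b fin by (metis Min_le order_le_less order_le_less_trans)
    qed
    then have "enclosed X D" unfolding enclosed_def using lt D fin by (meson Min_in)
    then show False using diagram_enclosed[OF d X D(1)] D by blast
  qed
qed

text \<open>Inverts the three ways of adding a point: by \<open>diagram_latest\<close> the block of the last point is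
  either the latest one marked +1 or becomes the latest one when the point is removed.\<close>
lemma diagram_Suc_cases:
  assumes d: "diagram (Suc n) Ps Ms"
  obtains (new) Ps' where "Ps = {Suc n} # Ps'" "diagram n Ps' Ms"
    | (extend) B Ps' where "Ps = insert (Suc n) B # Ps'" "diagram n (B # Ps') Ms"
    | (close) B Ms' where "Ms = insert (insert (Suc n) B) Ms'" "diagram n (B # Ps) Ms'"
proof -
  have "Suc n \<in> \<Union>(set Ps \<union> Ms)" unfolding diagram_Union[OF d] by simp
  then obtain D where D: "D \<in> set Ps \<union> Ms" "Suc n \<in> D" by blast
  define B where "B = D - {Suc n}"
  have DB: "D = insert (Suc n) B" "Suc n \<notin> B" using D by (auto simp: B_def)
  have other: "Suc n \<notin> X" if "X \<in> set Ps \<union> Ms" "X \<noteq> D" for X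
    using diagram_disjoint[OF d] that D by blast
  have later: "starts_before X B" if "X \<in> set Ps" "X \<noteq> D" for X
    using diagram_latest[OF d that(1) D that(2)] DB unfolding starts_before_def by blast
  show thesis
  proof (cases "D \<in> Ms")
    case True
    then have "D \<notin> set Ps" using diagram_marks[OF d] by blast
    moreover have "B \<noteq> {}" using diagram_card[OF d True] DB by auto
    moreover have "Ms = insert (insert (Suc n) B) (Ms - {D})" using True DB by auto
    moreover have "diagram n (B # Ps) (Ms - {D})"
      by (rule diagram_shrink[OF d])
        (use True DB calculation later diagram_sorted[OF d] in auto)
    ultimately show thesis using close by blast
  next
    case False
    then have "D \<in> set Ps" using D by blast
    then obtain P0 Ps' where Ps: "Ps = P0 # Ps'" by (cases Ps) auto
    have srt: "sorted_wrt (\<lambda>B A. starts_before A B) Ps'" "\<forall>X\<in>set Ps'. starts_before X P0"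
      using diagram_sorted[OF d] Ps by auto
    have "P0 = D"
    proof (rule ccontr)
      assume "P0 \<noteq> D"
      then have "starts_before D P0" "starts_before P0 D"
        using srt diagram_latest[OF d _ D, of P0] \<open>D \<in> set Ps\<close> Ps by auto
      then show False unfolding starts_before_def by fastforce
    qed
    then have notin: "D \<notin> set Ps'" using srt not_starts_before_self by blast
    have other': "Suc n \<notin> X" if "X \<in> set Ps' \<union> Ms" for X
      using other that notin False Ps by auto
    show thesis
    proof (cases "B = {}")
      case True
      have P: "set Ps \<union> Ms = insert {Suc n} (set Ps' \<union> Ms)"
        using Ps \<open>P0 = D\<close> DB True by auto
      have "diagram n Ps' Ms"
      proof (rule diagramI)
        have U: "\<Union> (insert {Suc n} (set Ps' \<union> Ms)) = {1..Suc n}"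
          using diagram_Union[OF d] unfolding P .
        have "\<Union> (set Ps' \<union> Ms) = \<Union> (insert {Suc n} (set Ps' \<union> Ms)) - {Suc n}"
          using other' by auto
        also have "\<dots> = {1..n}" unfolding U by auto
        finally show "\<Union> (set Ps' \<union> Ms) = {1..n}" .
        show "{} \<notin> set Ps' \<union> Ms" using diagram_nonempty[OF d] Ps by auto
        show "set Ps' \<inter> Ms = {}" using diagram_marks[OF d] Ps by auto
        have in': "X \<in> set Ps \<union> Ms" if "X \<in> set Ps' \<union> Ms" for X using that P by blast
        show "X = Y" if "X \<in> set Ps' \<union> Ms" "Y \<in> set Ps' \<union> Ms" "i \<in> X" "i \<in> Y" for X Y i
          using diagram_disjoint[OF d] in' that by metis
        show False if "X \<in> set Ps' \<union> Ms" "Y \<in> set Ps' \<union> Ms" "X \<noteq> Y"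
          "a < b" "b < c" "c < e" "a \<in> X" "c \<in> X" "b \<in> Y" "e \<in> Y" for X Y a b c e
          using diagram_noncrossing[OF d in' in', of X Y a b c e] that by blast
        show "card X \<noteq> 1" if "X \<in> Ms" for X using diagram_card[OF d that] .
        show False if "Y \<in> set Ps'" "X \<in> set Ps' \<union> Ms" "X \<noteq> Y" "enclosed Y X" for X Y
          using diagram_enclosed[OF d _ in', of Y X] that Ps by simp
        show "sorted_wrt (\<lambda>B A. starts_before A B) Ps'" using srt by blast
      qed
      then show thesis using new Ps \<open>P0 = D\<close> DB True by blast
    next
      case B: False
      have "diagram n (B # Ps') Ms"
        by (rule diagram_shrink[OF d])
          (use Ps \<open>P0 = D\<close> DB B False notin srt later other' in auto)
      then show thesis using extend Ps \<open>P0 = D\<close> DB by blast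
    qed
  qed
qed

section \<open>Words as programs of a stack machine\<close>

abbreviation normal_pair :: "letter \<Rightarrow> letter \<Rightarrow> bool" where
  "normal_pair x y \<equiv> x = Cre \<or> y = Ann"

text \<open>Normal order forbids each of Ann, Neu before each of Cre, Neu. The remaining relation between
  letters is transitive, so that normal order is a property of neighbours.\<close>
lemma normal_words_iff:
  "w \<in> normal_words n \<longleftrightarrow> length w = n \<and> sorted_wrt normal_pair w"
proof
  assume "w \<in> normal_words n"
  moreover have "sorted_wrt normal_pair (replicate k x)" if "x \<noteq> Neu" for k x
    using that by (cases x) (auto simp: sorted_wrt_iff_nth_less)
  ultimately show "length w = n \<and> sorted_wrt normal_pair w"
    by (auto simp: normal_words_def sorted_wrt_append simp del: replicate_Suc)
next
  have Cons: "Cre # w \<in> normal_words (Suc n)" if "w \<in> normal_words n" for w n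
  proof -
    consider "w = replicate n Cre"
      | i where "i \<in> {1..n}" "w = replicate (i - 1) Cre @ replicate (n - i + 1) Ann"
      | i where "i \<in> {1..n}" "w = replicate (i - 1) Cre @ [Neu] @ replicate (n - i) Ann"
      using \<open>w \<in> normal_words n\<close> unfolding normal_words_def by blast
    then show ?thesis
    proof cases
      case 1
      then show ?thesis by (simp add: normal_words_def)
    next
      case 2
      then have "Cre # w = replicate (Suc i - 1) Cre @ replicate (Suc n - Suc i + 1) Ann"
        by (cases i) auto
      moreover have "Suc i \<in> {1..Suc n}" using 2 by simp
      ultimately show ?thesis unfolding normal_words_def by blast
    next
      case 3
      then have "Cre # w = replicate (Suc i - 1) Cre @ [Neu] @ replicate (Suc n - Suc i) Ann"
        by (cases i) auto
      moreover have "Suc i \<in> {1..Suc n}" using 3 by simp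
      ultimately show ?thesis unfolding normal_words_def by blast
    qed
  qed
  assume "length w = n \<and> sorted_wrt normal_pair w"
  then have "sorted_wrt normal_pair w" "length w = n" by auto
  then show "w \<in> normal_words n"
  proof (induction w arbitrary: n)
    case Nil
    then show ?case by (simp add: normal_words_def)
  next
    case (Cons x w)
    show ?case
    proof (cases "x = Cre")
      case True
      then show ?thesis using Cons \<open>\<And>w n. w \<in> normal_words n \<Longrightarrow> Cre # w \<in> normal_words (Suc n)\<close>
        by auto
    next
      case False
      then have "\<forall>y\<in>set w. y = Ann" using Cons.prems by auto
      then have "w = replicate (length w) Ann" by (simp add: replicate_length_same)
      then have "x # w = replicate (1 - 1) Cre @ replicate (n - 1 + 1) Ann \<or>
          x # w = replicate (1 - 1) Cre @ [Neu] @ replicate (n - 1) Ann"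
        using False Cons.prems by (cases x) auto
      moreover have "1 \<in> {1..n}" using Cons.prems by auto
      ultimately show ?thesis unfolding normal_words_def by blast
    qed
  qed
qed

text \<open>The state of the stack machine after some letters: for each variable that is visible from outside the
  set of positions touching it and the letter that remains of it, the latest variable first, and the
  position sets of the variables that were pushed and popped. The label Cre means that the variable
  has left the stack, so that it cannot be touched again.\<close>
type_synonym state = "(nat set \<times> letter) list \<times> nat set set"

text \<open>The letter at position i touches the top of the stack. If the latest listed variable is labelled
  Cre, or none is listed, then the top is an original variable that was not touched before.\<close>
fun absorb :: "nat \<Rightarrow> letter \<Rightarrow> state \<Rightarrow> state" where
  "absorb i Ann (Qs, Ms) = (({i}, Ann) # Qs, Ms)"
| "absorb i Neu ((B, Ann) # Qs, Ms) = ((insert i B, Ann) # Qs, Ms)"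
| "absorb i Neu ((B, Neu) # Qs, Ms) = ((insert i B, Neu) # Qs, Ms)"
| "absorb i Neu (Qs, Ms) = (({i}, Neu) # Qs, Ms)"
| "absorb i Cre ((B, Ann) # Qs, Ms) = (Qs, insert (insert i B) Ms)"
| "absorb i Cre ((B, Neu) # Qs, Ms) = ((insert i B, Cre) # Qs, Ms)"
| "absorb i Cre (Qs, Ms) = (({i}, Cre) # Qs, Ms)"

lemma absorb_cases:
  obtains (annihilate) Qs Ms where "x = Ann" "s = (Qs, Ms)" "absorb i x s = (({i}, Ann) # Qs, Ms)"
  | (neutral_open) B l Qs Ms where "x = Neu" "s = ((B, l) # Qs, Ms)" "l \<noteq> Cre"
      "absorb i x s = ((insert i B, l) # Qs, Ms)"
  | (close) B Qs Ms where "x = Cre" "s = ((B, Ann) # Qs, Ms)"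
      "absorb i x s = (Qs, insert (insert i B) Ms)"
  | (create_open) B Qs Ms where "x = Cre" "s = ((B, Neu) # Qs, Ms)"
      "absorb i x s = ((insert i B, Cre) # Qs, Ms)"
  | (new) Qs Ms where "x \<noteq> Ann" "s = (Qs, Ms)" "Qs = [] \<or> snd (hd Qs) = Cre"
      "absorb i x s = (({i}, x) # Qs, Ms)"
  by (cases "(i, x, s)" rule: absorb.cases) auto

definition states :: "nat \<Rightarrow> state set" where
  "states n = {(Qs, Ms). diagram n (map fst Qs) Ms \<and>
     sorted_wrt (\<lambda>y x. normal_pair x y) (map snd Qs)}"

lemma absorb_states:
  assumes "s \<in> states n"
  shows "absorb (Suc n) x s \<in> states (Suc n)"
proof (cases rule: absorb_cases[of x s "Suc n"])
  case (new Qs Ms)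
  have "normal_pair y x" if "y \<in> snd ` set Qs" for y
    using new that assms unfolding states_def by (cases Qs) auto
  then show ?thesis using assms new diagram_new unfolding states_def by auto
qed (use assms in \<open>auto simp: states_def diagram_new diagram_extend diagram_close\<close>)

lemma states_fresh:
  assumes "(Qs, Ms) \<in> states n"
  shows "(B, l) \<in> set Qs \<Longrightarrow> Suc n \<notin> B" "B \<in> Ms \<Longrightarrow> Suc n \<notin> B"
    "(B, l) \<in> set Qs \<Longrightarrow> B \<noteq> {}" "B \<in> Ms \<Longrightarrow> B \<noteq> {}"
proof -
  have d: "diagram n (map fst Qs) Ms" using assms by (simp add: states_def)
  show "B \<in> Ms \<Longrightarrow> Suc n \<notin> B" using diagram_fresh[OF d, of B] by auto
  show "B \<in> Ms \<Longrightarrow> B \<noteq> {}" using diagram_nonempty[OF d, of B] by auto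
  assume "(B, l) \<in> set Qs"
  then have "B \<in> set (map fst Qs)" by force
  then show "Suc n \<notin> B" "B \<noteq> {}" using diagram_fresh[OF d, of B] diagram_nonempty[OF d, of B] by auto
qed

text \<open>The block of the last point and the label of that block determine the last letter.\<close>
lemma absorb_surj:
  assumes "s' \<in> states (Suc n)"
  shows "\<exists>x. \<exists>s\<in>states n. absorb (Suc n) x s = s'"
proof -
  obtain Qs Ms where s': "s' = (Qs, Ms)" by (cases s')
  have d: "diagram (Suc n) (map fst Qs) Ms"
    and srt: "sorted_wrt (\<lambda>y x. normal_pair x y) (map snd Qs)"
    using assms s' by (auto simp: states_def)
  from d show ?thesis
  proof (cases rule: diagram_Suc_cases)
    case (new Ps')
    then obtain l R where Qs: "Qs = ({Suc n}, l) # R" "Ps' = map fst R" by auto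
    then have "(R, Ms) \<in> states n" using new srt by (simp add: states_def)
    moreover have "absorb (Suc n) l (R, Ms) = s'"
      using Qs srt s' by (cases rule: absorb_cases[of l "(R, Ms)" "Suc n"]) auto
    ultimately show ?thesis by blast
  next
    case (extend B Ps')
    then obtain l R where Qs: "Qs = (insert (Suc n) B, l) # R" "Ps' = map fst R" by auto
    \<comment> \<open>The label Cre of a grown block can only come from Neu: a pushed variable that is popped leaves the list.\<close>
    define l' where "l' = (if l = Ann then Ann else Neu)"
    define x where "x = (if l = Cre then Cre else Neu)"
    have "((B, l') # R, Ms) \<in> states n"
      using extend srt Qs by (auto simp: states_def l'_def)
    moreover have "absorb (Suc n) x ((B, l') # R, Ms) = s'"
      using Qs s' by (cases l) (auto simp: l'_def x_def)
    ultimately show ?thesis by blast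
  next
    case (close B Ms')
    then have "((B, Ann) # Qs, Ms') \<in> states n" using srt by (simp add: states_def)
    moreover have "absorb (Suc n) Cre ((B, Ann) # Qs, Ms') = s'"
      using close s' by simp
    ultimately show ?thesis by blast
  qed
qed

lemma absorb_inj:
  assumes s: "s \<in> states n" and t: "t \<in> states n"
    and eq: "absorb (Suc n) x s = absorb (Suc n) y t"
  shows "x = y \<and> s = t"
proof -
  obtain Qs Ms Qs' Ms' where st: "s = (Qs, Ms)" "t = (Qs', Ms')" by (cases s, cases t)
  note f = states_fresh[OF s[unfolded st(1)]] states_fresh[OF t[unfolded st(2)]]
  have ins: "A = B" if "insert (Suc n) A = insert (Suc n) B" "Suc n \<notin> A" "Suc n \<notin> B" for A B
    using that by (metis insert_ident)
  have new: "\<forall>(B, l)\<in>set (fst u). Suc n \<notin> B \<and> \<not> B \<subseteq> {Suc n}" "\<forall>D\<in>snd u. Suc n \<notin> D"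
    if "u = s \<or> u = t" for u
    using that f st by fastforce+
  note new' = new[of s, simplified] new[of t, simplified]
  show ?thesis
  proof (cases rule: absorb_cases[of x s "Suc n"])
    case (close B R Ns)
    note X = close
    have fr: "\<forall>D\<in>Ns. Suc n \<notin> D" "Suc n \<notin> B" "\<forall>(D, l)\<in>set R. Suc n \<notin> D"
      using f X st by auto
    show ?thesis
    proof (cases rule: absorb_cases[of y t "Suc n"])
      case (close C R' Ns')
      have fr': "\<forall>D\<in>Ns'. Suc n \<notin> D" "Suc n \<notin> C"
        using f(6) f(5)[of C Ann] close st by auto
      have R: "R = R'" and Ns: "insert (insert (Suc n) B) Ns = insert (insert (Suc n) C) Ns'"
        using X close eq by simp_all
      have "insert (Suc n) B \<in> insert (insert (Suc n) C) Ns'" using Ns by blast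
      then have BC: "insert (Suc n) B = insert (Suc n) C" using fr' by blast
      moreover have "insert (Suc n) B \<notin> Ns" "insert (Suc n) C \<notin> Ns'" using fr fr' by blast+
      ultimately have "Ns = Ns'" using Ns by (metis insert_ident)
      then show ?thesis using X close R ins[OF BC fr(2) fr'(2)] by simp
    qed (use X fr eq in auto)
  next
    case annihilate
    then show ?thesis using eq new'
      by (cases rule: absorb_cases[of y t "Suc n"]) auto
  next
    case (neutral_open B l R Ns)
    then show ?thesis using eq new'
      by (cases rule: absorb_cases[of y t "Suc n"]) (auto simp: insert_ident)
  next
    case (create_open B R Ns)
    then show ?thesis using eq new'
      by (cases rule: absorb_cases[of y t "Suc n"]) (auto simp: insert_ident)
  next
    case (new R Ns)
    then show ?thesis using eq new'
      by (cases rule: absorb_cases[of y t "Suc n"]) auto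
  qed
qed

definition run :: "letter list \<Rightarrow> state" where
  "run w = foldl (\<lambda>s (i, x). absorb (Suc i) x s) ([], {}) (List.enumerate 0 w)"

lemma run_Nil [simp]: "run [] = ([], {})"
  by (simp add: run_def)

lemma run_snoc [simp]: "run (w @ [x]) = absorb (Suc (length w)) x (run w)"
  by (simp add: run_def List.enumerate_append_eq)

lemma states_0: "states 0 = {([], {})}"
proof -
  have "([], {}) \<in> states 0" by (auto simp: states_def diagram_def noncrossing_def)
  moreover have "Qs = [] \<and> Ms = {}" if "(Qs, Ms) \<in> states 0" for Qs Ms
  proof -
    have d: "diagram 0 (map fst Qs) Ms" using that by (simp add: states_def)
    have "A = {}" if "A \<in> set (map fst Qs) \<union> Ms" for A
      using diagram_Union[OF d] that by auto
    then have "set (map fst Qs) \<union> Ms = {}" using diagram_nonempty[OF d] by (metis all_not_in_conv)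
    then show ?thesis by auto
  qed
  ultimately show ?thesis by auto
qed

lemma run_bij: "bij_betw run {w. length w = n} (states n)"
proof (induction n)
  case 0
  then show ?case by (simp add: states_0 bij_betw_def)
next
  case (Suc n)
  have dec: "\<exists>v x. w = v @ [x] \<and> length v = n" if "length w = Suc n" for w :: "letter list"
    using that by (metis append_butlast_last_id butlast_snoc diff_Suc_1 length_0_conv
        length_butlast nat.distinct(1))
  have mem: "run v \<in> states n" if "length v = n" for v
    using Suc that by (auto simp: bij_betw_def)
  show ?case unfolding bij_betw_def
  proof
    show "inj_on run {w. length w = Suc n}"
    proof (rule inj_onI)
      fix w w' assume "w \<in> {w. length w = Suc n}" "w' \<in> {w. length w = Suc n}" and eq: "run w = run w'"
      then obtain v x v' x' where w: "w = v @ [x]" "length v = n" "w' = v' @ [x']" "length v' = n"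
        using dec[of w] dec[of w'] by blast
      then have "x = x' \<and> run v = run v'"
        using eq absorb_inj[OF mem mem, of v v' x x'] by simp
      then show "w = w'" using w Suc by (auto simp: bij_betw_def inj_on_def)
    qed
    show "run ` {w. length w = Suc n} = states (Suc n)"
    proof (intro equalityI subsetI)
      fix s assume "s \<in> run ` {w. length w = Suc n}"
      then obtain v x where "s = run (v @ [x])" "length v = n" using dec by blast
      then show "s \<in> states (Suc n)" using absorb_states[OF mem] by simp
    next
      fix s assume "s \<in> states (Suc n)"
      then obtain x s0 where s0: "s0 \<in> states n" "absorb (Suc n) x s0 = s" using absorb_surj by blast
      moreover from s0 have "s0 \<in> run ` {w. length w = n}" using Suc by (simp add: bij_betw_def)
      then obtain v where "length v = n" "run v = s0" by blast
      ultimately have "run (v @ [x]) = s" "length (v @ [x]) = Suc n" by auto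
      then show "s \<in> run ` {w. length w = Suc n}" by blast
    qed
  qed
qed

lemma run_states: "run w \<in> states (length w)"
  using run_bij[of "length w"] by (auto simp: bij_betw_def)

section \<open>Letters that touch the same variable\<close>

definition blocks :: "state \<Rightarrow> nat set set" where
  "blocks s = fst ` set (fst s) \<union> snd s"

lemma run_bounds:
  assumes "B \<in> blocks (run w)" "a \<in> B"
  shows "1 \<le> a \<and> a \<le> length w"
proof -
  have d: "diagram (length w) (map fst (fst (run w))) (snd (run w))"
    using run_states[of w] by (auto simp: states_def)
  show ?thesis using diagram_bounds[OF d, of B a] assms by (auto simp: blocks_def)
qed

text \<open>A variable with a label other than Cre is still on the stack, so no letter has popped it. Positions are
  counted from 1, whereas list indices start at 0.\<close>
lemma run_open:
  assumes "(B, l) \<in> set (fst (run w))" "l \<noteq> Cre" "a \<in> B"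
  shows "w ! (a - 1) \<noteq> Cre"
  using assms
proof (induction w arbitrary: B l rule: rev_induct)
  case Nil
  then show ?case by simp
next
  case (snoc x w)
  have old: "(w @ [x]) ! (a - 1) \<noteq> Cre" if "(B', l') \<in> set (fst (run w))" "l' \<noteq> Cre" "a \<in> B'" for B' l'
  proof -
    have "1 \<le> a \<and> a \<le> length w"
      using run_bounds[of B' w a] that by (force simp: blocks_def)
    then show ?thesis using snoc.IH[OF that] by (auto simp: nth_append)
  qed
  show ?case
  proof (cases rule: absorb_cases[of x "run w" "Suc (length w)"])
    case (neutral_open B' l' Qs Ms)
    then show ?thesis using snoc.prems old[of B' l'] old[of B l] by auto
  qed (use snoc.prems old[of B l] in auto)
qed

lemma run_last_open:
  assumes "w \<noteq> []" "last w \<noteq> Cre"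
  shows "\<exists>B l Qs Ms. run w = ((B, l) # Qs, Ms) \<and> l \<noteq> Cre \<and> length w \<in> B"
proof -
  obtain v x where w: "w = v @ [x]" using assms by (meson rev_exhaust)
  show ?thesis using assms
    by (cases rule: absorb_cases[of x "run v" "Suc (length v)"]) (auto simp: w)
qed

text \<open>A variable is touched again only while it is on the stack, and it is touched again only by letters
  that read or pop it.\<close>
lemma same_block_letters:
  assumes "B \<in> blocks (run w)" "a \<in> B" "b \<in> B" "a < b"
  shows "\<not> normal_pair (w ! (a - 1)) (w ! (b - 1))"
  using assms
proof (induction w arbitrary: B rule: rev_induct)
  case Nil
  then show ?case by (simp add: blocks_def)
next
  case (snoc x w)
  have old: "\<not> normal_pair ((w @ [x]) ! (a - 1)) ((w @ [x]) ! (b - 1))"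
    if "B' \<in> blocks (run w)" "a \<in> B'" "b \<in> B'" for B'
    using snoc.IH[OF that(1,2,3) \<open>a < b\<close>] run_bounds[OF that(1,2)] run_bounds[OF that(1,3)]
    by (auto simp: nth_append)
  have ext: "\<not> normal_pair ((w @ [x]) ! (a - 1)) ((w @ [x]) ! (b - 1))"
    if "(B', l) \<in> set (fst (run w))" "l \<noteq> Cre" "x \<noteq> Ann" "a \<in> insert (Suc (length w)) B'"
      "b \<in> insert (Suc (length w)) B'" for B' l
  proof -
    have B': "B' \<in> blocks (run w)" using that by (force simp: blocks_def)
    have a: "a \<in> B'"
    proof (rule ccontr)
      assume "a \<notin> B'"
      then have "b \<in> B'" "Suc (length w) < b" using that \<open>a < b\<close> by auto
      then show False using run_bounds[OF B'] by fastforce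
    qed
    show ?thesis
    proof (cases "b \<in> B'")
      case True
      then show ?thesis using old[OF B' a] by blast
    next
      case False
      then have "b = Suc (length w)" using that by simp
      moreover have "w ! (a - 1) \<noteq> Cre" using run_open[OF that(1,2) a] .
      moreover have "a - 1 < length w" using run_bounds[OF B' a] by auto
      ultimately show ?thesis using \<open>x \<noteq> Ann\<close> by (simp add: nth_append)
    qed
  qed
  show ?case
  proof (cases rule: absorb_cases[of x "run w" "Suc (length w)"])
    case (neutral_open B' l Qs Ms)
    then show ?thesis using snoc.prems old[of B] ext[of B' l] by (auto simp: blocks_def)
  next
    case (close B' Qs Ms)
    then show ?thesis using snoc.prems old[of B] ext[of B' Ann] by (auto simp: blocks_def)
  next
    case (create_open B' Qs Ms)
    then show ?thesis using snoc.prems old[of B] ext[of B' Neu] by (auto simp: blocks_def)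
  qed (use snoc.prems old[of B] in \<open>auto simp: blocks_def\<close>)
qed

text \<open>A letter Ann or Neu leaves its variable on top of the stack, where the next letter, unless it pushes,
  finds it.\<close>
lemma neighbours_same_block:
  assumes "Suc i < length w" "\<not> normal_pair (w ! i) (w ! Suc i)"
  shows "\<exists>B\<in>blocks (run w). Suc i \<in> B \<and> Suc (Suc i) \<in> B"
  using assms
proof (induction w rule: rev_induct)
  case Nil
  then show ?case by simp
next
  case (snoc x w)
  show ?case
  proof (cases "Suc i < length w")
    case True
    then obtain B where B: "B \<in> blocks (run w)" "Suc i \<in> B" "Suc (Suc i) \<in> B"
      using snoc by (auto simp: nth_append)
    have "\<exists>B'\<in>blocks (run (w @ [x])). B \<subseteq> B'"
      using B(1) by (cases rule: absorb_cases[of x "run w" "Suc (length w)"]) (auto simp: blocks_def)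
    then show ?thesis using B by blast
  next
    case False
    then have len: "length w = Suc i" using snoc.prems by simp
    then have "w \<noteq> []" by auto
    then have "last w \<noteq> Cre" "x \<noteq> Ann"
      using snoc.prems len by (auto simp: nth_append last_conv_nth)
    with \<open>w \<noteq> []\<close> obtain B l Qs Ms where "run w = ((B, l) # Qs, Ms)" "l \<noteq> Cre" "length w \<in> B"
      using run_last_open by metis
    moreover from this \<open>x \<noteq> Ann\<close> have "insert (Suc (length w)) B \<in> blocks (run (w @ [x]))"
      by (cases rule: absorb_cases[of x "run w" "Suc (length w)"]) (auto simp: blocks_def)
    ultimately show ?thesis using len by (metis insertI1 insertI2)
  qed
qed

section \<open>Products of normally ordered words and segments\<close>

lemma product_words_Cons:
  "w \<in> product_words (k # ks) \<longleftrightarrow> (\<exists>u v. w = u @ v \<and> u \<in> normal_words k \<and> v \<in> product_words ks)"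
proof
  assume "w \<in> product_words (k # ks)"
  then obtain u ws where "w = u @ concat ws" "u \<in> normal_words k"
      "list_all2 (\<lambda>w k. w \<in> normal_words k) ws ks"
    unfolding product_words_def list_all2_Cons2 by auto
  then show "\<exists>u v. w = u @ v \<and> u \<in> normal_words k \<and> v \<in> product_words ks"
    unfolding product_words_def by blast
next
  assume "\<exists>u v. w = u @ v \<and> u \<in> normal_words k \<and> v \<in> product_words ks"
  then obtain u ws where "w = concat (u # ws)" "list_all2 (\<lambda>w k. w \<in> normal_words k) (u # ws) (k # ks)"
    unfolding product_words_def by auto
  then show "w \<in> product_words (k # ks)" unfolding product_words_def by blast
qed

lemma product_words_length: "w \<in> product_words ks \<Longrightarrow> length w = sum_list ks"
  by (induction ks arbitrary: w)
    (auto simp: product_words_Cons normal_words_iff, auto simp: product_words_def)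

lemma segment_Cons_0: "segment (k # ks) 0 = {1..k}"
  by (simp add: segment_def)

lemma segment_Cons_Suc: "segment (k # ks) (Suc j) = (\<lambda>i. k + i) ` segment ks j"
  by (simp add: segment_def image_add_atLeastAtMost add.assoc)

lemma sorted_wrt_normal_pair:
  "sorted_wrt normal_pair w \<longleftrightarrow> (\<forall>i. Suc i < length w \<longrightarrow> normal_pair (w ! i) (w ! Suc i))"
proof -
  have "transp normal_pair" by (auto simp: transp_def)
  then show ?thesis by (simp add: sorted_wrt_iff_nth_Suc_transp)
qed

text \<open>The two versions are matched with \<open>same_block_letters\<close>, which speaks of arbitrary pairs of
  positions, and with \<open>neighbours_same_block\<close>.\<close>
lemma product_words_iff:
  "w \<in> product_words ks \<longleftrightarrow> length w = sum_list ks \<and>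
     (\<forall>j<length ks. \<forall>a\<in>segment ks j. \<forall>b\<in>segment ks j. a < b \<longrightarrow>
        normal_pair (w ! (a - 1)) (w ! (b - 1)))" (is "?L w ks \<longleftrightarrow> ?G w ks")
  and product_words_iff_neighbours:
  "w \<in> product_words ks \<longleftrightarrow> length w = sum_list ks \<and>
     (\<forall>j<length ks. \<forall>i. Suc i \<in> segment ks j \<longrightarrow> Suc (Suc i) \<in> segment ks j \<longrightarrow>
        normal_pair (w ! i) (w ! Suc i))" (is "?L w ks \<longleftrightarrow> ?N w ks")
proof -
  have LG: "?G w ks" if "?L w ks" using that
  proof (induction ks arbitrary: w)
    case Nil
    then show ?case using product_words_length by fastforce
  next
    case (Cons k ks)
    then obtain u v where w: "w = u @ v" "u \<in> normal_words k" "v \<in> product_words ks"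
      unfolding product_words_Cons by blast
    then have u: "length u = k" "sorted_wrt normal_pair u" by (auto simp: normal_words_iff)
    note v = Cons.IH[OF w(3)]
    show ?case
    proof (intro conjI allI impI ballI)
      show "length w = sum_list (k # ks)" using u v w by simp
      fix j a b assume j: "j < length (k # ks)" and a: "a \<in> segment (k # ks) j"
        and b: "b \<in> segment (k # ks) j" and ab: "a < b"
      show "normal_pair (w ! (a - 1)) (w ! (b - 1))"
      proof (cases j)
        case 0
        then have "a \<ge> 1" "b \<le> k" using a b segment_Cons_0 by auto
        then show ?thesis using u ab sorted_wrt_nth_less[OF u(2), of "a - 1" "b - 1"] w
          by (auto simp: nth_append)
      next
        case (Suc j')
        then obtain a' b' where *: "a' \<in> segment ks j'" "b' \<in> segment ks j'" "a = k + a'" "b = k + b'"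
          using a b segment_Cons_Suc by auto
        moreover have "1 \<le> a'" "1 \<le> b'" using * by (auto simp: segment_def)
        ultimately show ?thesis using v j Suc ab u w by (auto simp: nth_append)
      qed
    qed
  qed
  have GN: "?N w ks" if "?G w ks"
    using that by (metis diff_Suc_1 lessI)
  have NL: "?L w ks" if "?N w ks" using that
  proof (induction ks arbitrary: w)
    case Nil
    then show ?case by (simp add: product_words_def)
  next
    case (Cons k ks)
    let ?u = "take k w" and ?v = "drop k w"
    have len: "length w = k + sum_list ks" using Cons.prems by simp
    have N: "normal_pair (w ! i) (w ! Suc i)" if "j < Suc (length ks)"
      "Suc i \<in> segment (k # ks) j" "Suc (Suc i) \<in> segment (k # ks) j" for i j
      using Cons.prems that by simp
    have "?u \<in> normal_words k"
      unfolding normal_words_iff sorted_wrt_normal_pair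
      using len N[of 0] by (simp add: segment_Cons_0)
    moreover have "?v \<in> product_words ks"
    proof (rule Cons.IH, intro conjI allI impI)
      show "length ?v = sum_list ks" using len by simp
      fix j i assume "j < length ks" "Suc i \<in> segment ks j" "Suc (Suc i) \<in> segment ks j"
      then show "normal_pair (?v ! i) (?v ! Suc i)"
        using N[of "Suc j" "k + i"] len by (force simp: segment_Cons_Suc)
    qed
    ultimately show ?case unfolding product_words_Cons by (metis append_take_drop_id)
  qed
  show "?L w ks \<longleftrightarrow> ?G w ks" using LG GN NL by blast
  show "?L w ks \<longleftrightarrow> ?N w ks" using LG GN NL by blast
qed

text \<open>Two positions of one segment are in the same block only if their letters violate the normal order;
  conversely, a violation within a segment occurs already between neighbours, which then share a
  block.\<close>
lemma product_words_iff_blocks: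
  "w \<in> product_words ks \<longleftrightarrow> length w = sum_list ks \<and>
     (\<forall>A\<in>blocks (run w). \<forall>j<length ks. card (A \<inter> segment ks j) \<le> 1)"
proof (intro iffI conjI ballI allI impI)
  assume w: "w \<in> product_words ks"
  then show "length w = sum_list ks" by (rule product_words_length)
  fix A j assume A: "A \<in> blocks (run w)" and j: "j < length ks"
  have False if ab: "a \<in> A \<inter> segment ks j" "b \<in> A \<inter> segment ks j" "a < b" for a b
    using same_block_letters[OF A _ _ ab(3)] w j ab unfolding product_words_iff by blast
  then have "\<forall>a\<in>A \<inter> segment ks j. \<forall>b\<in>A \<inter> segment ks j. a = b"
    by (meson nat_neq_iff)
  moreover have "finite (A \<inter> segment ks j)" by (simp add: segment_def)
  ultimately show "card (A \<inter> segment ks j) \<le> 1"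
    by (simp add: card_le_Suc0_iff_eq)
next
  assume *: "length w = sum_list ks \<and>
     (\<forall>A\<in>blocks (run w). \<forall>j<length ks. card (A \<inter> segment ks j) \<le> 1)"
  show "w \<in> product_words ks"
  proof (rule ccontr)
    assume "w \<notin> product_words ks"
    then obtain j i where ji: "j < length ks" "Suc i \<in> segment ks j" "Suc (Suc i) \<in> segment ks j"
      "\<not> normal_pair (w ! i) (w ! Suc i)"
      unfolding product_words_iff_neighbours using * by blast
    have "Suc (Suc i) \<le> sum_list (take (Suc j) ks)" using ji by (simp add: segment_def)
    also have "\<dots> \<le> sum_list (take (Suc j) ks) + sum_list (drop (Suc j) ks)" by simp
    also have "\<dots> = length w"
      using * by (metis append_take_drop_id sum_list_append)
    finally obtain B where B: "B \<in> blocks (run w)" "Suc i \<in> B" "Suc (Suc i) \<in> B"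
      using neighbours_same_block[of i w] ji by auto
    have "finite (B \<inter> segment ks j)" by (simp add: segment_def)
    then have "Suc i = Suc (Suc i)"
      using * B ji by (metis IntI One_nat_def card_le_Suc0_iff_eq)
    then show False by simp
  qed
qed

section \<open>From states to marked partitions\<close>

lemma starts_before_Min:
  assumes "finite A" "A \<noteq> {}" "finite B" "B \<noteq> {}"
  shows "starts_before A B \<longleftrightarrow> Min A < Min B"
proof
  assume "starts_before A B"
  then obtain a where "a \<in> A" "\<forall>b\<in>B. a < b" unfolding starts_before_def by blast
  moreover have "Min B \<in> B" "Min A \<le> a" using assms calculation by auto
  ultimately show "Min A < Min B" by fastforce
next
  assume "Min A < Min B"
  then have "\<forall>b\<in>B. Min A < b" using assms by simp
  then show "starts_before A B" unfolding starts_before_def using assms by (meson Min_in)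
qed

lemma enclosed_Min_Max:
  assumes "finite A" "A \<noteq> {}" "finite B" "B \<noteq> {}"
  shows "enclosed B A \<longleftrightarrow> Min A < Min B \<and> Max B < Max A"
proof
  assume "enclosed B A"
  then obtain a c where "a \<in> A" "c \<in> A" "\<forall>b\<in>B. a < b \<and> b < c"
    unfolding enclosed_def by blast
  moreover from this have "Min A \<le> a" "c \<le> Max A" using assms by auto
  moreover have "Min B \<in> B" "Max B \<in> B" using assms by auto
  ultimately show "Min A < Min B \<and> Max B < Max A" by fastforce
next
  assume *: "Min A < Min B \<and> Max B < Max A"
  then have "\<forall>b\<in>B. Min A < b \<and> b < Max A" using assms by simp
  then show "enclosed B A" unfolding enclosed_def using assms by (meson Max_in Min_in)
qed

definition marked :: "state \<Rightarrow> marked_partition" where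
  "marked s = (\<lambda>Q. (fst Q, 1)) ` set (fst s) \<union> (\<lambda>D. (D, -1)) ` snd s"

lemma sorted_blocks_unique:
  assumes "set Bs = set Bs'" "inj_on Min (set Bs)"
    and "sorted_wrt (\<lambda>A B. Min A < Min B) Bs" "sorted_wrt (\<lambda>A B. Min A < Min B) Bs'"
  shows "Bs = (Bs' :: nat set list)"
proof -
  have "map Min Bs = map Min Bs'"
    using assms by (intro strict_sorted_equal) (simp_all add: sorted_wrt_map)
  then show ?thesis using assms(1,2) by (metis map_inj_on sup.idem)
qed

lemma states_diagram: "(Qs, Ms) \<in> states n \<Longrightarrow> diagram n (map fst Qs) Ms"
  by (simp add: states_def)

lemma diagram_Min_sorted:
  assumes d: "diagram n Ps Ms"
  shows "sorted_wrt (\<lambda>A B. Min A < Min B) (rev Ps)"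
  unfolding sorted_wrt_rev
  by (rule sorted_wrt_mono_rel[OF _ diagram_sorted[OF d]])
    (use diagram_finite[OF d] diagram_nonempty[OF d] in \<open>auto simp: starts_before_Min\<close>)

lemma plus_blocksI:
  assumes "set Bs = {B. (B, 1) \<in> \<kappa>}" "sorted_wrt (\<lambda>A B. Min A < Min B) Bs"
  shows "plus_blocks \<kappa> = Bs"
  unfolding plus_blocks_def
proof (rule the_equality)
  have inj: "inj_on Min (set Bs)"
  proof (rule inj_onI, rule ccontr)
    fix A B assume "A \<in> set Bs" "B \<in> set Bs" "Min A = Min B" "A \<noteq> B"
    then obtain i j where "i < length Bs" "j < length Bs" "Min (Bs ! i) = Min (Bs ! j)" "i \<noteq> j"
      by (metis in_set_conv_nth)
    then show False using sorted_wrt_nth_less[OF assms(2)] by (metis nat_neq_iff)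
  qed
  show "set Bs = {B. (B, 1) \<in> \<kappa>} \<and> sorted_wrt (\<lambda>A B. Min A < Min B) Bs" using assms by blast
  fix Bs' assume "set Bs' = {B. (B, 1) \<in> \<kappa>} \<and> sorted_wrt (\<lambda>A B. Min A < Min B) Bs'"
  then show "Bs' = Bs" using sorted_blocks_unique[of Bs Bs'] inj assms by simp
qed

lemma plus_blocks_marked:
  assumes "(Qs, Ms) \<in> states n"
  shows "plus_blocks (marked (Qs, Ms)) = rev (map fst Qs)"
proof (rule plus_blocksI)
  show "set (rev (map fst Qs)) = {B. (B, 1) \<in> marked (Qs, Ms)}"
    by (auto simp: marked_def)
qed (rule diagram_Min_sorted[OF states_diagram[OF assms]])

lemma minus_blocks_marked: "minus_blocks (marked (Qs, Ms)) = Ms"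
  by (auto simp: minus_blocks_def marked_def)

lemma underlying_marked: "underlying (marked s) = blocks s"
  by (force simp: marked_def blocks_def)

lemma marked_G_set:
  assumes "s \<in> states n"
  shows "marked s \<in> G_set n"
proof -
  obtain Qs Ms where s: "s = (Qs, Ms)" by (cases s)
  have d: "diagram n (map fst Qs) Ms" using assms s states_diagram by blast
  have b: "blocks s = set (map fst Qs) \<union> Ms" by (simp add: blocks_def s)
  have "inj_on fst (marked s)"
  proof (rule inj_onI)
    fix x y assume "x \<in> marked s" "y \<in> marked s" "fst x = fst y"
    moreover have False if "(a, l) \<in> set Qs" "a \<in> Ms" for a l
      using diagram_marks[OF d, of a] that by force
    ultimately show "x = y" by (auto simp: marked_def s)
  qed
  moreover have "partition_on {1..n} (blocks s)"
    unfolding b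
  proof (rule partition_onI)
    show "\<Union> (set (map fst Qs) \<union> Ms) = {1..n}" by (rule diagram_Union[OF d])
    show "{} \<notin> set (map fst Qs) \<union> Ms" using diagram_nonempty[OF d] by blast
    show "disjnt p q" if "p \<in> set (map fst Qs) \<union> Ms" "q \<in> set (map fst Qs) \<union> Ms" "p \<noteq> q" for p q
      using diagram_disjoint[OF d that(1,2)] that(3) unfolding disjnt_def by blast
  qed
  moreover have "noncrossing (blocks s)"
    using d unfolding b diagram_def by (elim conjE)
  moreover have "\<forall>(A, m)\<in>marked s. m \<in> {-1, 1} \<and> (card A = 1 \<longrightarrow> m = 1)"
    using diagram_card[OF d] by (auto simp: marked_def s)
  moreover have False
    if "(A, m) \<in> marked s" "(B, 1) \<in> marked s" "A \<noteq> B" "Min A < Min B" "Max B < Max A" for A m B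
  proof -
    have A: "A \<in> set (map fst Qs) \<union> Ms" and B: "B \<in> set (map fst Qs)"
      using that by (auto simp: marked_def s)
    have "enclosed B A"
      using that diagram_finite[OF d] diagram_nonempty[OF d] A B by (subst enclosed_Min_Max) auto
    then show False using diagram_enclosed[OF d B A] that by blast
  qed
  ultimately show ?thesis
    unfolding G_set_def NC_marked_def mem_Collect_eq underlying_marked by blast
qed

lemma exists_sorted_blocks:
  assumes "finite S" "inj_on Min S"
  shows "\<exists>Bs. set Bs = S \<and> sorted_wrt (\<lambda>A B. Min A < (Min B :: nat)) Bs"
proof -
  let ?Bs = "map (inv_into S Min) (sorted_list_of_set (Min ` S))"
  have "set ?Bs = S" using assms by (simp add: inv_into_image_cancel image_image)
  moreover have "sorted_wrt (\<lambda>A B. Min A < Min B) ?Bs"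
    unfolding sorted_wrt_map
    by (rule sorted_wrt_mono_rel[OF _ strict_sorted_list_of_set])
      (use assms in \<open>auto simp: f_inv_into_f\<close>)
  ultimately show ?thesis by blast
qed

text \<open>Recovers the state from a marked partition and the remaining letters; the ordering of the blocks
  by minima makes the assignment of letters to blocks unambiguous.\<close>
lemma G_set_state:
  assumes \<kappa>: "\<kappa> \<in> G_set n" and w: "w \<in> normal_words (length (plus_blocks \<kappa>))"
  defines "s \<equiv> (rev (zip (plus_blocks \<kappa>) w), minus_blocks \<kappa>)"
  shows "s \<in> states n \<and> marked s = \<kappa> \<and> rev (map snd (fst s)) = w"
proof -
  let ?P = "{B. (B, 1) \<in> \<kappa>}" and ?M = "minus_blocks \<kappa>"
  have inj: "inj_on fst \<kappa>" and part: "partition_on {1..n} (underlying \<kappa>)"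
    and nc: "noncrossing (underlying \<kappa>)"
    and marks: "\<forall>(A, m)\<in>\<kappa>. m \<in> {-1, 1} \<and> (card A = 1 \<longrightarrow> m = 1)"
    using \<kappa> unfolding G_set_def NC_marked_def by auto
  have under: "underlying \<kappa> = ?P \<union> ?M"
    using marks by (force simp: minus_blocks_def)
  have fin: "finite A" "A \<noteq> {}" if "A \<in> ?P \<union> ?M" for A
    using part that partition_onD1[OF part] partition_onD3[OF part] under
    by (metis Union_upper finite_atLeastAtMost finite_subset, metis)
  have disj: "A = B" if "A \<in> ?P \<union> ?M" "B \<in> ?P \<union> ?M" "i \<in> A" "i \<in> B" for A B i
    using partition_onD2[OF part] that unfolding under disjoint_def by blast
  have finP: "finite (?P \<union> ?M)"
    using finite_elements[OF _ part] under by simp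
  have "inj_on Min ?P"
    by (rule inj_onI) (metis Min_in UnI1 disj fin)
  then obtain Bs where Bs: "set Bs = ?P" "sorted_wrt (\<lambda>A B. Min A < Min B) Bs"
    using exists_sorted_blocks[of ?P] finP by auto
  then have pb: "plus_blocks \<kappa> = Bs" by (rule plus_blocksI)
  have len: "length w = length Bs" and norm: "sorted_wrt normal_pair w"
    using w pb by (auto simp: normal_words_iff)
  have fsts: "map fst (fst s) = rev Bs" and snds: "map snd (fst s) = rev w"
    using len by (auto simp: s_def pb rev_map[symmetric])
  have "diagram n (rev Bs) ?M"
  proof (rule diagramI, unfold set_rev Bs(1))
    show "\<Union> (?P \<union> ?M) = {1..n}" using partition_onD1[OF part] under by simp
    show "{} \<notin> ?P \<union> ?M" using fin by blast
    show "?P \<inter> ?M = {}"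
      using inj_onD[OF inj] by (fastforce simp: minus_blocks_def)
    show "A = B" if "A \<in> ?P \<union> ?M" "B \<in> ?P \<union> ?M" "i \<in> A" "i \<in> B" for A B i
      using disj that .
    show False if "A \<in> ?P \<union> ?M" "B \<in> ?P \<union> ?M" "A \<noteq> B"
       "a < b" "b < c" "c < d" "a \<in> A" "c \<in> A" "b \<in> B" "d \<in> B" for A B a b c d
      using nc that unfolding under noncrossing_def by metis
    show "card D \<noteq> 1" if "D \<in> ?M" for D
      using marks that by (force simp: minus_blocks_def)
    show False if "B \<in> ?P" "A \<in> ?P \<union> ?M" "A \<noteq> B" "enclosed B A" for A B
    proof -
      have "Min A < Min B" "Max B < Max A"
        using that fin enclosed_Min_Max[of A B] by auto
      moreover have "Min B \<le> Max B" using fin[of B] that by simp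
      moreover from that(2) obtain m where "(A, m) \<in> \<kappa>" by (auto simp: minus_blocks_def)
      ultimately show False using \<kappa> that unfolding G_set_def by blast
    qed
    show "sorted_wrt (\<lambda>B A. starts_before A B) (rev Bs)"
      unfolding sorted_wrt_rev
      by (rule sorted_wrt_mono_rel[OF _ Bs(2)]) (use fin Bs(1) in \<open>auto simp: starts_before_Min\<close>)
  qed
  then have "s \<in> states n"
    unfolding states_def using fsts snds norm by (auto simp: s_def sorted_wrt_rev)
  moreover have "marked s = \<kappa>"
  proof -
    have "(\<lambda>Q. (fst Q, 1 :: int)) ` set (fst s) = (\<lambda>B. (B, 1)) ` set (map fst (fst s))"
      by (simp add: image_image)
    also have "\<dots> = (\<lambda>B. (B, 1)) ` ?P" unfolding fsts using Bs by simp
    finally have "marked s = (\<lambda>B. (B, 1)) ` ?P \<union> (\<lambda>D. (D, -1)) ` ?M"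
      by (simp add: marked_def s_def)
    also have "\<dots> = \<kappa>" using marks by (force simp: minus_blocks_def)
    finally show ?thesis .
  qed
  moreover have "rev (map snd (fst s)) = w" using snds by simp
  ultimately show ?thesis by blast
qed

definition labels :: "state \<Rightarrow> letter list" where
  "labels s = rev (map snd (fst s))"

lemma marked_bij:
  "bij_betw (\<lambda>s. (marked s, labels s)) (states n)
     (SIGMA \<kappa>:G_set n. normal_words (length (plus_blocks \<kappa>)))"
proof (rule bij_betw_byWitness[where f' = "\<lambda>(\<kappa>, w). (rev (zip (plus_blocks \<kappa>) w), minus_blocks \<kappa>)"])
  show "\<forall>s\<in>states n. (\<lambda>(\<kappa>, w). (rev (zip (plus_blocks \<kappa>) w), minus_blocks \<kappa>)) (marked s, labels s) = s"
    by (auto simp: plus_blocks_marked minus_blocks_marked labels_def zip_rev[symmetric] zip_map_fst_snd)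
  show "\<forall>p\<in>SIGMA \<kappa>:G_set n. normal_words (length (plus_blocks \<kappa>)).
      (\<lambda>s. (marked s, labels s)) ((\<lambda>(\<kappa>, w). (rev (zip (plus_blocks \<kappa>) w), minus_blocks \<kappa>)) p) = p"
    using G_set_state by (auto simp: labels_def)
  show "(\<lambda>s. (marked s, labels s)) ` states n \<subseteq> (SIGMA \<kappa>:G_set n. normal_words (length (plus_blocks \<kappa>)))"
    using marked_G_set
    by (auto simp: labels_def plus_blocks_marked normal_words_iff states_def sorted_wrt_rev)
  show "(\<lambda>(\<kappa>, w). (rev (zip (plus_blocks \<kappa>) w), minus_blocks \<kappa>)) `
      (SIGMA \<kappa>:G_set n. normal_words (length (plus_blocks \<kappa>))) \<subseteq> states n"
    using G_set_state by auto
qed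

text \<open>Matches the terms on the two sides of the Wick rule: the words of the product of Wick products with
  the normally ordered words of the Wick products of all contractions.\<close>
lemma product_words_bij:
  "bij_betw (\<lambda>w. (marked (run w), labels (run w))) (product_words ks)
     (SIGMA \<kappa>:admissible ks. normal_words (length (plus_blocks \<kappa>)))"
proof -
  let ?n = "sum_list ks"
  let ?f = "\<lambda>w. (marked (run w), labels (run w))"
  let ?S = "SIGMA \<kappa>:G_set ?n. normal_words (length (plus_blocks \<kappa>))"
  have bij: "bij_betw ?f {w. length w = ?n} ?S"
    using bij_betw_trans[OF run_bij marked_bij] by (simp add: comp_def)
  have adm: "w \<in> product_words ks \<longleftrightarrow> marked (run w) \<in> admissible ks" if "length w = ?n" for w
  proof -
    have "marked (run w) \<in> G_set ?n" using marked_G_set[OF run_states, of w] that by simp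
    then show ?thesis
      using that unfolding product_words_iff_blocks admissible_def mem_Collect_eq underlying_marked
      by blast
  qed
  have "?f ` product_words ks = (SIGMA \<kappa>:admissible ks. normal_words (length (plus_blocks \<kappa>)))"
  proof (intro equalityI subsetI)
    fix p assume "p \<in> ?f ` product_words ks"
    then obtain w where w: "w \<in> product_words ks" "p = ?f w" by blast
    then have "length w = ?n" using product_words_length by blast
    then show "p \<in> (SIGMA \<kappa>:admissible ks. normal_words (length (plus_blocks \<kappa>)))"
      using bij w adm[of w] unfolding bij_betw_def by blast
  next
    fix p assume p: "p \<in> (SIGMA \<kappa>:admissible ks. normal_words (length (plus_blocks \<kappa>)))"
    then have "p \<in> ?S" by (auto simp: admissible_def)
    then obtain w where w: "length w = ?n" "p = ?f w" using bij unfolding bij_betw_def by blast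
    then show "p \<in> ?f ` product_words ks" using p adm[of w] by auto
  qed
  moreover have "product_words ks \<subseteq> {w. length w = ?n}" using product_words_length by blast
  ultimately show ?thesis using bij unfolding bij_betw_def by (meson inj_on_subset)
qed

section \<open>Integration over powers of the base space\<close>

lemma length_tup [simp]: "length (tup n x) = n"
  by (simp add: tup_def)

lemma nth_tup [simp]: "i < n \<Longrightarrow> tup n x ! i = x i"
  by (simp add: tup_def)

lemma set_tup: "set (tup n x) = x ` {..<n}"
  by (auto simp: tup_def)

text \<open>A Radon measure on a locally compact second countable space is of this kind by
  \<open>compact_exhaustion\<close>. The exhaustion gives sigma-finiteness and reduces almost everywhere statements to compact sets.\<close>
locale exhausted_measure =
  fixes \<sigma> :: "'a::{second_countable_topology, t2_space} measure"
  assumes sets_eq_borel [measurable_cong]: "sets \<sigma> = sets borel"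
    and finite_compact: "\<And>K. compact K \<Longrightarrow> emeasure \<sigma> K < \<infinity>"
    and exhaustion: "\<exists>Q :: nat \<Rightarrow> 'a set. (\<forall>i. compact (Q i)) \<and> incseq Q \<and> (\<Union>i. Q i) = UNIV"
begin

lemma space_UNIV [simp]: "space \<sigma> = UNIV"
  using sets_eq_imp_space_eq[OF sets_eq_borel] by simp

lemma compact_sets [measurable]: "compact K \<Longrightarrow> K \<in> sets \<sigma>"
  unfolding sets_eq_borel by (intro borel_closed compact_imp_closed)

sublocale sigma_finite_measure \<sigma>
proof
  obtain Q :: "nat \<Rightarrow> 'a set" where Q: "\<And>i. compact (Q i)" "(\<Union>i. Q i) = UNIV"
    using exhaustion by blast
  show "\<exists>A. countable A \<and> A \<subseteq> sets \<sigma> \<and> \<Union> A = space \<sigma> \<and> (\<forall>a\<in>A. emeasure \<sigma> a \<noteq> \<infinity>)"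
    by (rule exI[of _ "range Q"]) (use Q compact_sets finite_compact in \<open>auto simp: less_top\<close>)
qed

sublocale products: product_sigma_finite "\<lambda>_. \<sigma>"
  by standard

abbreviation "T m \<equiv> power_meas \<sigma> m"

lemma sigma_finite_T: "sigma_finite_measure (T m)"
  by (rule products.sigma_finite) simp

sublocale T_\<sigma>: pair_sigma_finite "T m" \<sigma> for m
  by (intro pair_sigma_finite.intro sigma_finite_T sigma_finite_measure_axioms)

text \<open>Prepending a variable. As the new variable takes index 0, all the others are shifted.\<close>
definition cons_tuple :: "nat \<Rightarrow> (nat \<Rightarrow> 'a) \<times> 'a \<Rightarrow> nat \<Rightarrow> 'a" where
  "cons_tuple m = (\<lambda>(x, t). \<lambda>i\<in>{..<Suc m}. case i of 0 \<Rightarrow> t | Suc j \<Rightarrow> x j)"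

lemma tup_cons_tuple [simp]: "tup (Suc m) (cons_tuple m (x, t)) = t # tup m x"
  by (rule nth_equalityI) (auto simp: cons_tuple_def nth_Cons split: nat.split)

lemma measurable_cons_tuple [measurable]: "cons_tuple m \<in> T m \<Otimes>\<^sub>M \<sigma> \<rightarrow>\<^sub>M T (Suc m)"
  unfolding cons_tuple_def split_beta'
proof (rule measurable_restrict)
  fix i assume "i \<in> {..<Suc m}"
  then show "(\<lambda>p. case i of 0 \<Rightarrow> snd p | Suc j \<Rightarrow> fst p j) \<in> T m \<Otimes>\<^sub>M \<sigma> \<rightarrow>\<^sub>M \<sigma>"
    by (cases i) auto
qed

lemma distr_cons_tuple: "distr (T m \<Otimes>\<^sub>M \<sigma>) (T (Suc m)) (cons_tuple m) = T (Suc m)"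
proof (rule products.PiM_eqI)
  fix A assume A: "\<And>i. i \<in> {..<Suc m} \<Longrightarrow> A i \<in> sets \<sigma>"
  have "cons_tuple m -` Pi\<^sub>E {..<Suc m} A \<inter> space (T m \<Otimes>\<^sub>M \<sigma>) = Pi\<^sub>E {..<m} (\<lambda>i. A (Suc i)) \<times> A 0"
  proof (intro equalityI subsetI)
    fix p assume p: "p \<in> cons_tuple m -` Pi\<^sub>E {..<Suc m} A \<inter> space (T m \<Otimes>\<^sub>M \<sigma>)"
    obtain x t where xt: "p = (x, t)" by (cases p)
    have ext: "x \<in> extensional {..<m}"
      using p xt by (auto simp: space_pair_measure space_PiM PiE_def)
    have "cons_tuple m (x, t) i \<in> A i" if "i < Suc m" for i using p xt that by auto
    from this[of 0] this[of "Suc _"] have "t \<in> A 0" "\<And>i. i < m \<Longrightarrow> x i \<in> A (Suc i)"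
      by (auto simp: cons_tuple_def)
    then show "p \<in> Pi\<^sub>E {..<m} (\<lambda>i. A (Suc i)) \<times> A 0" using ext xt by (auto simp: PiE_def)
  next
    fix p assume p: "p \<in> Pi\<^sub>E {..<m} (\<lambda>i. A (Suc i)) \<times> A 0"
    obtain x t where xt: "p = (x, t)" by (cases p)
    have "cons_tuple m (x, t) \<in> Pi\<^sub>E {..<Suc m} A"
      using p xt by (auto simp: cons_tuple_def PiE_iff split: nat.split)
    then show "p \<in> cons_tuple m -` Pi\<^sub>E {..<Suc m} A \<inter> space (T m \<Otimes>\<^sub>M \<sigma>)"
      using p xt by (auto simp: space_pair_measure space_PiM PiE_iff)
  qed
  then have "emeasure (distr (T m \<Otimes>\<^sub>M \<sigma>) (T (Suc m)) (cons_tuple m)) (Pi\<^sub>E {..<Suc m} A) =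
      emeasure (T m \<Otimes>\<^sub>M \<sigma>) (Pi\<^sub>E {..<m} (\<lambda>i. A (Suc i)) \<times> A 0)"
    using A by (subst emeasure_distr) (auto intro!: sets_PiM_I_finite)
  also have "\<dots> = emeasure (T m) (Pi\<^sub>E {..<m} (\<lambda>i. A (Suc i))) * emeasure \<sigma> (A 0)"
    using A by (intro emeasure_pair_measure_Times sets_PiM_I_finite) auto
  also have "\<dots> = (\<Prod>i<m. emeasure \<sigma> (A (Suc i))) * emeasure \<sigma> (A 0)"
    using A by (subst products.emeasure_PiM) auto
  also have "\<dots> = (\<Prod>i<Suc m. emeasure \<sigma> (A i))"
    by (subst prod.lessThan_Suc_shift) (simp add: mult.commute)
  finally show "emeasure (distr (T m \<Otimes>\<^sub>M \<sigma>) (T (Suc m)) (cons_tuple m)) (Pi\<^sub>E {..<Suc m} A) =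
      (\<Prod>i\<in>{..<Suc m}. emeasure \<sigma> (A i))" .
qed auto

lemma nn_integral_T_Suc:
  assumes [measurable]: "(\<lambda>y. F (tup (Suc m) y)) \<in> borel_measurable (T (Suc m))"
  shows "(\<integral>\<^sup>+y. F (tup (Suc m) y) \<partial>T (Suc m)) = (\<integral>\<^sup>+x. \<integral>\<^sup>+t. F (t # tup m x) \<partial>\<sigma> \<partial>T m)"
proof -
  have "(\<lambda>p. F (tup (Suc m) (cons_tuple m p))) \<in> borel_measurable (T m \<Otimes>\<^sub>M \<sigma>)"
    by (rule measurable_compose[OF measurable_cons_tuple assms])
  then have "(\<integral>\<^sup>+x. \<integral>\<^sup>+t. F (tup (Suc m) (cons_tuple m (x, t))) \<partial>\<sigma> \<partial>T m) =
      (\<integral>\<^sup>+p. F (tup (Suc m) (cons_tuple m p)) \<partial>(T m \<Otimes>\<^sub>M \<sigma>))"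
    by (rule nn_integral_fst)
  also have "\<dots> = (\<integral>\<^sup>+y. F (tup (Suc m) y) \<partial>distr (T m \<Otimes>\<^sub>M \<sigma>) (T (Suc m)) (cons_tuple m))"
    by (rule nn_integral_distr[symmetric]) measurable
  finally show ?thesis by (simp add: distr_cons_tuple)
qed

text \<open>Together with \<open>AE_T_tl\<close> this transports statements that hold almost everywhere between
  neighbouring degrees of Fock space.\<close>
lemma AE_T_Suc:
  assumes "AE y in T (Suc m). P (tup (Suc m) y)"
  shows "AE x in T m. AE t in \<sigma>. P (t # tup m x)"
proof -
  have "AE p in T m \<Otimes>\<^sub>M \<sigma>. P (tup (Suc m) (cons_tuple m p))"
    by (rule AE_distrD[OF measurable_cons_tuple], unfold distr_cons_tuple) (rule assms)
  from T_\<sigma>.AE_pair[OF this] show ?thesis by simp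
qed

lemma AE_T_tl:
  assumes "AE x in T m. P (tup m x)"
  shows "AE y in T (Suc m). P (tl (tup (Suc m) y))"
proof -
  obtain N where N: "{x\<in>space (T m). \<not> P (tup m x)} \<subseteq> N" "emeasure (T m) N = 0" "N \<in> sets (T m)"
    using AE_E[OF assms] by blast
  define r :: "(nat \<Rightarrow> 'a) \<Rightarrow> nat \<Rightarrow> 'a" where "r = (\<lambda>y. \<lambda>i\<in>{..<m}. y (Suc i))"
  have r [measurable]: "r \<in> T (Suc m) \<rightarrow>\<^sub>M T m"
    unfolding r_def by (rule measurable_restrict) auto
  have tl: "tl (tup (Suc m) y) = tup m (r y)" for y
    by (rule nth_equalityI) (auto simp: r_def nth_tl)
  have NS [measurable]: "N \<in> sets (T m)" by (rule N(3))
  have "AE x in T m. x \<notin> N" using N by (intro AE_not_in) (simp add: null_sets_def)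
  then have "AE x in T m. AE t in \<sigma>. (x, t) \<in> {p. fst p \<notin> N}" by auto
  moreover have "{p \<in> space (T m \<Otimes>\<^sub>M \<sigma>). p \<in> {p. fst p \<notin> N}} \<in> sets (T m \<Otimes>\<^sub>M \<sigma>)"
    by simp
  ultimately have "AE p in T m \<Otimes>\<^sub>M \<sigma>. p \<in> {p. fst p \<notin> N}"
    by (intro T_\<sigma>.AE_pair_measure)
  moreover have "r (cons_tuple m p) = fst p" if "p \<in> space (T m \<Otimes>\<^sub>M \<sigma>)" for p
    using that by (auto simp: r_def cons_tuple_def space_pair_measure space_PiM PiE_def
        extensional_def fun_eq_iff split_beta')
  ultimately have "AE p in T m \<Otimes>\<^sub>M \<sigma>. r (cons_tuple m p) \<notin> N"
    using AE_space[of "T m \<Otimes>\<^sub>M \<sigma>"] by (auto elim!: AE_mp)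
  then have "AE y in distr (T m \<Otimes>\<^sub>M \<sigma>) (T (Suc m)) (cons_tuple m). r y \<notin> N"
    by (subst AE_distr_iff) simp_all
  then have "AE y in T (Suc m). r y \<notin> N" unfolding distr_cons_tuple .
  moreover have "r y \<in> space (T m)" if "y \<in> space (T (Suc m))" for y
    using measurable_space[OF r that] .
  ultimately show ?thesis
    using AE_space[of "T (Suc m)"] N(1) unfolding tl by (auto elim!: AE_mp)
qed

lemma PiM_insert_pair:
  assumes I: "finite I" "i \<notin> I"
  shows "distr (Pi\<^sub>M I (\<lambda>_. \<sigma>) \<Otimes>\<^sub>M \<sigma>) (Pi\<^sub>M (insert i I) (\<lambda>_. \<sigma>)) (\<lambda>(x, t). x(i := t)) =
    Pi\<^sub>M (insert i I) (\<lambda>_. \<sigma>)" (is "distr ?P ?R ?u = _")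
proof (rule products.PiM_eqI)
  have u [measurable]: "?u \<in> ?P \<rightarrow>\<^sub>M ?R"
    unfolding split_beta' by (rule measurable_fun_upd[where J = I]) auto
  fix A assume A: "\<And>j. j \<in> insert i I \<Longrightarrow> A j \<in> sets \<sigma>"
  have "?u -` Pi\<^sub>E (insert i I) A \<inter> space ?P = Pi\<^sub>E I A \<times> A i"
    using I by (auto simp: space_pair_measure space_PiM PiE_iff extensional_def split: if_splits)
  then have "emeasure (distr ?P ?R ?u) (Pi\<^sub>E (insert i I) A) = emeasure ?P (Pi\<^sub>E I A \<times> A i)"
    using A I by (subst emeasure_distr) (auto intro!: sets_PiM_I_finite)
  also have "\<dots> = emeasure (Pi\<^sub>M I (\<lambda>_. \<sigma>)) (Pi\<^sub>E I A) * emeasure \<sigma> (A i)"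
    using A I by (intro emeasure_pair_measure_Times sets_PiM_I_finite) auto
  also have "\<dots> = (\<Prod>j\<in>insert i I. emeasure \<sigma> (A j))"
    using A I by (subst products.emeasure_PiM) (auto simp: mult.commute)
  finally show "emeasure (distr ?P ?R ?u) (Pi\<^sub>E (insert i I) A) = (\<Prod>j\<in>insert i I. emeasure \<sigma> (A j))" .
qed (use I in auto)

section \<open>Kernels with measurable list arguments\<close>

text \<open>A measurable map into the k-fold power of the space, but given as a list of fixed length. This avoids
  changing between tuples and lists whenever variables are repeated, moved or appended.\<close>
definition measurable_list :: "'b measure \<Rightarrow> nat \<Rightarrow> ('b \<Rightarrow> 'a list) \<Rightarrow> bool" where
  "measurable_list M k L \<longleftrightarrow> (\<forall>\<omega>. length (L \<omega>) = k) \<and> (\<forall>i<k. (\<lambda>\<omega>. L \<omega> ! i) \<in> M \<rightarrow>\<^sub>M \<sigma>)"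

lemma measurable_list_const: "length ts = k \<Longrightarrow> measurable_list M k (\<lambda>_. ts)"
  by (simp add: measurable_list_def)

lemma measurable_list_Cons:
  assumes "g \<in> M \<rightarrow>\<^sub>M \<sigma>" "measurable_list M k L"
  shows "measurable_list M (Suc k) (\<lambda>\<omega>. g \<omega> # L \<omega>)"
  unfolding measurable_list_def
proof (intro conjI allI impI)
  fix i assume "i < Suc k"
  then show "(\<lambda>\<omega>. (g \<omega> # L \<omega>) ! i) \<in> M \<rightarrow>\<^sub>M \<sigma>"
    using assms unfolding measurable_list_def by (cases i) auto
qed (use assms in \<open>auto simp: measurable_list_def\<close>)

lemma measurable_list_snoc:
  assumes "g \<in> M \<rightarrow>\<^sub>M \<sigma>" "measurable_list M k L"
  shows "measurable_list M (Suc k) (\<lambda>\<omega>. L \<omega> @ [g \<omega>])"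
  unfolding measurable_list_def
proof (intro conjI allI impI)
  fix i assume "i < Suc k"
  then show "(\<lambda>\<omega>. (L \<omega> @ [g \<omega>]) ! i) \<in> M \<rightarrow>\<^sub>M \<sigma>"
    using assms unfolding measurable_list_def by (cases "i = k") (auto simp: nth_append)
qed (use assms in \<open>auto simp: measurable_list_def\<close>)

lemma measurable_list_tl:
  assumes "measurable_list M (Suc k) L"
  shows "measurable_list M k (\<lambda>\<omega>. tl (L \<omega>))"
  using assms unfolding measurable_list_def by (auto simp: nth_tl)

lemma measurable_list_hd:
  assumes "measurable_list M (Suc k) L"
  shows "(\<lambda>\<omega>. hd (L \<omega>)) \<in> M \<rightarrow>\<^sub>M \<sigma>"
proof -
  have "hd (L \<omega>) = L \<omega> ! 0" for \<omega>
    using assms by (metis hd_conv_nth length_greater_0_conv measurable_list_def zero_less_Suc)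
  then show ?thesis using assms unfolding measurable_list_def by simp
qed

lemma measurable_list_tup:
  assumes "g \<in> M \<rightarrow>\<^sub>M T k"
  shows "measurable_list M k (\<lambda>\<omega>. tup k (g \<omega>))"
  unfolding measurable_list_def using assms by (auto intro: measurable_component_singleton[THEN measurable_compose[OF assms]])

lemma measurable_list_map:
  assumes "\<And>i. i \<in> set is \<Longrightarrow> (\<lambda>\<omega>. g \<omega> i) \<in> M \<rightarrow>\<^sub>M \<sigma>"
  shows "measurable_list M (length is) (\<lambda>\<omega>. map (g \<omega>) is)"
  using assms unfolding measurable_list_def by auto

lemma measurable_list_tuple:
  assumes "measurable_list M k L"
  shows "(\<lambda>\<omega>. \<lambda>i\<in>{..<k}. L \<omega> ! i) \<in> M \<rightarrow>\<^sub>M T k" "tup k (\<lambda>i\<in>{..<k}. L \<omega> ! i) = L \<omega>"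
proof -
  show "(\<lambda>\<omega>. \<lambda>i\<in>{..<k}. L \<omega> ! i) \<in> M \<rightarrow>\<^sub>M T k"
    using assms by (intro measurable_restrict) (auto simp: measurable_list_def)
  show "tup k (\<lambda>i\<in>{..<k}. L \<omega> ! i) = L \<omega>"
    using assms by (intro nth_equalityI) (auto simp: measurable_list_def)
qed

lemma measurable_on_list:
  assumes F: "(\<lambda>y. F (tup m y)) \<in> borel_measurable (T m)" and L: "measurable_list M m L"
  shows "(\<lambda>\<omega>. F (L \<omega>)) \<in> borel_measurable M"
  using measurable_compose[OF measurable_list_tuple(1)[OF L] F] by (simp add: measurable_list_tuple(2)[OF L])

definition measurable_kernel :: "nat \<Rightarrow> ('a list \<Rightarrow> 'a list \<Rightarrow> real) \<Rightarrow> bool" where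
  "measurable_kernel k h \<longleftrightarrow>
     (\<forall>m. (\<lambda>(x, y). h (tup k x) (tup m y)) \<in> borel_measurable (T k \<Otimes>\<^sub>M T m))"

lemma measurable_kernel_lists:
  assumes h: "measurable_kernel k h"
    and L: "measurable_list M k L" "measurable_list M m L'"
  shows "(\<lambda>\<omega>. h (L \<omega>) (L' \<omega>)) \<in> borel_measurable M"
proof -
  have "(\<lambda>\<omega>. (\<lambda>(x, y). h (tup k x) (tup m y))
      (\<lambda>i\<in>{..<k}. L \<omega> ! i, \<lambda>i\<in>{..<m}. L' \<omega> ! i)) \<in> borel_measurable M"
    using h unfolding measurable_kernel_def
    by (intro measurable_compose[OF measurable_Pair[OF measurable_list_tuple(1)[OF L(1)]
        measurable_list_tuple(1)[OF L(2)]]]) blast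
  then show ?thesis by (simp add: measurable_list_tuple(2)[OF L(1)] measurable_list_tuple(2)[OF L(2)])
qed

lemma letter_op_Nil: "x \<noteq> Ann \<Longrightarrow> letter_op \<sigma> lam x h ts [] = 0"
  by (cases x) auto

lemma measurable_kernel_letter_op:
  assumes h: "measurable_kernel (Suc k) h" and lam [measurable]: "lam \<in> borel_measurable \<sigma>"
  shows "measurable_kernel k (letter_op \<sigma> lam x h)"
  unfolding measurable_kernel_def split_beta'
proof
  fix m
  let ?M = "T k \<Otimes>\<^sub>M T m"
  have ts: "measurable_list ?M k (\<lambda>p. tup k (fst p))" and ys: "measurable_list ?M m (\<lambda>p. tup m (snd p))"
    by (intro measurable_list_tup; simp)+
  show "(\<lambda>p. letter_op \<sigma> lam x h (tup k (fst p)) (tup m (snd p))) \<in> borel_measurable ?M"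
  proof (cases "x = Ann")
    case True
    let ?M' = "?M \<Otimes>\<^sub>M \<sigma>"
    have "measurable_list ?M' (Suc k) (\<lambda>q. tup k (fst (fst q)) @ [snd q])"
      "measurable_list ?M' (Suc m) (\<lambda>q. snd q # tup m (snd (fst q)))"
      by (intro measurable_list_snoc measurable_list_Cons measurable_list_tup; measurable)+
    from measurable_kernel_lists[OF h this]
    have "(\<lambda>(p, t). h (tup k (fst p) @ [t]) (t # tup m (snd p))) \<in> borel_measurable ?M'"
      by (simp add: split_beta')
    then show ?thesis using True by (simp add: borel_measurable_lebesgue_integral)
  next
    case False
    show ?thesis
    proof (cases m)
      case 0
      then have "tup m y = []" for y :: "nat \<Rightarrow> 'a" by (simp add: tup_def)
      then show ?thesis using False by (simp add: letter_op_Nil)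
    next
      case (Suc m')
      have split: "tup m y = hd (tup m y) # tl (tup m y)" for y :: "nat \<Rightarrow> 'a"
        using Suc by (metis length_tup list.collapse list.size(3) nat.distinct(1))
      note hd = measurable_list_hd[OF ys[unfolded Suc]] and tl = measurable_list_tl[OF ys[unfolded Suc]]
      note hd' = measurable_compose[OF hd lam]
      have "(\<lambda>p. h (tup k (fst p) @ [hd (tup m (snd p))]) (tup m (snd p))) \<in> borel_measurable ?M"
        "(\<lambda>p. h (tup k (fst p) @ [hd (tup m (snd p))]) (tl (tup m (snd p)))) \<in> borel_measurable ?M"
        by (intro measurable_kernel_lists[OF h] measurable_list_snoc ts ys tl hd;
            use ys tl hd Suc in simp)+
      moreover have "letter_op \<sigma> lam x h ts (tup m y) = (if x = Cre then h (ts @ [hd (tup m y)]) (tl (tup m y))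
          else lam (hd (tup m y)) * h (ts @ [hd (tup m y)]) (tup m y))" for ts y
        using False by (subst split, subst (7) split) (cases x; simp)
      ultimately show ?thesis using hd' Suc by (cases "x = Cre") simp_all
    qed
  qed
qed

end
locale wick_setting = exhausted_measure \<sigma>
  for \<sigma> :: "'a::{second_countable_topology, t2_space} measure" +
  fixes lam :: "'a \<Rightarrow> real"
  assumes continuous_lam: "continuous_on UNIV lam"
begin

lemma measurable_lam [measurable]: "lam \<in> borel_measurable \<sigma>"
  using borel_measurable_continuous_onI[OF continuous_lam] measurable_cong_sets[OF sets_eq_borel refl] by blast

lemma lam_bounded_on_compact:
  assumes "compact K"
  obtains L where "L \<ge> 0" "\<And>t. t \<in> K \<Longrightarrow> \<bar>lam t\<bar> \<le> L"
proof -
  have "compact (lam ` K)"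
    by (rule compact_continuous_image[OF continuous_on_subset[OF continuous_lam] assms]) simp
  then obtain L where "\<And>t. t \<in> K \<Longrightarrow> \<bar>lam t\<bar> \<le> L"
    using compact_imp_bounded bounded_iff by (metis imageI real_norm_def)
  then show thesis using that[of "max L 0"] by fastforce
qed

section \<open>Locally integrable bounds\<close>

text \<open>The size of a kernel in the variables of the Fock vector is controlled by such functions. Values
  in the extended half-line make the class stable under all three letters: integrating a bound over a
  compact set gives a bound that may be infinite, but only on a null set.\<close>
definition locally_integrable :: "('a list \<Rightarrow> ennreal) \<Rightarrow> bool" where
  "locally_integrable H \<longleftrightarrow> (\<forall>m. (\<lambda>y. H (tup m y)) \<in> borel_measurable (T m) \<and>
     (\<forall>Q. compact Q \<longrightarrow> (\<integral>\<^sup>+y. (if set (tup m y) \<subseteq> Q then H (tup m y) else 0) \<partial>T m) < \<infinity>))"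

lemma pred_set_tup:
  assumes "Q \<in> sets \<sigma>"
  shows "Measurable.pred (T m) (\<lambda>y. set (tup m y) \<subseteq> Q)"
proof -
  have "(\<lambda>y. set (tup m y) \<subseteq> Q) = (\<lambda>y. \<forall>i\<in>{..<m}. y i \<in> Q)"
    by (auto simp: set_tup)
  moreover have "Measurable.pred (T m) (\<lambda>y. \<forall>i\<in>{..<m}. y i \<in> Q)"
    by (intro pred_intros_finite(3)) (use assms in auto)
  ultimately show ?thesis by simp
qed

lemma locally_integrable_measurable:
  assumes "locally_integrable H"
  shows "(\<lambda>y. H (tup m y)) \<in> borel_measurable (T m)"
    and "Q \<in> sets \<sigma> \<Longrightarrow> (\<lambda>y. if set (tup m y) \<subseteq> Q then H (tup m y) else 0) \<in> borel_measurable (T m)"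
proof -
  show H: "(\<lambda>y. H (tup m y)) \<in> borel_measurable (T m)"
    using assms by (simp add: locally_integrable_def)
  show "(\<lambda>y. if set (tup m y) \<subseteq> Q then H (tup m y) else 0) \<in> borel_measurable (T m)" if "Q \<in> sets \<sigma>"
    using pred_set_tup[OF that] H by (intro measurable_If) auto
qed

lemma locally_integrable_AE_finite:
  assumes H: "locally_integrable H"
  shows "AE y in T m. H (tup m y) < \<infinity>"
proof -
  obtain Q :: "nat \<Rightarrow> 'a set" where Q: "\<And>i. compact (Q i)" "incseq Q" "(\<Union>i. Q i) = UNIV"
    using exhaustion by blast
  have "AE y in T m. \<forall>i. (if set (tup m y) \<subseteq> Q i then H (tup m y) else 0) \<noteq> \<infinity>"
    unfolding AE_all_countable
  proof
    fix i
    show "AE y in T m. (if set (tup m y) \<subseteq> Q i then H (tup m y) else 0) \<noteq> \<infinity>"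
      using H Q(1)[of i] unfolding locally_integrable_def
      by (intro nn_integral_PInf_AE locally_integrable_measurable[OF H] compact_sets) (auto simp: less_top)
  qed
  moreover have "\<exists>i. set ys \<subseteq> Q i" for ys :: "'a list"
  proof (induction ys)
    case (Cons y ys)
    then obtain i where "set ys \<subseteq> Q i" by blast
    moreover obtain j where "y \<in> Q j" using Q(3) by blast
    moreover have "Q i \<subseteq> Q (max i j)" "Q j \<subseteq> Q (max i j)"
      using Q(2) by (auto simp: incseq_def)
    ultimately show ?case by (intro exI[of _ "max i j"]) auto
  qed auto
  ultimately show ?thesis
    by (auto elim!: eventually_mono simp: less_top) metis
qed

lemma locally_integrable_mult:
  assumes "locally_integrable H" "c < \<infinity>"
  shows "locally_integrable (\<lambda>ys. c * H ys)"
  unfolding locally_integrable_def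
proof (intro allI conjI impI)
  fix m
  note H = locally_integrable_measurable[OF assms(1), of m]
  show "(\<lambda>y. c * H (tup m y)) \<in> borel_measurable (T m)" using H by simp
  fix Q :: "'a set" assume Q: "compact Q"
  have "(\<integral>\<^sup>+y. (if set (tup m y) \<subseteq> Q then c * H (tup m y) else 0) \<partial>T m) =
      (\<integral>\<^sup>+y. c * (if set (tup m y) \<subseteq> Q then H (tup m y) else 0) \<partial>T m)"
    by (intro nn_integral_cong) auto
  also have "\<dots> = c * (\<integral>\<^sup>+y. (if set (tup m y) \<subseteq> Q then H (tup m y) else 0) \<partial>T m)"
    by (rule nn_integral_cmult[OF locally_integrable_measurable(2)[OF assms(1) compact_sets[OF Q]]])
  also have "\<dots> < \<infinity>"
    using assms Q unfolding locally_integrable_def by (simp add: ennreal_mult_less_top)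
  finally show "(\<integral>\<^sup>+y. (if set (tup m y) \<subseteq> Q then c * H (tup m y) else 0) \<partial>T m) < \<infinity>" .
qed

lemma locally_integrable_pos_degree:
  assumes "locally_integrable H"
  shows "locally_integrable (\<lambda>ys. if ys = [] then 0 else H ys)"
  unfolding locally_integrable_def
proof (intro allI conjI impI)
  fix m
  note H = locally_integrable_measurable[OF assms(1), of m]
  have e: "tup m y = [] \<longleftrightarrow> m = 0" for y :: "nat \<Rightarrow> 'a" by (simp add: tup_def)
  show "(\<lambda>y. if tup m y = [] then 0 else H (tup m y)) \<in> borel_measurable (T m)"
    unfolding e using H by simp
  fix Q :: "'a set" assume Q: "compact Q"
  have "(\<integral>\<^sup>+y. (if set (tup m y) \<subseteq> Q then if tup m y = [] then 0 else H (tup m y) else 0) \<partial>T m) \<le>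
      (\<integral>\<^sup>+y. (if set (tup m y) \<subseteq> Q then H (tup m y) else 0) \<partial>T m)"
    by (intro nn_integral_mono) auto
  also have "\<dots> < \<infinity>" using assms Q unfolding locally_integrable_def by simp
  finally show "(\<integral>\<^sup>+y. (if set (tup m y) \<subseteq> Q then if tup m y = [] then 0 else H (tup m y) else 0) \<partial>T m) < \<infinity>" .
qed

text \<open>A new variable that the bound does not depend on: it costs a factor, the measure of a compact set.\<close>
lemma locally_integrable_tl:
  assumes "locally_integrable H"
  shows "locally_integrable (\<lambda>ys. if ys = [] then 0 else H (tl ys))"
  unfolding locally_integrable_def
proof (intro allI)
  fix m
  show "(\<lambda>y. if tup m y = [] then 0 else H (tl (tup m y))) \<in> borel_measurable (T m) \<and>
    (\<forall>Q. compact Q \<longrightarrow> (\<integral>\<^sup>+y. (if set (tup m y) \<subseteq> Q then if tup m y = [] then 0 else H (tl (tup m y)) else 0) \<partial>T m) < \<infinity>)"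
  proof (cases m)
    case 0
    then have "tup m y = []" for y :: "nat \<Rightarrow> 'a" by (simp add: tup_def)
    then show ?thesis by simp
  next
    case (Suc m')
    have ne: "tup m y \<noteq> []" for y :: "nat \<Rightarrow> 'a" using Suc by (simp add: tup_def)
    have tl: "measurable_list (T m) m' (\<lambda>y. tl (tup m y))"
      unfolding Suc by (intro measurable_list_tl measurable_list_tup) simp
    have meas: "(\<lambda>y. H (tl (tup m y))) \<in> borel_measurable (T m)"
      by (rule measurable_on_list[OF locally_integrable_measurable(1)[OF assms] tl])
    moreover have "(\<integral>\<^sup>+y. (if set (tup m y) \<subseteq> Q then H (tl (tup m y)) else 0) \<partial>T m) < \<infinity>"
      if Q: "compact Q" for Q
    proof -
      have [measurable]: "Q \<in> sets \<sigma>" using Q by simp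
      have "(\<integral>\<^sup>+y. (if set (tup m y) \<subseteq> Q then H (tl (tup m y)) else 0) \<partial>T m) =
          (\<integral>\<^sup>+x. \<integral>\<^sup>+t. (if set (t # tup m' x) \<subseteq> Q then H (tl (t # tup m' x)) else 0) \<partial>\<sigma> \<partial>T m')"
        unfolding Suc
        by (rule nn_integral_T_Suc[where F = "\<lambda>ys. if set ys \<subseteq> Q then H (tl ys) else 0"])
          (use meas Suc pred_set_tup[of Q m] in \<open>auto intro!: measurable_If\<close>)
      also have "\<dots> = (\<integral>\<^sup>+x. emeasure \<sigma> Q * (if set (tup m' x) \<subseteq> Q then H (tup m' x) else 0) \<partial>T m')"
      proof (rule nn_integral_cong)
        fix x
        have "(\<integral>\<^sup>+t. (if set (t # tup m' x) \<subseteq> Q then H (tl (t # tup m' x)) else 0) \<partial>\<sigma>) =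
            (\<integral>\<^sup>+t. (if set (tup m' x) \<subseteq> Q then H (tup m' x) else 0) * indicator Q t \<partial>\<sigma>)"
          by (intro nn_integral_cong) (auto simp: indicator_def)
        also have "\<dots> = (if set (tup m' x) \<subseteq> Q then H (tup m' x) else 0) * emeasure \<sigma> Q"
          by (rule nn_integral_cmult_indicator) simp
        finally show "(\<integral>\<^sup>+t. (if set (t # tup m' x) \<subseteq> Q then H (tl (t # tup m' x)) else 0) \<partial>\<sigma>) =
            emeasure \<sigma> Q * (if set (tup m' x) \<subseteq> Q then H (tup m' x) else 0)"
          by (simp only: mult.commute)
      qed
      also have "\<dots> = emeasure \<sigma> Q * (\<integral>\<^sup>+x. (if set (tup m' x) \<subseteq> Q then H (tup m' x) else 0) \<partial>T m')"
        by (intro nn_integral_cmult locally_integrable_measurable(2)[OF assms]) simp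
      also have "\<dots> < \<infinity>"
        using finite_compact[OF Q] assms Q unfolding locally_integrable_def
        by (simp add: ennreal_mult_less_top)
      finally show ?thesis .
    qed
    ultimately show ?thesis using ne by (simp cong: if_cong)
  qed
qed

lemma locally_integrable_integral:
  assumes H: "locally_integrable H" and K: "compact K"
  shows "locally_integrable (\<lambda>ys. \<integral>\<^sup>+t. indicator K t * H (t # ys) \<partial>\<sigma>)"
  unfolding locally_integrable_def
proof (intro allI conjI impI)
  fix m
  have [measurable]: "K \<in> sets \<sigma>" using K by simp
  have "measurable_list (T m \<Otimes>\<^sub>M \<sigma>) (Suc m) (\<lambda>p. snd p # tup m (fst p))"
    by (intro measurable_list_Cons measurable_list_tup) auto
  from measurable_on_list[OF locally_integrable_measurable(1)[OF H] this]
  have [measurable]: "(\<lambda>p. H (snd p # tup m (fst p))) \<in> borel_measurable (T m \<Otimes>\<^sub>M \<sigma>)" .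
  then show "(\<lambda>y. \<integral>\<^sup>+t. indicator K t * H (t # tup m y) \<partial>\<sigma>) \<in> borel_measurable (T m)"
    by (intro borel_measurable_nn_integral) (simp add: split_beta')
  fix Q :: "'a set" assume Q: "compact Q"
  \<comment> \<open>One compact set has to serve both for the integrated and for the remaining variables.\<close>
  let ?R = "Q \<union> K"
  have R: "compact ?R" using Q K by (rule compact_Un)
  have "(\<integral>\<^sup>+y. (if set (tup m y) \<subseteq> Q then \<integral>\<^sup>+t. indicator K t * H (t # tup m y) \<partial>\<sigma> else 0) \<partial>T m) \<le>
      (\<integral>\<^sup>+y. \<integral>\<^sup>+t. (if set (t # tup m y) \<subseteq> ?R then H (t # tup m y) else 0) \<partial>\<sigma> \<partial>T m)"
    by (intro nn_integral_mono) (auto intro!: nn_integral_mono simp: indicator_def)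
  also have "\<dots> = (\<integral>\<^sup>+y. (if set (tup (Suc m) y) \<subseteq> ?R then H (tup (Suc m) y) else 0) \<partial>T (Suc m))"
    by (rule nn_integral_T_Suc[symmetric])
      (intro locally_integrable_measurable(2)[OF H] compact_sets R)
  also have "\<dots> < \<infinity>" using H R unfolding locally_integrable_def by blast
  finally show "(\<integral>\<^sup>+y. (if set (tup m y) \<subseteq> Q then \<integral>\<^sup>+t. indicator K t * H (t # tup m y) \<partial>\<sigma> else 0) \<partial>T m) < \<infinity>" .
qed

text \<open>Boundedness and compact support in the variables ts of the test function, for every single ys: the
  exceptional sets of the almost everywhere statements below must not depend on ts.\<close>
definition dominated :: "nat \<Rightarrow> ('a list \<Rightarrow> 'a list \<Rightarrow> real) \<Rightarrow> 'a set \<Rightarrow> ('a list \<Rightarrow> ennreal) \<Rightarrow> bool" where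
  "dominated k h K H \<longleftrightarrow> (\<forall>ts ys. length ts = k \<longrightarrow>
     ennreal \<bar>h ts ys\<bar> \<le> (if set ts \<subseteq> K then H ys else 0))"

text \<open>The class of kernels in which the induction over words takes place: it contains the product of a
  test function and a Fock vector and is closed under the letters.\<close>
definition regular_kernel :: "nat \<Rightarrow> ('a list \<Rightarrow> 'a list \<Rightarrow> real) \<Rightarrow> bool" where
  "regular_kernel k h \<longleftrightarrow> measurable_kernel k h \<and>
     (\<exists>K H. compact K \<and> locally_integrable H \<and> dominated k h K H)"

lemma regular_kernel_letter_op:
  assumes h: "regular_kernel (Suc k) h"
  shows "regular_kernel k (letter_op \<sigma> lam x h)"
proof -
  obtain K H where K: "compact K" and H: "locally_integrable H" and dom: "dominated (Suc k) h K H"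
    using h unfolding regular_kernel_def by blast
  obtain L where L: "L \<ge> 0" "\<And>t. t \<in> K \<Longrightarrow> \<bar>lam t\<bar> \<le> L" using lam_bounded_on_compact[OF K] by blast
  have hb: "ennreal \<bar>h (ts @ [t]) ys\<bar> \<le> (if set ts \<subseteq> K then indicator K t * H ys else 0)"
    if "length ts = k" for ts t ys
  proof -
    have "ennreal \<bar>h (ts @ [t]) ys\<bar> \<le> (if set (ts @ [t]) \<subseteq> K then H ys else 0)"
      using dom that unfolding dominated_def by (metis length_append_singleton)
    then show ?thesis by (auto simp: indicator_def split: if_splits)
  qed
  have "\<exists>H'. locally_integrable H' \<and> dominated k (letter_op \<sigma> lam x h) K H'"
  proof (cases x)
    case Cre
    let ?H = "\<lambda>ys. if ys = [] then 0 else H (tl ys)"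
    have "ennreal \<bar>letter_op \<sigma> lam Cre h ts ys\<bar> \<le> (if set ts \<subseteq> K then ?H ys else 0)"
      if "length ts = k" for ts ys
    proof (cases ys)
      case (Cons y ys')
      have "indicator K y * H ys' \<le> H ys'" by (auto simp: indicator_def)
      then show ?thesis using hb[OF that, of y ys'] Cons by (auto split: if_splits)
    qed simp
    then have "dominated k (letter_op \<sigma> lam x h) K ?H" by (simp add: dominated_def Cre)
    then show ?thesis using locally_integrable_tl[OF H] by blast
  next
    case Neu
    let ?H = "\<lambda>ys. if ys = [] then 0 else ennreal L * H ys"
    have "ennreal \<bar>letter_op \<sigma> lam Neu h ts ys\<bar> \<le> (if set ts \<subseteq> K then ?H ys else 0)"
      if "length ts = k" for ts ys
    proof (cases ys)
      case (Cons y ys')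
      have "ennreal \<bar>letter_op \<sigma> lam Neu h ts ys\<bar> = ennreal \<bar>lam y\<bar> * ennreal \<bar>h (ts @ [y]) ys\<bar>"
        using Cons by (simp add: abs_mult ennreal_mult)
      also have "\<dots> \<le> ennreal \<bar>lam y\<bar> * (if set ts \<subseteq> K then indicator K y * H ys else 0)"
        by (intro mult_left_mono hb that) simp
      also have "\<dots> \<le> (if set ts \<subseteq> K then ?H ys else 0)"
        using Cons L(2)[of y] by (auto simp: indicator_def intro!: mult_right_mono ennreal_leI)
      finally show ?thesis .
    qed simp
    then have "dominated k (letter_op \<sigma> lam x h) K ?H" by (simp add: dominated_def Neu)
    moreover have "locally_integrable ?H"
      by (intro locally_integrable_pos_degree locally_integrable_mult H) simp
    ultimately show ?thesis by blast
  next
    case Ann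
    let ?H = "\<lambda>ys. \<integral>\<^sup>+t. indicator K t * H (t # ys) \<partial>\<sigma>"
    have "ennreal \<bar>letter_op \<sigma> lam Ann h ts ys\<bar> \<le> (if set ts \<subseteq> K then ?H ys else 0)"
      if "length ts = k" for ts ys
    proof -
      have "ennreal \<bar>\<integral>t. h (ts @ [t]) (t # ys) \<partial>\<sigma>\<bar> \<le> (\<integral>\<^sup>+t. ennreal \<bar>h (ts @ [t]) (t # ys)\<bar> \<partial>\<sigma>)"
        using integral_norm_bound_ennreal[of \<sigma> "\<lambda>t. h (ts @ [t]) (t # ys)"] not_integrable_integral_eq
        by (cases "integrable \<sigma> (\<lambda>t. h (ts @ [t]) (t # ys))") (auto simp: not_integrable_integral_eq)
      also have "\<dots> \<le> (\<integral>\<^sup>+t. (if set ts \<subseteq> K then indicator K t * H (t # ys) else 0) \<partial>\<sigma>)"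
        by (intro nn_integral_mono hb that)
      also have "\<dots> = (if set ts \<subseteq> K then ?H ys else 0)" by simp
      finally show ?thesis by simp
    qed
    then have "dominated k (letter_op \<sigma> lam x h) K ?H" by (simp add: dominated_def Ann)
    then show ?thesis using locally_integrable_integral[OF H K] by blast
  qed
  then show ?thesis
    using h K measurable_kernel_letter_op measurable_lam unfolding regular_kernel_def by blast
qed

text \<open>Equality for all ts, but only for almost all ys. The variables ts get values from ys when letters
  act, so an exceptional set in ts would not be negligible on the diagonals.\<close>
definition kernel_eq :: "nat \<Rightarrow> ('a list \<Rightarrow> 'a list \<Rightarrow> real) \<Rightarrow> ('a list \<Rightarrow> 'a list \<Rightarrow> real) \<Rightarrow> bool" where
  "kernel_eq k h1 h2 \<longleftrightarrow> (\<forall>m. AE y in T m. \<forall>ts. length ts = k \<longrightarrow> h1 ts (tup m y) = h2 ts (tup m y))"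

lemma kernel_eqI:
  "(\<And>ts ys. length ts = k \<Longrightarrow> h1 ts ys = h2 ts ys) \<Longrightarrow> kernel_eq k h1 h2"
  unfolding kernel_eq_def by simp

lemma kernel_eq_trans [trans]:
  assumes "kernel_eq k h1 h2" "kernel_eq k h2 h3"
  shows "kernel_eq k h1 h3"
  unfolding kernel_eq_def
proof
  fix m
  show "AE y in T m. \<forall>ts. length ts = k \<longrightarrow> h1 ts (tup m y) = h3 ts (tup m y)"
    using assms[unfolded kernel_eq_def, THEN spec, of m] by eventually_elim simp
qed

lemma kernel_eq_letter_op:
  assumes eq: "kernel_eq (Suc k) h1 h2"
    and h1: "measurable_kernel (Suc k) h1" and h2: "measurable_kernel (Suc k) h2"
  shows "kernel_eq k (letter_op \<sigma> lam x h1) (letter_op \<sigma> lam x h2)"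
  unfolding kernel_eq_def
proof
  fix m
  show "AE y in T m. \<forall>ts. length ts = k \<longrightarrow>
      letter_op \<sigma> lam x h1 ts (tup m y) = letter_op \<sigma> lam x h2 ts (tup m y)"
  proof (cases "x = Ann")
    case True
    have "AE y in T m. AE t in \<sigma>. \<forall>ts. length ts = Suc k \<longrightarrow> h1 ts (t # tup m y) = h2 ts (t # tup m y)"
      using eq unfolding kernel_eq_def
      by (intro AE_T_Suc[where P = "\<lambda>ys. \<forall>ts. length ts = Suc k \<longrightarrow> h1 ts ys = h2 ts ys"]) blast
    then show ?thesis
    proof eventually_elim
      case (elim y)
      have meas: "(\<lambda>t. h (ts @ [t]) (t # tup m y)) \<in> borel_measurable \<sigma>"
        if "length ts = k" "measurable_kernel (Suc k) h" for h ts
        by (rule measurable_kernel_lists[OF that(2), of _ _ "Suc m"])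
          (intro measurable_list_snoc measurable_list_Cons measurable_list_const; simp add: that)+
      have "(\<integral>t. h1 (ts @ [t]) (t # tup m y) \<partial>\<sigma>) = (\<integral>t. h2 (ts @ [t]) (t # tup m y) \<partial>\<sigma>)"
        if ts: "length ts = k" for ts
      proof (rule integral_cong_AE[OF meas[OF ts h1] meas[OF ts h2]])
        show "AE t in \<sigma>. h1 (ts @ [t]) (t # tup m y) = h2 (ts @ [t]) (t # tup m y)"
          using elim by eventually_elim (simp add: ts)
      qed
      then show ?case using True by simp
    qed
  next
    case False
    show ?thesis
    proof (cases m)
      case 0
      then have "tup m y = []" for y :: "nat \<Rightarrow> 'a" by (simp add: tup_def)
      then show ?thesis using letter_op_Nil[OF False] by simp
    next
      case (Suc m')
      have "AE y in T m. \<forall>ts. length ts = Suc k \<longrightarrow> h1 ts (tup m y) = h2 ts (tup m y)"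
        using eq unfolding kernel_eq_def by blast
      moreover have "AE y in T m. \<forall>ts. length ts = Suc k \<longrightarrow> h1 ts (tl (tup m y)) = h2 ts (tl (tup m y))"
        using eq unfolding kernel_eq_def Suc
        by (intro AE_T_tl[where P = "\<lambda>ys. \<forall>ts. length ts = Suc k \<longrightarrow> h1 ts ys = h2 ts ys"]) blast
      ultimately show ?thesis
      proof eventually_elim
        case (elim y)
        obtain z ys where "tup m y = z # ys" using Suc by (cases "tup m y") (auto simp: tup_def)
        then show ?case using elim False by (cases x) auto
      qed
    qed
  qed
qed

abbreviation word_kernel :: "letter list \<Rightarrow> ('a list \<Rightarrow> 'a list \<Rightarrow> real) \<Rightarrow> 'a list \<Rightarrow> 'a list \<Rightarrow> real" where
  "word_kernel w \<equiv> foldr (letter_op \<sigma> lam) w"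

lemma measurable_word_kernel:
  "measurable_kernel (k + length w) h \<Longrightarrow> measurable_kernel k (word_kernel w h)"
  by (induction w arbitrary: k) (auto intro!: measurable_kernel_letter_op measurable_lam)

lemma kernel_eq_word_kernel:
  assumes "kernel_eq (k + length w) h1 h2"
    and "measurable_kernel (k + length w) h1" "measurable_kernel (k + length w) h2"
  shows "kernel_eq k (word_kernel w h1) (word_kernel w h2)"
  using assms
proof (induction w arbitrary: k)
  case (Cons x w)
  have "Suc k + length w = k + length (x # w)" by simp
  then show ?case
    using Cons by (simp only: foldr.simps comp_def)
      (intro kernel_eq_letter_op Cons.IH measurable_word_kernel; simp)
qed simp

end

section \<open>The arguments of a contracted kernel\<close>

lemma block_exists:
  assumes "(Qs, Ms) \<in> states n" "i \<in> {1..n}"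
  obtains (plus) j where "j < length Qs" "i \<in> rev (map fst Qs) ! j" | (minus) D where "D \<in> Ms" "i \<in> D"
proof -
  have "i \<in> \<Union>(set (map fst Qs) \<union> Ms)"
    using diagram_Union[OF states_diagram[OF assms(1)]] assms(2) by simp
  then consider B where "B \<in> set (rev (map fst Qs))" "i \<in> B" | D where "D \<in> Ms" "i \<in> D" by auto
  then show thesis
  proof cases
    case 1
    then obtain j where "j < length Qs" "B = rev (map fst Qs) ! j"
      by (metis in_set_conv_nth length_map length_rev)
    then show thesis using plus 1 by blast
  qed (use minus in blast)
qed

lemma block_var_plus:
  assumes s: "(Qs, Ms) \<in> states n" and j: "j < length Qs" "i \<in> rev (map fst Qs) ! j"
  shows "block_var (marked (Qs, Ms)) us v i = us ! j"
  unfolding block_var_def plus_blocks_marked[OF s] minus_blocks_marked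
proof (rule the_equality)
  let ?ps = "rev (map fst Qs)"
  have d: "diagram n (map fst Qs) Ms" using states_diagram[OF s] .
  have mem: "?ps ! k \<in> set (map fst Qs)" if "k < length Qs" for k
    using that nth_mem[of k ?ps] by simp
  show "(\<exists>k<length ?ps. i \<in> ?ps ! k \<and> us ! j = us ! k) \<or> (\<exists>D\<in>Ms. i \<in> D \<and> us ! j = v D)"
    using j by auto
  fix t assume "(\<exists>j<length ?ps. i \<in> ?ps ! j \<and> t = us ! j) \<or> (\<exists>D\<in>Ms. i \<in> D \<and> t = v D)"
  then show "t = us ! j"
  proof (elim disjE exE conjE bexE)
    fix k assume k: "k < length ?ps" "i \<in> ?ps ! k" "t = us ! k"
    have eq: "?ps ! k = ?ps ! j"
      using diagram_disjoint[OF d, of "?ps ! k" "?ps ! j" i] mem[of k] mem[of j] j k by auto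
    have "k = j"
    proof (rule ccontr)
      assume "k \<noteq> j"
      then have "Min (?ps ! k) < Min (?ps ! j) \<or> Min (?ps ! j) < Min (?ps ! k)"
        using sorted_wrt_nth_less[OF diagram_Min_sorted[OF d]] j k
        by (metis length_map length_rev nat_neq_iff)
      then show False using eq by simp
    qed
    then show ?thesis using k by simp
  next
    fix D assume D: "D \<in> Ms" "i \<in> D"
    then have "?ps ! j = D" using diagram_disjoint[OF d, of "?ps ! j" D i] mem j by auto
    then show ?thesis using diagram_marks[OF d mem[OF j(1)]] D by simp
  qed
qed

lemma block_var_minus:
  assumes s: "(Qs, Ms) \<in> states n" and D: "D \<in> Ms" "i \<in> D"
  shows "block_var (marked (Qs, Ms)) us v i = v D"
  unfolding block_var_def plus_blocks_marked[OF s] minus_blocks_marked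
proof (rule the_equality)
  let ?ps = "rev (map fst Qs)"
  have d: "diagram n (map fst Qs) Ms" using states_diagram[OF s] .
  show "(\<exists>j<length ?ps. i \<in> ?ps ! j \<and> v D = us ! j) \<or> (\<exists>D'\<in>Ms. i \<in> D' \<and> v D = v D')"
    using D by auto
  fix t assume "(\<exists>j<length ?ps. i \<in> ?ps ! j \<and> t = us ! j) \<or> (\<exists>D\<in>Ms. i \<in> D \<and> t = v D)"
  then show "t = v D"
  proof (elim disjE exE conjE bexE)
    fix k assume k: "k < length ?ps" "i \<in> ?ps ! k"
    then have mem: "?ps ! k \<in> set (map fst Qs)" using nth_mem[of k ?ps] by simp
    then have "?ps ! k = D" using diagram_disjoint[OF d, of "?ps ! k" D i] D k by auto
    then show ?thesis using diagram_marks[OF d mem] D by simp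
  next
    fix D' assume "D' \<in> Ms" "i \<in> D'" "t = v D'"
    then show ?thesis using diagram_disjoint[OF d, of D' D i] D by auto
  qed
qed

text \<open>The values t_1, ..., t_n at which the contraction evaluates the kernel. Adding a letter appends one
  value, and it is the value of the variable that the letter touches; the three lemmas below
  correspond to the three ways of growing a diagram.\<close>
definition arguments :: "state \<Rightarrow> nat \<Rightarrow> 'a list \<Rightarrow> (nat set \<Rightarrow> 'a) \<Rightarrow> 'a list" where
  "arguments s n us v = map (block_var (marked s) us v) [1..<n + 1]"

lemma length_arguments [simp]: "length (arguments s n us v) = n"
  by (simp add: arguments_def)

lemma upt_Suc_snoc: "[1..<Suc n + 1] = [1..<n + 1] @ [Suc n]"
  by simp

lemma arguments_Suc:
  assumes "block_var (marked s') us' v' (Suc n) = y"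
    and "\<And>i. i \<in> {1..n} \<Longrightarrow> block_var (marked s') us' v' i = block_var (marked s) us v i"
  shows "arguments s' (Suc n) us' v' = arguments s n us v @ [y]"
  unfolding arguments_def upt_Suc_snoc map_append using assms by auto

lemma arguments_new:
  assumes s: "(Qs, Ms) \<in> states n" and s': "(({Suc n}, l) # Qs, Ms) \<in> states (Suc n)"
    and us: "length us = length Qs"
  shows "arguments (({Suc n}, l) # Qs, Ms) (Suc n) (us @ [y]) v = arguments (Qs, Ms) n us v @ [y]"
proof (rule arguments_Suc)
  show "block_var (marked (({Suc n}, l) # Qs, Ms)) (us @ [y]) v (Suc n) = y"
    using block_var_plus[OF s', of "length Qs" "Suc n" "us @ [y]" v] us by (simp add: nth_append)
  fix i assume "i \<in> {1..n}"
  with s show "block_var (marked (({Suc n}, l) # Qs, Ms)) (us @ [y]) v i = block_var (marked (Qs, Ms)) us v i"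
  proof (cases rule: block_exists)
    case (plus j)
    then show ?thesis
      using block_var_plus[OF s plus, of us v] block_var_plus[OF s', of j i "us @ [y]" v] us
      by (simp add: nth_append)
  next
    case (minus D)
    then show ?thesis by (simp add: block_var_minus[OF s] block_var_minus[OF s'])
  qed
qed

lemma arguments_extend:
  assumes s: "((B, l) # R, Ms) \<in> states n" and s': "((insert (Suc n) B, l') # R, Ms) \<in> states (Suc n)"
    and us: "length us = length R"
  shows "arguments ((insert (Suc n) B, l') # R, Ms) (Suc n) (us @ [y]) v =
    arguments ((B, l) # R, Ms) n (us @ [y]) v @ [y]"
proof (rule arguments_Suc)
  show "block_var (marked ((insert (Suc n) B, l') # R, Ms)) (us @ [y]) v (Suc n) = y"
    using block_var_plus[OF s', of "length R" "Suc n" "us @ [y]" v] us by (simp add: nth_append)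
  fix i assume "i \<in> {1..n}"
  with s show "block_var (marked ((insert (Suc n) B, l') # R, Ms)) (us @ [y]) v i =
      block_var (marked ((B, l) # R, Ms)) (us @ [y]) v i"
  proof (cases rule: block_exists)
    case (plus j)
    then have "i \<in> rev (map fst ((insert (Suc n) B, l') # R)) ! j"
      by (cases "j = length R") (auto simp: nth_append)
    then show ?thesis
      using block_var_plus[OF s plus, of "us @ [y]" v] block_var_plus[OF s', of j i "us @ [y]" v] plus
      by simp
  next
    case (minus D)
    then show ?thesis by (simp add: block_var_minus[OF s] block_var_minus[OF s'])
  qed
qed

lemma arguments_close:
  assumes s: "((B, l) # R, Ms) \<in> states n" and s': "(R, insert (insert (Suc n) B) Ms) \<in> states (Suc n)"
    and us: "length us = length R"
  shows "arguments (R, insert (insert (Suc n) B) Ms) (Suc n) us (v(insert (Suc n) B := t)) =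
    arguments ((B, l) # R, Ms) n (us @ [t]) v @ [t]"
proof (rule arguments_Suc)
  let ?B = "insert (Suc n) B"
  show "block_var (marked (R, insert ?B Ms)) us (v(?B := t)) (Suc n) = t"
    using block_var_minus[OF s', of ?B "Suc n" us "v(?B := t)"] by simp
  fix i assume "i \<in> {1..n}"
  with s show "block_var (marked (R, insert ?B Ms)) us (v(?B := t)) i =
      block_var (marked ((B, l) # R, Ms)) (us @ [t]) v i"
  proof (cases rule: block_exists)
    case (plus j)
    note old = block_var_plus[OF s plus, of "us @ [t]" v]
    show ?thesis
    proof (cases "j = length R")
      case True
      then have "i \<in> ?B" using plus by (simp add: nth_append)
      then show ?thesis using old block_var_minus[OF s', of ?B i us "v(?B := t)"] True us
          nth_append_length[of us t "[]"] by simp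
    next
      case False
      then have "j < length R" "i \<in> rev (map fst R) ! j" using plus by (auto simp: nth_append)
      then show ?thesis using old block_var_plus[OF s'] us by (simp add: nth_append)
    qed
  next
    case (minus D)
    moreover have "D \<noteq> ?B" using states_fresh(2)[OF s, of D] minus by auto
    ultimately show ?thesis
      using block_var_minus[OF s minus, of "us @ [t]" v] block_var_minus[OF s', of D i us "v(?B := t)"] by simp
  qed
qed

section \<open>Contractions and letters\<close>

context wick_setting
begin

definition plus_weight :: "state \<Rightarrow> 'a list \<Rightarrow> real" where
  "plus_weight s us = (\<Prod>j<length (fst s). lam (us ! j) ^ (card (rev (map fst (fst s)) ! j) - 1))"

definition minus_weight :: "state \<Rightarrow> (nat set \<Rightarrow> 'a) \<Rightarrow> real" where
  "minus_weight s v = (\<Prod>D\<in>snd s. lam (v D) ^ (card D - 2))"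

text \<open>The kernel \<^const>\<open>contracted\<close> for a state and for a kernel that also depends on ys. The
  additional dependence makes room for the letters not yet absorbed.\<close>
definition contraction :: "state \<Rightarrow> nat \<Rightarrow> ('a list \<Rightarrow> 'a list \<Rightarrow> real) \<Rightarrow> 'a list \<Rightarrow> 'a list \<Rightarrow> real" where
  "contraction s n h us ys =
     (\<integral>v. h (arguments s n us v) ys * plus_weight s us * minus_weight s v \<partial>Pi\<^sub>M (snd s) (\<lambda>_. \<sigma>))"

lemma contracted_eq_contraction:
  assumes "s \<in> states n"
  shows "contracted \<sigma> lam n (marked s) (\<lambda>ts. h ts ys) us = contraction s n h us ys"
proof -
  obtain Qs Ms where s: "s = (Qs, Ms)" by (cases s)
  show ?thesis
    using plus_blocks_marked[of Qs Ms n] minus_blocks_marked[of Qs Ms] assms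
    unfolding contracted_def contraction_def arguments_def plus_weight_def minus_weight_def s by simp
qed

lemma block_card_pos:
  assumes "(Qs, Ms) \<in> states n" "(B, l) \<in> set Qs"
  shows "card B > 0" "card (insert (Suc n) B) = Suc (card B)"
proof -
  have "B \<in> set (map fst Qs) \<union> Ms" using assms(2) by force
  then have "finite B" using diagram_finite[OF states_diagram[OF assms(1)]] by blast
  then show "card B > 0" "card (insert (Suc n) B) = Suc (card B)"
    using states_fresh(1,3)[OF assms] by (auto simp: card_gt_0_iff)
qed

lemma plus_weight_snoc:
  assumes "length us = length R"
  shows "plus_weight ((B, l) # R, Ms) (us @ [y]) = plus_weight (R, Ms') us * lam y ^ (card B - 1)"
proof -
  have "(\<Prod>j<length R. lam ((us @ [y]) ! j) ^ (card ((rev (map fst R) @ [B]) ! j) - 1)) =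
      (\<Prod>j<length R. lam (us ! j) ^ (card (rev (map fst R) ! j) - 1))"
    using assms by (intro prod.cong) (auto simp: nth_append)
  then show ?thesis unfolding plus_weight_def using assms by (simp add: nth_append)
qed

text \<open>A singleton block contributes the power 0 of lam.\<close>
lemma plus_weight_new:
  assumes "length us = length R"
  shows "plus_weight (({i}, l) # R, Ms) (us @ [y]) = plus_weight (R, Ms) us"
  using plus_weight_snoc[OF assms, where Ms' = Ms] by simp

lemma plus_weight_extend:
  assumes "((B, l) # R, Ms) \<in> states n" "length us = length R"
  shows "plus_weight ((insert (Suc n) B, l') # R, Ms) (us @ [y]) = lam y * plus_weight ((B, l) # R, Ms) (us @ [y])"
proof -
  have "card (insert (Suc n) B) - 1 = Suc (card B - 1)"
    using block_card_pos[OF assms(1), of B l] by simp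
  then show ?thesis
    unfolding plus_weight_snoc[OF assms(2), where Ms' = Ms] by simp
qed

text \<open>A block of r letters that changes its mark from +1 to -1 by a further letter keeps its weight:
  r - 1 = (r + 1) - 2.\<close>
lemma weights_close:
  assumes s: "((B, l) # R, Ms) \<in> states n" and us: "length us = length R"
  shows "plus_weight (R, insert (insert (Suc n) B) Ms) us *
      minus_weight (R, insert (insert (Suc n) B) Ms) (v(insert (Suc n) B := t)) =
    plus_weight ((B, l) # R, Ms) (us @ [t]) * minus_weight ((B, l) # R, Ms) v"
proof -
  let ?B = "insert (Suc n) B"
  have new: "?B \<notin> Ms" using states_fresh(2)[OF s] by blast
  have fin: "finite Ms" using diagram_finite_minus[OF states_diagram[OF s]] .
  have "(\<Prod>D\<in>Ms. lam ((v(?B := t)) D) ^ (card D - 2)) = (\<Prod>D\<in>Ms. lam (v D) ^ (card D - 2))"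
    using new by (intro prod.cong) auto
  then have "minus_weight (R, insert ?B Ms) (v(?B := t)) = lam t ^ (card ?B - 2) * minus_weight ((B, l) # R, Ms) v"
    unfolding minus_weight_def using new fin by simp
  moreover have "card ?B - 2 = card B - 1" using block_card_pos[OF s, of B l] by simp
  ultimately show ?thesis
    using plus_weight_snoc[OF us, of B l Ms t "insert ?B Ms"] by simp
qed

lemma contraction_new:
  assumes s: "(Qs, Ms) \<in> states n" and s': "(({Suc n}, x) # Qs, Ms) \<in> states (Suc n)"
    and x: "x \<noteq> Ann" and us: "length us = length Qs"
  shows "contraction (Qs, Ms) n (letter_op \<sigma> lam x h) us ys =
    letter_op \<sigma> lam x (contraction (({Suc n}, x) # Qs, Ms) (Suc n) h) us ys"
proof (cases ys)
  case Nil
  then show ?thesis using x by (cases x) (auto simp: contraction_def)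
next
  case (Cons y ys')
  note eqs = arguments_new[OF s s' us] plus_weight_new[OF us]
  consider "x = Cre" | "x = Neu" using x by (cases x) auto
  then show ?thesis
  proof cases
    case 1
    note eqs = eqs[unfolded 1]
    show ?thesis by (simp add: Cons 1 contraction_def eqs minus_weight_def)
  next
    case 2
    note eqs = eqs[unfolded 2]
    show ?thesis by (simp add: Cons 2 contraction_def eqs minus_weight_def mult.assoc)
  qed
qed

text \<open>The factor lam y produced by the letter is the additional power of lam of the enlarged block.\<close>
lemma contraction_neutral:
  assumes s: "((B, l) # R, Ms) \<in> states n"
    and s': "((insert (Suc n) B, l') # R, Ms) \<in> states (Suc n)"
    and us: "length us = length R"
  shows "contraction ((B, l) # R, Ms) n (letter_op \<sigma> lam Neu h) (us @ [y]) (y # ys) =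
    contraction ((insert (Suc n) B, l') # R, Ms) (Suc n) h (us @ [y]) (y # ys)"
  using us s
  by (simp add: contraction_def arguments_extend[OF s s' us] plus_weight_extend[OF s us] minus_weight_def ac_simps)

text \<open>The factor lam y of the label Neu turns into the additional power of lam of the block, whose label
  is now Cre.\<close>
lemma contraction_create_open:
  assumes s: "((B, l) # R, Ms) \<in> states n"
    and s': "((insert (Suc n) B, l') # R, Ms) \<in> states (Suc n)"
    and us: "length us = length R"
  shows "lam y * contraction ((B, l) # R, Ms) n (letter_op \<sigma> lam Cre h) (us @ [y]) (y # ys) =
    contraction ((insert (Suc n) B, l') # R, Ms) (Suc n) h (us @ [y]) ys"
proof -
  have "h (arguments ((insert (Suc n) B, l') # R, Ms) (Suc n) (us @ [y]) v) ys *
      plus_weight ((insert (Suc n) B, l') # R, Ms) (us @ [y]) *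
      minus_weight ((insert (Suc n) B, l') # R, Ms) v =
    lam y * (letter_op \<sigma> lam Cre h (arguments ((B, l) # R, Ms) n (us @ [y]) v) (y # ys) *
      plus_weight ((B, l) # R, Ms) (us @ [y]) * minus_weight ((B, l) # R, Ms) v)" for v
    by (simp add: arguments_extend[OF s s' us] plus_weight_extend[OF s us] minus_weight_def)
  then show ?thesis unfolding contraction_def by simp
qed

lemma sigma_finite_products: "finite I \<Longrightarrow> sigma_finite_measure (Pi\<^sub>M I (\<lambda>_. \<sigma>))"
  by (rule products.sigma_finite)

lemma measurable_integrand:
  assumes s: "s \<in> states n" and h: "measurable_kernel n h"
    and us: "measurable_list M (length (fst s)) us" and ys: "measurable_list M m ys"
    and v: "v \<in> M \<rightarrow>\<^sub>M Pi\<^sub>M (snd s) (\<lambda>_. \<sigma>)"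
  shows "(\<lambda>\<omega>. h (arguments s n (us \<omega>) (v \<omega>)) (ys \<omega>) * plus_weight s (us \<omega>) * minus_weight s (v \<omega>))
    \<in> borel_measurable M"
proof -
  obtain Qs Ms where s_eq: "s = (Qs, Ms)" by (cases s)
  note st = s[unfolded s_eq]
  have us_j: "(\<lambda>\<omega>. us \<omega> ! j) \<in> M \<rightarrow>\<^sub>M \<sigma>" if "j < length Qs" for j
    using us that unfolding measurable_list_def s_eq by simp
  have v_D: "(\<lambda>\<omega>. v \<omega> D) \<in> M \<rightarrow>\<^sub>M \<sigma>" if "D \<in> Ms" for D
    using measurable_component_singleton[THEN measurable_compose[OF v]] that s_eq by simp
  have "(\<lambda>\<omega>. block_var (marked s) (us \<omega>) (v \<omega>) i) \<in> M \<rightarrow>\<^sub>M \<sigma>" if "i \<in> set [1..<n + 1]" for i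
  proof -
    have "i \<in> {1..n}" using that by auto
    with st show ?thesis
    proof (cases rule: block_exists)
      case (plus j)
      then show ?thesis using us_j[of j] by (simp add: s_eq block_var_plus[OF st plus])
    next
      case (minus D)
      then show ?thesis using v_D[of D] by (simp add: s_eq block_var_minus[OF st minus])
    qed
  qed
  then have "measurable_list M (length [1..<n + 1]) (\<lambda>\<omega>. arguments s n (us \<omega>) (v \<omega>))"
    unfolding arguments_def by (rule measurable_list_map)
  then have "(\<lambda>\<omega>. h (arguments s n (us \<omega>) (v \<omega>)) (ys \<omega>)) \<in> borel_measurable M"
    using measurable_kernel_lists[OF h _ ys] by (simp del: upt_Suc)
  moreover have "(\<lambda>\<omega>. plus_weight s (us \<omega>)) \<in> borel_measurable M"
    unfolding plus_weight_def s_eq fst_conv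
    by (intro borel_measurable_prod borel_measurable_power measurable_compose[OF us_j measurable_lam]) simp
  moreover have "(\<lambda>\<omega>. minus_weight s (v \<omega>)) \<in> borel_measurable M"
    unfolding minus_weight_def s_eq snd_conv
    by (intro borel_measurable_prod borel_measurable_power measurable_compose[OF v_D measurable_lam])
  ultimately show ?thesis by (intro borel_measurable_times)
qed

lemma measurable_contraction:
  assumes s: "s \<in> states n" and h: "measurable_kernel n h"
  shows "measurable_kernel (length (fst s)) (contraction s n h)"
  unfolding measurable_kernel_def split_beta'
proof
  fix m
  let ?k = "length (fst s)" and ?P = "Pi\<^sub>M (snd s) (\<lambda>_. \<sigma>)"
  let ?M = "(T ?k \<Otimes>\<^sub>M T m) \<Otimes>\<^sub>M ?P"
  obtain Qs Ms where s_eq: "s = (Qs, Ms)" by (cases s)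
  have "finite (snd s)"
    using diagram_finite_minus[OF states_diagram] s unfolding s_eq by simp
  then interpret P: sigma_finite_measure ?P by (rule sigma_finite_products)
  have "(\<lambda>q. h (arguments s n (tup ?k (fst (fst q))) (snd q)) (tup m (snd (fst q))) *
      plus_weight s (tup ?k (fst (fst q))) * minus_weight s (snd q)) \<in> borel_measurable ?M"
    by (rule measurable_integrand[OF s h, where m = m]) (auto intro!: measurable_list_tup)
  then show "(\<lambda>p. contraction s n h (tup ?k (fst p)) (tup m (snd p))) \<in> borel_measurable (T ?k \<Otimes>\<^sub>M T m)"
    unfolding contraction_def by (intro P.borel_measurable_lebesgue_integral) (simp add: split_beta')
qed

text \<open>Each variable attached to a block occurs among the arguments of h, as blocks are non-empty. Hence
  the support of h confines all of them to K, where lam is bounded.\<close>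
lemma dominated_integrand:
  assumes s: "s \<in> states n" and K: "compact K" and dom: "dominated n h K H"
  shows "\<exists>c. \<forall>us v ys. length us = length (fst s) \<longrightarrow>
    ennreal \<bar>h (arguments s n us v) ys * plus_weight s us * minus_weight s v\<bar> \<le>
      (if set us \<subseteq> K \<and> v ` snd s \<subseteq> K then ennreal c * H ys else 0)"
proof -
  obtain Qs Ms where s_eq: "s = (Qs, Ms)" by (cases s)
  note st = s[unfolded s_eq]
  have d: "diagram n (map fst Qs) Ms" by (rule states_diagram[OF st])
  obtain L where L: "L \<ge> 0" "\<And>t. t \<in> K \<Longrightarrow> \<bar>lam t\<bar> \<le> L" using lam_bounded_on_compact[OF K] by blast
  define c1 where "c1 = (\<Prod>j<length Qs. L ^ (card (rev (map fst Qs) ! j) - 1))"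
  define c2 where "c2 = (\<Prod>D\<in>Ms. L ^ (card D - 2))"
  have c: "c1 \<ge> 0" "c2 \<ge> 0" unfolding c1_def c2_def using L by (auto intro!: prod_nonneg)
  have "ennreal \<bar>h (arguments s n us v) ys * plus_weight s us * minus_weight s v\<bar> \<le>
      (if set us \<subseteq> K \<and> v ` snd s \<subseteq> K then ennreal (c1 * c2) * H ys else 0)"
    if us: "length us = length (fst s)" for us v ys
  proof -
    have hb: "ennreal \<bar>h (arguments s n us v) ys\<bar> \<le> (if set (arguments s n us v) \<subseteq> K then H ys else 0)"
      using dom unfolding dominated_def by simp
    have in_args: "block_var (marked s) us v i \<in> set (arguments s n us v)" if "i \<in> {1..n}" for i
      using that unfolding arguments_def by (auto simp del: upt_Suc)
    have "set us \<subseteq> K" if args: "set (arguments s n us v) \<subseteq> K"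
    proof
      fix t assume "t \<in> set us"
      then obtain j where j: "j < length Qs" "t = us ! j" using us s_eq by (auto simp: in_set_conv_nth)
      then have mem: "rev (map fst Qs) ! j \<in> set (map fst Qs)" using nth_mem[of j "rev (map fst Qs)"] by simp
      then obtain i where i: "i \<in> rev (map fst Qs) ! j" using diagram_nonempty[OF d] by blast
      then have "i \<in> {1..n}" using diagram_bounds[OF d, of "rev (map fst Qs) ! j" i] mem by simp
      then show "t \<in> K" using in_args[of i] args j block_var_plus[OF st j(1) i, of us v] s_eq by auto
    qed
    moreover have "v ` snd s \<subseteq> K" if args: "set (arguments s n us v) \<subseteq> K"
    proof
      fix t assume "t \<in> v ` snd s"
      then obtain D where D: "D \<in> Ms" "t = v D" using s_eq by auto
      then obtain i where i: "i \<in> D" using diagram_nonempty[OF d] by blast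
      then have "i \<in> {1..n}" using diagram_bounds[OF d, of D i] D by simp
      then show "t \<in> K" using in_args[of i] args D block_var_minus[OF st D(1) i, of us v] s_eq by auto
    qed
    ultimately have *: "set us \<subseteq> K \<and> v ` snd s \<subseteq> K" if "set (arguments s n us v) \<subseteq> K"
      using that by blast
    show ?thesis
    proof (cases "set (arguments s n us v) \<subseteq> K")
      case False
      then have "h (arguments s n us v) ys = 0" using hb by simp
      then show ?thesis by simp
    next
      case True
      then have K': "set us \<subseteq> K" "v ` Ms \<subseteq> K" using * s_eq by auto
      have "\<bar>plus_weight s us\<bar> \<le> c1"
        unfolding plus_weight_def c1_def s_eq fst_conv abs_prod power_abs
        using K' us s_eq by (intro prod_mono) (auto intro!: power_mono L(2) simp: power_abs subset_iff)
      moreover have "\<bar>minus_weight s v\<bar> \<le> c2"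
        unfolding minus_weight_def c2_def s_eq snd_conv abs_prod power_abs
        using K' by (intro prod_mono) (auto intro!: power_mono L(2) simp: power_abs image_subset_iff)
      ultimately have w: "\<bar>plus_weight s us * minus_weight s v\<bar> \<le> c1 * c2"
        unfolding abs_mult using c by (intro mult_mono) auto
      have "ennreal \<bar>h (arguments s n us v) ys * plus_weight s us * minus_weight s v\<bar> =
          ennreal \<bar>plus_weight s us * minus_weight s v\<bar> * ennreal \<bar>h (arguments s n us v) ys\<bar>"
        by (simp add: abs_mult ennreal_mult[symmetric] ac_simps)
      also have "\<dots> \<le> ennreal (c1 * c2) * H ys"
        using hb True w by (intro mult_mono ennreal_leI) auto
      finally show ?thesis using * True by simp
    qed
  qed
  then show ?thesis by blast
qed

lemma integrable_on_compacts:
  assumes I: "finite I" and K: "compact K"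
    and F: "(\<lambda>(v, t). F v t) \<in> borel_measurable (Pi\<^sub>M I (\<lambda>_. \<sigma>) \<Otimes>\<^sub>M \<sigma>)"
    and J: "J \<in> borel_measurable \<sigma>" "(\<integral>\<^sup>+t. indicator K t * J t \<partial>\<sigma>) < \<infinity>"
    and le: "\<And>v t. ennreal \<bar>F v t\<bar> \<le> (if v ` I \<subseteq> K \<and> t \<in> K then ennreal c * J t else 0)"
  shows "integrable (Pi\<^sub>M I (\<lambda>_. \<sigma>) \<Otimes>\<^sub>M \<sigma>) (\<lambda>(v, t). F v t :: real)"
proof (rule integrableI_bounded[OF F])
  let ?P = "Pi\<^sub>M I (\<lambda>_. \<sigma>)"
  let ?B = "Pi\<^sub>E I (\<lambda>_. K)"
  have [measurable]: "K \<in> sets \<sigma>" using K by simp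
  have [measurable]: "?B \<in> sets ?P" by (rule sets_PiM_I_finite) (use I in auto)
  have "(\<integral>\<^sup>+p. ennreal (norm (case p of (v, t) \<Rightarrow> F v t)) \<partial>(?P \<Otimes>\<^sub>M \<sigma>)) \<le>
      (\<integral>\<^sup>+p. indicator ?B (fst p) * (ennreal c * (indicator K (snd p) * J (snd p))) \<partial>(?P \<Otimes>\<^sub>M \<sigma>))"
  proof (rule nn_integral_mono)
    fix p assume p: "p \<in> space (?P \<Otimes>\<^sub>M \<sigma>)"
    obtain v t where vt: "p = (v, t)" by (cases p)
    then have "v \<in> extensional I" using p by (auto simp: space_pair_measure space_PiM PiE_def)
    then have "v ` I \<subseteq> K \<longleftrightarrow> v \<in> ?B" by (auto simp: PiE_def)
    then show "ennreal (norm (case p of (v, t) \<Rightarrow> F v t)) \<le>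
        indicator ?B (fst p) * (ennreal c * (indicator K (snd p) * J (snd p)))"
      using le[of v t] vt by (auto simp: indicator_def split: if_splits)
  qed
  also have "\<dots> = (\<integral>\<^sup>+v. \<integral>\<^sup>+t. indicator ?B v * (ennreal c * (indicator K t * J t)) \<partial>\<sigma> \<partial>?P)"
    using J(1) by (subst nn_integral_fst[symmetric]) (simp_all add: split_beta')
  also have "\<dots> = (\<integral>\<^sup>+v. indicator ?B v * (ennreal c * (\<integral>\<^sup>+t. indicator K t * J t \<partial>\<sigma>)) \<partial>?P)"
    using J(1) by (simp add: nn_integral_cmult)
  also have "\<dots> = emeasure ?P ?B * (ennreal c * (\<integral>\<^sup>+t. indicator K t * J t \<partial>\<sigma>))"
    by (simp add: nn_integral_multc)
  also have "\<dots> < \<infinity>"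
    using J(2) finite_compact[OF K] I
    by (simp add: products.emeasure_PiM ennreal_mult_less_top power_less_top_ennreal)
  finally show "(\<integral>\<^sup>+p. ennreal (norm (case p of (v, t) \<Rightarrow> F v t)) \<partial>(?P \<Otimes>\<^sub>M \<sigma>)) < \<infinity>" .
qed

text \<open>The variable of the new letter is integrated innermost on the left, and outside the integrals over
  the blocks marked -1 on the right.\<close>
lemma contraction_annihilate:
  assumes s: "(Qs, Ms) \<in> states n" and s': "(({Suc n}, Ann) # Qs, Ms) \<in> states (Suc n)"
    and h: "regular_kernel (Suc n) h"
  shows "kernel_eq (length Qs) (contraction (Qs, Ms) n (letter_op \<sigma> lam Ann h))
    (letter_op \<sigma> lam Ann (contraction (({Suc n}, Ann) # Qs, Ms) (Suc n) h))"
  unfolding kernel_eq_def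
proof
  fix m
  let ?s = "(Qs, Ms)" and ?s' = "(({Suc n}, Ann) # Qs, Ms)"
  let ?P = "Pi\<^sub>M Ms (\<lambda>_. \<sigma>)"
  obtain K H where hm: "measurable_kernel (Suc n) h" and K: "compact K"
    and H: "locally_integrable H" and dom: "dominated (Suc n) h K H"
    using h unfolding regular_kernel_def by blast
  have fin: "finite Ms" using diagram_finite_minus[OF states_diagram[OF s]] .
  interpret P: sigma_finite_measure ?P using fin by (rule sigma_finite_products)
  interpret P\<sigma>: pair_sigma_finite ?P \<sigma> ..
  define F where "F us ys v t = h (arguments ?s' (Suc n) (us @ [t]) v) (t # ys) *
    plus_weight ?s' (us @ [t]) * minus_weight ?s' v" for us ys v t
  obtain c where c: "\<And>us v ys. length us = length (fst ?s') \<Longrightarrow>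
      ennreal \<bar>h (arguments ?s' (Suc n) us v) ys * plus_weight ?s' us * minus_weight ?s' v\<bar> \<le>
      (if set us \<subseteq> K \<and> v ` snd ?s' \<subseteq> K then ennreal c * H ys else 0)"
    using dominated_integrand[OF s' K dom] by blast
  have "AE y in T m. (\<integral>\<^sup>+t. indicator K t * H (t # tup m y) \<partial>\<sigma>) < \<infinity>"
    by (rule locally_integrable_AE_finite[OF locally_integrable_integral[OF H K]])
  then show "AE y in T m. \<forall>us. length us = length Qs \<longrightarrow>
      contraction ?s n (letter_op \<sigma> lam Ann h) us (tup m y) =
      letter_op \<sigma> lam Ann (contraction ?s' (Suc n) h) us (tup m y)"
  proof eventually_elim
    case (elim y)
    let ?ys = "tup m y"
    show ?case
    proof (intro allI impI)
      fix us :: "'a list" assume us: "length us = length Qs"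
      have "integrable (?P \<Otimes>\<^sub>M \<sigma>) (\<lambda>(v, t). F us ?ys v t)"
      proof (rule integrable_on_compacts[OF fin K])
        show "(\<lambda>(v, t). F us ?ys v t) \<in> borel_measurable (?P \<Otimes>\<^sub>M \<sigma>)"
          unfolding F_def split_beta'
          by (rule measurable_integrand[OF s' hm, where m = "Suc m"])
            (auto intro!: measurable_list_snoc measurable_list_Cons measurable_list_const simp: us)
        have "measurable_list \<sigma> (Suc m) (\<lambda>t. t # ?ys)"
          by (intro measurable_list_Cons measurable_list_const) auto
        from measurable_on_list[OF locally_integrable_measurable(1)[OF H] this]
        show "(\<lambda>t. H (t # ?ys)) \<in> borel_measurable \<sigma>" .
        show "(\<integral>\<^sup>+t. indicator K t * H (t # ?ys) \<partial>\<sigma>) < \<infinity>" by fact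
        show "ennreal \<bar>F us ?ys v t\<bar> \<le> (if v ` Ms \<subseteq> K \<and> t \<in> K then ennreal c * H (t # ?ys) else 0)" for v t
          using c[of "us @ [t]" v "t # ?ys"] us unfolding F_def by (auto split: if_splits)
      qed
      from P\<sigma>.Fubini_integral[OF this]
      have "(\<integral>v. \<integral>t. F us ?ys v t \<partial>\<sigma> \<partial>?P) = (\<integral>t. \<integral>v. F us ?ys v t \<partial>?P \<partial>\<sigma>)" by simp
      moreover have "(\<integral>t. F us ?ys v t \<partial>\<sigma>) =
          letter_op \<sigma> lam Ann h (arguments ?s n us v) ?ys * plus_weight ?s us * minus_weight ?s v" for v
        by (simp add: F_def arguments_new[OF s s' us] plus_weight_new[OF us] minus_weight_def)
      ultimately show "contraction ?s n (letter_op \<sigma> lam Ann h) us ?ys =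
          letter_op \<sigma> lam Ann (contraction ?s' (Suc n) h) us ?ys"
        by (simp add: contraction_def F_def)
    qed
  qed
qed

text \<open>The outermost integration over the variable of an open block becomes one of the integrations over the
  blocks marked -1.\<close>
lemma contraction_close:
  assumes s: "((B, l) # R, Ms) \<in> states n" and s': "(R, insert (insert (Suc n) B) Ms) \<in> states (Suc n)"
    and h: "regular_kernel (Suc n) h"
  shows "kernel_eq (length R)
    (letter_op \<sigma> lam Ann (contraction ((B, l) # R, Ms) n (letter_op \<sigma> lam Cre h)))
    (contraction (R, insert (insert (Suc n) B) Ms) (Suc n) h)"
  unfolding kernel_eq_def
proof
  fix m
  let ?B = "insert (Suc n) B"
  let ?s = "((B, l) # R, Ms)" and ?s' = "(R, insert ?B Ms)"
  let ?P = "Pi\<^sub>M Ms (\<lambda>_. \<sigma>)" and ?P' = "Pi\<^sub>M (insert ?B Ms) (\<lambda>_. \<sigma>)"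
  obtain K H where hm: "measurable_kernel (Suc n) h" and K: "compact K"
    and H: "locally_integrable H" and dom: "dominated (Suc n) h K H"
    using h unfolding regular_kernel_def by blast
  have [measurable]: "K \<in> sets \<sigma>" using K by simp
  have fin: "finite Ms" using diagram_finite_minus[OF states_diagram[OF s]] .
  have new: "?B \<notin> Ms" using states_fresh(2)[OF s] by blast
  interpret P: sigma_finite_measure ?P using fin by (rule sigma_finite_products)
  interpret P\<sigma>: pair_sigma_finite ?P \<sigma> ..
  define F where "F us ys v = h (arguments ?s' (Suc n) us v) ys *
    plus_weight ?s' us * minus_weight ?s' v" for us ys v
  obtain c where c: "\<And>us v ys. length us = length (fst ?s') \<Longrightarrow>
      ennreal \<bar>h (arguments ?s' (Suc n) us v) ys * plus_weight ?s' us * minus_weight ?s' v\<bar> \<le>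
      (if set us \<subseteq> K \<and> v ` snd ?s' \<subseteq> K then ennreal c * H ys else 0)"
    using dominated_integrand[OF s' K dom] by blast
  have upd: "(\<lambda>(v, t). v(?B := t)) \<in> ?P \<Otimes>\<^sub>M \<sigma> \<rightarrow>\<^sub>M ?P'"
    unfolding split_beta' by (rule measurable_fun_upd[where J = Ms]) auto
  have "AE y in T m. H (tup m y) < \<infinity>"
    by (rule locally_integrable_AE_finite[OF H])
  then show "AE y in T m. \<forall>us. length us = length R \<longrightarrow>
      letter_op \<sigma> lam Ann (contraction ?s n (letter_op \<sigma> lam Cre h)) us (tup m y) =
      contraction ?s' (Suc n) h us (tup m y)"
  proof eventually_elim
    case (elim y)
    let ?ys = "tup m y"
    show ?case
    proof (intro allI impI)
      fix us :: "'a list" assume us: "length us = length R"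
      have F_meas: "F us ?ys \<in> borel_measurable ?P'"
        unfolding F_def
        by (rule measurable_integrand[OF s' hm, where m = m])
          (auto intro!: measurable_list_const simp: us)
      have int: "integrable (?P \<Otimes>\<^sub>M \<sigma>) (\<lambda>(v, t). F us ?ys (v(?B := t)))"
      proof (rule integrable_on_compacts[OF fin K])
        show "(\<lambda>(v, t). F us ?ys (v(?B := t))) \<in> borel_measurable (?P \<Otimes>\<^sub>M \<sigma>)"
          using measurable_compose[OF upd F_meas] by (simp add: split_beta')
        show "(\<lambda>t. H ?ys) \<in> borel_measurable \<sigma>" by simp
        show "(\<integral>\<^sup>+t. indicator K t * H ?ys \<partial>\<sigma>) < \<infinity>"
          using elim finite_compact[OF K] by (simp add: nn_integral_multc ennreal_mult_less_top)
        show "ennreal \<bar>F us ?ys (v(?B := t))\<bar> \<le> (if v ` Ms \<subseteq> K \<and> t \<in> K then ennreal c * H ?ys else 0)" for v t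
        proof -
          have "(v(?B := t)) ` insert ?B Ms \<subseteq> K \<longleftrightarrow> v ` Ms \<subseteq> K \<and> t \<in> K"
            using new by (auto simp: image_subset_iff)
          then show ?thesis
            using c[of us "v(?B := t)" ?ys] us unfolding F_def snd_conv by (auto split: if_splits)
        qed
      qed
      have "contraction ?s' (Suc n) h us ?ys = (\<integral>v. F us ?ys v \<partial>?P')"
        by (simp add: contraction_def F_def)
      also have "\<dots> = (\<integral>v. F us ?ys v \<partial>distr (?P \<Otimes>\<^sub>M \<sigma>) ?P' (\<lambda>(v, t). v(?B := t)))"
        unfolding PiM_insert_pair[OF fin new] ..
      also have "\<dots> = (\<integral>p. F us ?ys (case p of (v, t) \<Rightarrow> v(?B := t)) \<partial>(?P \<Otimes>\<^sub>M \<sigma>))"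
        by (rule integral_distr[OF upd F_meas])
      also have "\<dots> = (\<integral>t. \<integral>v. F us ?ys (v(?B := t)) \<partial>?P \<partial>\<sigma>)"
        using P\<sigma>.integral_snd[OF int] by (simp add: split_beta')
      also have "\<dots> = (\<integral>t. contraction ?s n (letter_op \<sigma> lam Cre h) (us @ [t]) (t # ?ys) \<partial>\<sigma>)"
        by (simp add: contraction_def F_def arguments_close[OF s s' us] mult.assoc weights_close[OF s us])
      finally show "letter_op \<sigma> lam Ann (contraction ?s n (letter_op \<sigma> lam Cre h)) us ?ys =
          contraction ?s' (Suc n) h us ?ys" by simp
    qed
  qed
qed

lemma length_labels [simp]: "length (labels s) = length (fst s)"
  by (simp add: labels_def)

text \<open>Absorbing one letter. The labels that do not change are stripped off by \<open>kernel_eq_word_kernel\<close>.\<close>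
lemma contraction_step:
  assumes s: "s \<in> states n" and h: "regular_kernel (Suc n) h"
  shows "kernel_eq 0 (word_kernel (labels s) (contraction s n (letter_op \<sigma> lam x h)))
    (word_kernel (labels (absorb (Suc n) x s)) (contraction (absorb (Suc n) x s) (Suc n) h))"
proof -
  let ?s' = "absorb (Suc n) x s"
  have hm: "measurable_kernel (Suc n) h" using h unfolding regular_kernel_def by blast
  have xm: "measurable_kernel n (letter_op \<sigma> lam y h)" for y
    by (rule measurable_kernel_letter_op[OF hm measurable_lam])
  have s': "?s' \<in> states (Suc n)" by (rule absorb_states[OF s])
  have m: "measurable_kernel (length (fst s)) (contraction s n (letter_op \<sigma> lam x h))"
    by (rule measurable_contraction[OF s xm])
  have m': "measurable_kernel (length (fst ?s')) (contraction ?s' (Suc n) h)"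
    by (rule measurable_contraction[OF s' hm])
  show ?thesis
  proof (cases rule: absorb_cases[of x s "Suc n"])
    case (annihilate Qs Ms)
    have "kernel_eq 0 (word_kernel (labels s) (contraction s n (letter_op \<sigma> lam x h)))
        (word_kernel (labels s) (letter_op \<sigma> lam Ann (contraction ?s' (Suc n) h)))"
      using annihilate m m' contraction_annihilate[OF _ _ h, of Qs Ms] s s'
      by (intro kernel_eq_word_kernel) (auto intro!: measurable_kernel_letter_op measurable_lam)
    then show ?thesis using annihilate by (simp add: labels_def)
  next
    case (new Qs Ms)
    have "kernel_eq 0 (word_kernel (labels s) (contraction s n (letter_op \<sigma> lam x h)))
        (word_kernel (labels s) (letter_op \<sigma> lam x (contraction ?s' (Suc n) h)))"
      using new m m' contraction_new[of Qs Ms n x _ h] s s'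
      by (intro kernel_eq_word_kernel kernel_eqI) (auto intro!: measurable_kernel_letter_op measurable_lam)
    then show ?thesis using new by (simp add: labels_def)
  next
    case (close B Qs Ms)
    have "kernel_eq 0
        (word_kernel (labels ?s') (letter_op \<sigma> lam Ann (contraction s n (letter_op \<sigma> lam Cre h))))
        (word_kernel (labels ?s') (contraction ?s' (Suc n) h))"
      using close m m' contraction_close[OF _ _ h, of B Ann Qs Ms] s s'
      by (intro kernel_eq_word_kernel) (auto intro!: measurable_kernel_letter_op measurable_lam)
    then show ?thesis using close by (simp add: labels_def)
  next
    case (create_open B Qs Ms)
    have "kernel_eq (length Qs) (letter_op \<sigma> lam Neu (contraction s n (letter_op \<sigma> lam Cre h)))
        (letter_op \<sigma> lam Cre (contraction ?s' (Suc n) h))"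
    proof (rule kernel_eqI)
      fix us ys :: "'a list" assume "length us = length Qs"
      then show "letter_op \<sigma> lam Neu (contraction s n (letter_op \<sigma> lam Cre h)) us ys =
          letter_op \<sigma> lam Cre (contraction ?s' (Suc n) h) us ys"
        using create_open s s' contraction_create_open[of B Neu Qs Ms n Cre us] by (cases ys) auto
    qed
    then have "kernel_eq 0
        (word_kernel (rev (map snd Qs)) (letter_op \<sigma> lam Neu (contraction s n (letter_op \<sigma> lam Cre h))))
        (word_kernel (rev (map snd Qs)) (letter_op \<sigma> lam Cre (contraction ?s' (Suc n) h)))"
      using create_open m m'
      by (intro kernel_eq_word_kernel) (auto intro!: measurable_kernel_letter_op measurable_lam)
    then show ?thesis using create_open by (simp add: labels_def)
  next
    case (neutral_open B l Qs Ms)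
    have "kernel_eq (length Qs) (letter_op \<sigma> lam l (contraction s n (letter_op \<sigma> lam Neu h)))
        (letter_op \<sigma> lam l (contraction ?s' (Suc n) h))"
    proof (rule kernel_eqI)
      fix us ys :: "'a list" assume "length us = length Qs"
      then show "letter_op \<sigma> lam l (contraction s n (letter_op \<sigma> lam Neu h)) us ys =
          letter_op \<sigma> lam l (contraction ?s' (Suc n) h) us ys"
        using neutral_open s s' contraction_neutral[of B l Qs Ms n l us] by (cases l; cases ys) auto
    qed
    then have "kernel_eq 0
        (word_kernel (rev (map snd Qs)) (letter_op \<sigma> lam l (contraction s n (letter_op \<sigma> lam Neu h))))
        (word_kernel (rev (map snd Qs)) (letter_op \<sigma> lam l (contraction ?s' (Suc n) h)))"
      using neutral_open m m'
      by (intro kernel_eq_word_kernel) (auto intro!: measurable_kernel_letter_op measurable_lam)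
    then show ?thesis using neutral_open by (simp add: labels_def)
  qed
qed

text \<open>Matched terms are equal. The last letter of the word acts first, directly on the kernel,
  so that induction on the remaining word applies to the resulting kernel.\<close>
lemma word_kernel_eq_contraction:
  assumes "regular_kernel (length w) h"
  shows "kernel_eq 0 (word_kernel w h) (word_kernel (labels (run w)) (contraction (run w) (length w) h))"
  using assms
proof (induction w arbitrary: h rule: rev_induct)
  case Nil
  have "contraction ([], {}) 0 h us ys = h [] ys" for us ys
    by (simp add: contraction_def arguments_def plus_weight_def minus_weight_def PiM_empty
        lebesgue_integral_count_space_finite)
  then show ?case by (intro kernel_eqI) (simp add: labels_def)
next
  case (snoc x w)
  have h: "regular_kernel (Suc (length w)) h" using snoc.prems by simp
  have "kernel_eq 0 (word_kernel (w @ [x]) h)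
      (word_kernel (labels (run w)) (contraction (run w) (length w) (letter_op \<sigma> lam x h)))"
    using snoc.IH[OF regular_kernel_letter_op[OF h]] by simp
  also have "kernel_eq 0 \<dots>
      (word_kernel (labels (run (w @ [x]))) (contraction (run (w @ [x])) (length (w @ [x])) h))"
    using contraction_step[OF run_states h] by simp
  finally show ?case .
qed

section \<open>Test functions and Fock vectors\<close>

lemma fock_locally_integrable:
  assumes G: "G \<in> fock \<sigma>"
  shows "locally_integrable (\<lambda>ys. ennreal \<bar>G ys\<bar>)"
  unfolding locally_integrable_def
proof (intro allI conjI impI)
  fix m
  have [measurable]: "(\<lambda>y. G (tup m y)) \<in> borel_measurable (T m)"
    and sq: "integrable (T m) (\<lambda>y. (G (tup m y))\<^sup>2)"
    using G unfolding fock_def by auto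
  show "(\<lambda>y. ennreal \<bar>G (tup m y)\<bar>) \<in> borel_measurable (T m)" by simp
  fix Q :: "'a set" assume Q: "compact Q"
  let ?B = "Pi\<^sub>E {..<m} (\<lambda>_. Q)"
  have B [measurable]: "?B \<in> sets (T m)" using Q by (intro sets_PiM_I_finite) auto
  have "(\<integral>\<^sup>+y. (if set (tup m y) \<subseteq> Q then ennreal \<bar>G (tup m y)\<bar> else 0) \<partial>T m) \<le>
      (\<integral>\<^sup>+y. indicator ?B y + ennreal ((G (tup m y))\<^sup>2) \<partial>T m)"
  proof (rule nn_integral_mono)
    fix y assume y: "y \<in> space (T m)"
    \<comment> \<open>A square integrable function is integrable on sets of finite measure.\<close>
    have "\<bar>a\<bar> \<le> 1 + a\<^sup>2" for a :: real
    proof -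
      have "0 \<le> (\<bar>a\<bar> - 1)\<^sup>2" by simp
      also have "\<dots> = a\<^sup>2 + 1 - 2 * \<bar>a\<bar>" by (simp add: power2_diff)
      finally show ?thesis by simp
    qed
    then have "ennreal \<bar>G (tup m y)\<bar> \<le> ennreal (1 + (G (tup m y))\<^sup>2)" by (rule ennreal_leI)
    also have "\<dots> = 1 + ennreal ((G (tup m y))\<^sup>2)" by (simp add: ennreal_plus)
    finally have "ennreal \<bar>G (tup m y)\<bar> \<le> 1 + ennreal ((G (tup m y))\<^sup>2)" .
    moreover have "set (tup m y) \<subseteq> Q \<longleftrightarrow> y \<in> ?B"
      using y by (auto simp: set_tup space_PiM PiE_def)
    ultimately show "(if set (tup m y) \<subseteq> Q then ennreal \<bar>G (tup m y)\<bar> else 0) \<le>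
        indicator ?B y + ennreal ((G (tup m y))\<^sup>2)" by simp
  qed
  also have "\<dots> = emeasure (T m) ?B + (\<integral>\<^sup>+y. ennreal ((G (tup m y))\<^sup>2) \<partial>T m)"
    by (subst nn_integral_add) auto
  also have "\<dots> < \<infinity>"
  proof -
    have "emeasure (T m) ?B = emeasure \<sigma> Q ^ m"
      using Q by (subst products.emeasure_PiM) auto
    then have "emeasure (T m) ?B < \<infinity>" using finite_compact[OF Q] by (simp add: power_less_top_ennreal)
    moreover have "(\<integral>\<^sup>+y. ennreal ((G (tup m y))\<^sup>2) \<partial>T m) < \<infinity>"
      using sq unfolding integrable_iff_bounded by simp
    ultimately show ?thesis by simp
  qed
  finally show "(\<integral>\<^sup>+y. (if set (tup m y) \<subseteq> Q then ennreal \<bar>G (tup m y)\<bar> else 0) \<partial>T m) < \<infinity>" .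
qed

text \<open>The Borel sets of a countable power are generated by the coordinates if all functions on the index
  set are considered. Extensional functions are therefore extended to all indices, which leaves their
  first n values and hence the value of f unchanged.\<close>
lemma continuous_on_power_measurable:
  assumes f: "continuous_map (power_top n) euclideanreal (\<lambda>x. f (tup n x))"
  shows "(\<lambda>x. f (tup n x)) \<in> borel_measurable (T n)"
proof -
  have tr: "tup n (restrict z {..<n}) = tup n z" for z :: "nat \<Rightarrow> 'a"
    by (simp add: tup_def)
  have "continuous_map (product_topology (\<lambda>_. euclidean) UNIV) (power_top n) (\<lambda>z. restrict z {..<n})"
    unfolding continuous_map_componentwise
    by (auto intro!: continuous_map_product_projection simp: restrict_def[abs_def] extensional_def cong: if_cong)
  from continuous_map_compose[OF this f]
  have "continuous_map (euclidean :: (nat \<Rightarrow> 'a) topology) euclideanreal (\<lambda>z. f (tup n z))"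
    by (simp add: comp_def tr euclidean_product_topology)
  then have f_meas: "(\<lambda>z. f (tup n z)) \<in> borel_measurable borel"
    by (intro borel_measurable_continuous_onI) simp
  define e :: "(nat \<Rightarrow> 'a) \<Rightarrow> nat \<Rightarrow> 'a" where "e x i = (if i < n then x i else undefined)" for x i
  have "e \<in> borel_measurable (T n)"
  proof (rule measurable_coordinatewise_then_product)
    fix i
    have "(\<lambda>x. x i) \<in> borel_measurable (T n)" if "i < n"
    proof -
      have "(\<lambda>x. x i) \<in> T n \<rightarrow>\<^sub>M \<sigma>" using that by simp
      then show ?thesis using measurable_cong_sets[OF refl sets_eq_borel] by blast
    qed
    then show "(\<lambda>x. e x i) \<in> borel_measurable (T n)"
      by (cases "i < n") (simp_all add: e_def)
  qed
  from measurable_compose[OF this f_meas]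
  have "(\<lambda>x. f (tup n (e x))) \<in> borel_measurable (T n)" .
  moreover have "tup n (e x) = tup n x" for x by (simp add: tup_def e_def)
  ultimately show ?thesis by simp
qed

lemma test_fun_bound:
  assumes "test_fun n f"
  obtains K c where "compact (K :: 'a set)" "c \<ge> 0"
    "\<And>ts. length ts = n \<Longrightarrow> \<bar>f ts\<bar> \<le> (if set ts \<subseteq> K then c else 0)"
proof -
  let ?g = "\<lambda>x. f (tup n x)"
  let ?U = "{x \<in> topspace (power_top n). ?g x \<noteq> 0}"
  define S where "S = power_top n closure_of ?U"
  have cont: "continuous_map (power_top n) euclideanreal ?g" and S: "compactin (power_top n) S"
    using assms unfolding test_fun_def S_def by auto
  have "compact (?g ` S)"
    using image_compactin[OF S cont] by simp
  then obtain c where c: "\<And>x. x \<in> S \<Longrightarrow> \<bar>?g x\<bar> \<le> c"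
    using compact_imp_bounded bounded_iff by (metis imageI real_norm_def)
  define K where "K = (\<Union>i<n. (\<lambda>x. x i) ` S)"
  have "compact ((\<lambda>x. x i) ` S)" if "i < n" for i
    using image_compactin[OF S continuous_map_product_projection[of i "{..<n}" "\<lambda>_. euclidean"]] that
    by simp
  then have "compact K" unfolding K_def by (intro compact_UN) auto
  moreover have "\<bar>f ts\<bar> \<le> (if set ts \<subseteq> K then max c 0 else 0)" if ts: "length ts = n" for ts
  proof (cases "f ts = 0")
    case False
    define x where "x = (\<lambda>i\<in>{..<n}. ts ! i)"
    have tup: "tup n x = ts" using ts by (intro nth_equalityI) (auto simp: x_def)
    have "x \<in> ?U" using False tup by (simp add: x_def)
    moreover have "?U \<subseteq> S" unfolding S_def by (rule closure_of_subset) auto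
    ultimately have xS: "x \<in> S" by blast
    have "set ts = x ` {..<n}" unfolding tup[symmetric] set_tup ..
    then have "set ts \<subseteq> K" using xS unfolding K_def by auto
    then show ?thesis using c[OF xS] tup by simp
  qed simp
  ultimately show thesis using that[of K "max c 0"] by simp
qed

lemma regular_kernel_test_fun:
  assumes f: "test_fun n f" and G: "G \<in> fock \<sigma>"
  shows "regular_kernel n (\<lambda>ts ys. f ts * G ys)"
proof -
  have fm [measurable]: "(\<lambda>x. f (tup n x)) \<in> borel_measurable (T n)"
    using f unfolding test_fun_def by (intro continuous_on_power_measurable) blast
  have "measurable_kernel n (\<lambda>ts ys. f ts * G ys)"
    unfolding measurable_kernel_def
  proof
    fix m
    have [measurable]: "(\<lambda>y. G (tup m y)) \<in> borel_measurable (T m)"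
      using G unfolding fock_def by auto
    show "(\<lambda>(x, y). f (tup n x) * G (tup m y)) \<in> borel_measurable (T n \<Otimes>\<^sub>M T m)" by measurable
  qed
  moreover obtain K c where K: "compact K" "c \<ge> 0"
      "\<And>ts. length ts = n \<Longrightarrow> \<bar>f ts\<bar> \<le> (if set ts \<subseteq> K then c else 0)"
    using test_fun_bound[OF f] by blast
  have "dominated n (\<lambda>ts ys. f ts * G ys) K (\<lambda>ys. ennreal c * ennreal \<bar>G ys\<bar>)"
    unfolding dominated_def
  proof (intro allI impI)
    fix ts ys :: "'a list" assume "length ts = n"
    then have "\<bar>f ts * G ys\<bar> \<le> (if set ts \<subseteq> K then c else 0) * \<bar>G ys\<bar>"
      unfolding abs_mult by (intro mult_right_mono K) auto
    then show "ennreal \<bar>f ts * G ys\<bar> \<le> (if set ts \<subseteq> K then ennreal c * ennreal \<bar>G ys\<bar> else 0)"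
      using K(2) by (auto simp: ennreal_mult[symmetric] split: if_splits intro!: ennreal_leI)
  qed
  moreover have "locally_integrable (\<lambda>ys. ennreal c * ennreal \<bar>G ys\<bar>)"
    by (intro locally_integrable_mult fock_locally_integrable G) simp
  ultimately show ?thesis using K(1) unfolding regular_kernel_def by blast
qed

lemma word_op_contraction:
  assumes f: "test_fun (length w) f" and G: "G \<in> fock \<sigma>"
  shows "AE y in T m. word_op \<sigma> lam w f G (tup m y) =
    word_op \<sigma> lam (labels (run w)) (contracted \<sigma> lam (length w) (marked (run w)) f) G (tup m y)"
proof -
  let ?h = "\<lambda>ts ys. f ts * G ys"
  have "contraction (run w) (length w) ?h us ys =
      contracted \<sigma> lam (length w) (marked (run w)) f us * G ys" for us ys
  proof -
    have "contracted \<sigma> lam (length w) (marked (run w)) (\<lambda>ts. f ts * G ys) us =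
        contracted \<sigma> lam (length w) (marked (run w)) f us * G ys"
      unfolding contracted_def integral_mult_left_zero[symmetric]
      by (intro Bochner_Integration.integral_cong refl) (simp only: ac_simps)
    then show ?thesis using contracted_eq_contraction[OF run_states, of w ?h] by simp
  qed
  then have "contraction (run w) (length w) ?h =
      (\<lambda>us ys. contracted \<sigma> lam (length w) (marked (run w)) f us * G ys)" by blast
  moreover have "kernel_eq 0 (word_kernel w ?h)
      (word_kernel (labels (run w)) (contraction (run w) (length w) ?h))"
    by (rule word_kernel_eq_contraction[OF regular_kernel_test_fun[OF f G]])
  ultimately show ?thesis unfolding kernel_eq_def word_op_def by simp
qed

end

section \<open>The Wick rule\<close>

lemma compact_exhaustion:
  assumes "locally_compact_space (euclidean :: 'a::{second_countable_topology, t2_space} topology)"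
  shows "\<exists>Q :: nat \<Rightarrow> 'a set. (\<forall>i. compact (Q i)) \<and> incseq Q \<and> (\<Union>i. Q i) = UNIV"
proof -
  let ?F = "{U :: 'a set. open U \<and> (\<exists>K. compact K \<and> U \<subseteq> K)}"
  have "\<exists>U\<in>?F. x \<in> U" for x
    using assms unfolding locally_compact_space_def by simp blast
  then have "\<Union>?F = UNIV" by blast
  moreover obtain F where F: "F \<subseteq> ?F" "countable F" "\<Union>F = \<Union>?F"
    using Lindelof[of ?F] by auto
  ultimately have cover: "\<Union>F = UNIV" by simp
  then have ne: "F \<noteq> {}" by auto
  have "\<exists>K. compact K \<and> from_nat_into F i \<subseteq> K" for i
    using from_nat_into[OF ne, of i] F(1) by blast
  then obtain K where K: "\<And>i. compact (K i)" "\<And>i. from_nat_into F i \<subseteq> K i" by metis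
  have "(\<Union>i. \<Union>j\<le>i. K j) = UNIV"
  proof -
    have "x \<in> (\<Union>i. \<Union>j\<le>i. K j)" for x
    proof -
      obtain U where "U \<in> F" "x \<in> U" using cover by (metis UNIV_I UnionE)
      then obtain i where "from_nat_into F i = U" using from_nat_into_surj[OF F(2)] by blast
      then show ?thesis using K(2)[of i] \<open>x \<in> U\<close> by blast
    qed
    then show ?thesis by blast
  qed
  moreover have "compact (\<Union>j\<le>i. K j)" for i using K(1) by (intro compact_UN) auto
  moreover have "incseq (\<lambda>i. \<Union>j\<le>i. K j)" by (intro incseq_SucI UN_mono) auto
  ultimately show ?thesis by (intro exI[of _ "\<lambda>i. \<Union>j\<le>i. K j"]) blast
qed

theorem theorem2p4:
  fixes \<sigma> :: "'a::{second_countable_topology, t2_space, perfect_space} measure"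
    and lam :: "'a \<Rightarrow> real"
    and ks :: "nat list"
    and f :: "'a list \<Rightarrow> real"
  assumes "locally_compact_space (euclidean :: 'a topology)"
    and "radon_measure \<sigma>"
    and "nonatomic \<sigma>"
    and "\<And>U. open U \<Longrightarrow> U \<noteq> {} \<Longrightarrow> emeasure \<sigma> U > 0"
    and "continuous_on UNIV lam"
    and "length ks \<ge> 1"
    and "\<And>k. k \<in> set ks \<Longrightarrow> k \<ge> 1"
    and "test_fun (sum_list ks) f"
  shows "fock_op_eq \<sigma> (wick_product \<sigma> lam ks f)
           (\<lambda>G ys. \<Sum>\<kappa>\<in>admissible ks. wick_contracted \<sigma> lam (sum_list ks) \<kappa> f G ys)"
  unfolding fock_op_eq_def fock_eq_def
proof (intro ballI allI)
  fix G :: "'a list \<Rightarrow> real" and m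
  assume G: "G \<in> fock \<sigma>"
  interpret wick_setting \<sigma> lam
    by unfold_locales (use assms(2,5) compact_exhaustion[OF assms(1)] in \<open>auto simp: radon_measure_def\<close>)
  let ?n = "sum_list ks"
  let ?term = "\<lambda>(\<kappa>, w'). word_op \<sigma> lam w' (contracted \<sigma> lam ?n \<kappa> f) G"
  have "AE y in T m. \<forall>w\<in>product_words ks.
      word_op \<sigma> lam w f G (tup m y) = ?term (marked (run w), labels (run w)) (tup m y)"
  proof (intro AE_finite_allI finite_product_words)
    fix w assume "w \<in> product_words ks"
    then have "length w = ?n" by (rule product_words_length)
    then show "AE y in T m. word_op \<sigma> lam w f G (tup m y) = ?term (marked (run w), labels (run w)) (tup m y)"
      using word_op_contraction[of w f G m] assms(8) G by simp
  qed
  then show "AE y in T m. wick_product \<sigma> lam ks f G (tup m y) =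
      (\<Sum>\<kappa>\<in>admissible ks. wick_contracted \<sigma> lam ?n \<kappa> f G (tup m y))"
  proof eventually_elim
    case (elim y)
    have "wick_product \<sigma> lam ks f G (tup m y) =
        (\<Sum>w\<in>product_words ks. ?term (marked (run w), labels (run w)) (tup m y))"
      unfolding wick_product_def words_op_def using elim by (intro sum.cong) auto
    also have "\<dots> = (\<Sum>p\<in>(SIGMA \<kappa>:admissible ks. normal_words (length (plus_blocks \<kappa>))). ?term p (tup m y))"
      by (rule sum.reindex_bij_betw[OF product_words_bij])
    also have "\<dots> = (\<Sum>\<kappa>\<in>admissible ks. \<Sum>w'\<in>normal_words (length (plus_blocks \<kappa>)). ?term (\<kappa>, w') (tup m y))"
      by (subst sum.Sigma) (auto simp: finite_admissible finite_normal_words split_beta')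
    finally show ?case unfolding wick_contracted_def wick_def words_op_def by simp
  qed
qed

end
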